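(* Let $(X,S)$ be a non-degenerate, involutive and braided "set-theoretical" solution of the quantum Yang-Baxter equation, where $X$ is a finite set. Let $G$ be the structure group of $(X,S)$ and let $M$ be the monoid with the same presentation. (i) The right least common multiple in $M$ of the generators (the elements of $X$) is a Garside element of $M$; that is, $G$ is Garside in the stronger sense that it is the group of fractions of a Garside monoid, namely $M$, in which the right lcm of the atoms is a Garside element. (ii) The homological dimension and the cohomological dimension of the group $G$ are bounded above by the cardinality of $X$.
   Context: Solutions. Let $X$ be a non-empty set and $S:X\times X\to X\times X$ a bijection, written $S(x,y)=(g_x(y),f_y(x))$. $(X,S)$ is non-degenerate if all the maps $f_x,g_x:X\to X$ are bijective; involutive if $S^2=\mathrm{id}$; braided if $S^{12}S^{23}S^{12}=S^{23}S^{12}S^{23}$ on $X^3$, where $S^{12}=S\times \mathrm{id}_X$, $S^{23}=\mathrm{id}_X\times S$. The structure group $G$ (resp. the monoid $M$ with the same presentation) is the group (resp. monoid) generated by $X$ with defining relations $xy=tz$ whenever $S(x,y)=(t,z)$. The atoms of $M$ are the elements of $X$. Garside monoids. $x$ is a left (resp. right) divisor of $z$ if $z=xt$ (resp. $z=tx$) for some $t$. A right lcm of a set of elements is an element having all of them as left divisors that is a left divisor of every element having all of them as left divisors; a left gcd is a common left divisor that every common left divisor left-divides; left lcm and right gcd are defined symmetrically. An atom is an $x\neq1$ such that $x=yz$ implies $y=1$ or $z=1$. A monoid is atomic if it is generated by its atoms and each element has a finite supremum of lengths of decompositions into atoms. It is Gaussian if it is atomic, left and right cancellative, and any two elements have left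 and right gcds and lcms. A Garside element is an element $\Delta$ whose left divisors coincide with its right divisors, are finite in number, and generate the monoid. A Garside monoid is a Gaussian monoid containing a Garside element. *)

theory Defs
  imports
    "HOL-Algebra.Divisibility"
    "HOL-Algebra.Module"
    "HOL-Algebra.AbelCoset"
    "HOL-Algebra.Generated_Groups"
    "HOL-Algebra.Free_Abelian_Groups"
    "HOL-Library.Extended_Nat"
begin

section \<open>Set-theoretical solutions of the quantum Yang-Baxter equation\<close>

text \<open>
  The underlying set \<open>X\<close> is a carrier set in an arbitrary type; only the values of \<open>S\<close> on
  \<open>X \<times> X\<close> matter. In the notation \<open>S (x, y) = (g\<^sub>x y, f\<^sub>y x)\<close>, the component \<open>fst\<close> is
  \<open>g\<^sub>x y\<close> and the component \<open>snd\<close> is \<open>f\<^sub>y x\<close>.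
\<close>

definition yb_solution :: "'x set \<Rightarrow> ('x \<times> 'x \<Rightarrow> 'x \<times> 'x) \<Rightarrow> bool" where
  "yb_solution X S \<longleftrightarrow> X \<noteq> {} \<and> bij_betw S (X \<times> X) (X \<times> X)"

definition non_degenerate :: "'x set \<Rightarrow> ('x \<times> 'x \<Rightarrow> 'x \<times> 'x) \<Rightarrow> bool" where
  "non_degenerate X S \<longleftrightarrow>
     (\<forall>x\<in>X. bij_betw (\<lambda>y. fst (S (x, y))) X X) \<and>
     (\<forall>y\<in>X. bij_betw (\<lambda>x. snd (S (x, y))) X X)"

definition involutive :: "'x set \<Rightarrow> ('x \<times> 'x \<Rightarrow> 'x \<times> 'x) \<Rightarrow> bool" where
  "involutive X S \<longleftrightarrow> (\<forall>p\<in>X \<times> X. S (S p) = p)"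

definition S12 :: "('x \<times> 'x \<Rightarrow> 'x \<times> 'x) \<Rightarrow> 'x \<times> 'x \<times> 'x \<Rightarrow> 'x \<times> 'x \<times> 'x" where
  "S12 S = (\<lambda>(x, y, z). (fst (S (x, y)), snd (S (x, y)), z))"

definition S23 :: "('x \<times> 'x \<Rightarrow> 'x \<times> 'x) \<Rightarrow> 'x \<times> 'x \<times> 'x \<Rightarrow> 'x \<times> 'x \<times> 'x" where
  "S23 S = (\<lambda>(x, y, z). (x, S (y, z)))"

definition braided :: "'x set \<Rightarrow> ('x \<times> 'x \<Rightarrow> 'x \<times> 'x) \<Rightarrow> bool" where
  "braided X S \<longleftrightarrow>
     (\<forall>p\<in>X \<times> X \<times> X. S12 S (S23 S (S12 S p)) = S23 S (S12 S (S23 S p)))"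


section \<open>Monoids and groups given by presentations\<close>

inductive_set word_cong :: "'l set \<Rightarrow> ('l list \<times> 'l list) set \<Rightarrow> ('l list \<times> 'l list) set"
  for A :: "'l set" and R :: "('l list \<times> 'l list) set" where
  cong_rel: "\<lbrakk>(u, v) \<in> R; u \<in> lists A; v \<in> lists A\<rbrakk> \<Longrightarrow> (u, v) \<in> word_cong A R"
| cong_refl: "u \<in> lists A \<Longrightarrow> (u, u) \<in> word_cong A R"
| cong_sym: "(u, v) \<in> word_cong A R \<Longrightarrow> (v, u) \<in> word_cong A R"
| cong_trans: "\<lbrakk>(u, v) \<in> word_cong A R; (v, w) \<in> word_cong A R\<rbrakk> \<Longrightarrow> (u, w) \<in> word_cong A R"
| cong_append: "\<lbrakk>(u, v) \<in> word_cong A R; (u', v') \<in> word_cong A R\<rbrakk>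
    \<Longrightarrow> (u @ u', v @ v') \<in> word_cong A R"

definition presented_monoid :: "'l set \<Rightarrow> ('l list \<times> 'l list) set \<Rightarrow> 'l list set monoid" where
  "presented_monoid A R =
     \<lparr>carrier = lists A // word_cong A R,
      monoid.mult = (\<lambda>U V. \<Union>u\<in>U. \<Union>v\<in>V. word_cong A R `` {u @ v}),
      one = word_cong A R `` {[]}\<rparr>"

text \<open>
  For groups the letters are \<open>(x, True)\<close>, standing for the generator \<open>x\<close>, and
  \<open>(x, False)\<close>, standing for its inverse.
\<close>

definition pos_word :: "'l list \<Rightarrow> ('l \<times> bool) list" where
  "pos_word = map (\<lambda>x. (x, True))"

definition group_relations ::
  "'l set \<Rightarrow> ('l list \<times> 'l list) set \<Rightarrow> (('l \<times> bool) list \<times> ('l \<times> bool) list) set" where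
  "group_relations A R =
     map_prod pos_word pos_word ` R \<union> {([(x, b), (x, \<not> b)], []) | x b. x \<in> A}"

definition presented_group ::
  "'l set \<Rightarrow> ('l list \<times> 'l list) set \<Rightarrow> ('l \<times> bool) list set monoid" where
  "presented_group A R = presented_monoid (A \<times> UNIV) (group_relations A R)"

definition yb_relations :: "'x set \<Rightarrow> ('x \<times> 'x \<Rightarrow> 'x \<times> 'x) \<Rightarrow> ('x list \<times> 'x list) set" where
  "yb_relations X S = {([x, y], [t, z]) | x y t z. x \<in> X \<and> y \<in> X \<and> S (x, y) = (t, z)}"

definition structure_monoid :: "'x set \<Rightarrow> ('x \<times> 'x \<Rightarrow> 'x \<times> 'x) \<Rightarrow> 'x list set monoid" where
  "structure_monoid X S = presented_monoid X (yb_relations X S)"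

definition structure_group ::
  "'x set \<Rightarrow> ('x \<times> 'x \<Rightarrow> 'x \<times> 'x) \<Rightarrow> ('x \<times> bool) list set monoid" where
  "structure_group X S = presented_group X (yb_relations X S)"

definition generators :: "'x set \<Rightarrow> ('x \<times> 'x \<Rightarrow> 'x \<times> 'x) \<Rightarrow> 'x list set set" where
  "generators X S = (\<lambda>x. word_cong X (yb_relations X S) `` {[x]}) ` X"

text \<open>The homomorphism from the monoid to the group that sends each generator to itself.\<close>

definition structure_map ::
  "'x set \<Rightarrow> ('x \<times> 'x \<Rightarrow> 'x \<times> 'x) \<Rightarrow> 'x list set \<Rightarrow> ('x \<times> bool) list set" where
  "structure_map X S U =
     (\<Union>u\<in>U. word_cong (X \<times> UNIV) (group_relations X (yb_relations X S)) `` {pos_word u})"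


section \<open>Garside monoids\<close>

text \<open>Left divisibility is the library's \<open>divides\<close>: \<open>z = x \<otimes> t\<close> for some \<open>t\<close>.\<close>

abbreviation left_divides :: "('a, 'b) monoid_scheme \<Rightarrow> 'a \<Rightarrow> 'a \<Rightarrow> bool" where
  "left_divides M x z \<equiv> x divides\<^bsub>M\<^esub> z"

definition right_divides :: "('a, 'b) monoid_scheme \<Rightarrow> 'a \<Rightarrow> 'a \<Rightarrow> bool" where
  "right_divides M x z \<longleftrightarrow> (\<exists>t\<in>carrier M. z = t \<otimes>\<^bsub>M\<^esub> x)"

definition is_right_lcm :: "('a, 'b) monoid_scheme \<Rightarrow> 'a set \<Rightarrow> 'a \<Rightarrow> bool" where
  "is_right_lcm M A z \<longleftrightarrow> z \<in> carrier M \<and> (\<forall>a\<in>A. left_divides M a z) \<and>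
     (\<forall>w\<in>carrier M. (\<forall>a\<in>A. left_divides M a w) \<longrightarrow> left_divides M z w)"

definition is_left_lcm :: "('a, 'b) monoid_scheme \<Rightarrow> 'a set \<Rightarrow> 'a \<Rightarrow> bool" where
  "is_left_lcm M A z \<longleftrightarrow> z \<in> carrier M \<and> (\<forall>a\<in>A. right_divides M a z) \<and>
     (\<forall>w\<in>carrier M. (\<forall>a\<in>A. right_divides M a w) \<longrightarrow> right_divides M z w)"

definition is_left_gcd :: "('a, 'b) monoid_scheme \<Rightarrow> 'a set \<Rightarrow> 'a \<Rightarrow> bool" where
  "is_left_gcd M A z \<longleftrightarrow> z \<in> carrier M \<and> (\<forall>a\<in>A. left_divides M z a) \<and>
     (\<forall>w\<in>carrier M. (\<forall>a\<in>A. left_divides M w a) \<longrightarrow> left_divides M w z)"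

definition is_right_gcd :: "('a, 'b) monoid_scheme \<Rightarrow> 'a set \<Rightarrow> 'a \<Rightarrow> bool" where
  "is_right_gcd M A z \<longleftrightarrow> z \<in> carrier M \<and> (\<forall>a\<in>A. right_divides M z a) \<and>
     (\<forall>w\<in>carrier M. (\<forall>a\<in>A. right_divides M w a) \<longrightarrow> right_divides M w z)"

definition atoms :: "('a, 'b) monoid_scheme \<Rightarrow> 'a set" where
  "atoms M = {x \<in> carrier M. x \<noteq> \<one>\<^bsub>M\<^esub> \<and>
     (\<forall>y\<in>carrier M. \<forall>z\<in>carrier M. x = y \<otimes>\<^bsub>M\<^esub> z \<longrightarrow> y = \<one>\<^bsub>M\<^esub> \<or> z = \<one>\<^bsub>M\<^esub>)}"

definition list_product :: "('a, 'b) monoid_scheme \<Rightarrow> 'a list \<Rightarrow> 'a" where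
  "list_product M xs = foldr (\<lambda>x y. x \<otimes>\<^bsub>M\<^esub> y) xs \<one>\<^bsub>M\<^esub>"

definition monoid_generated_by :: "('a, 'b) monoid_scheme \<Rightarrow> 'a set \<Rightarrow> bool" where
  "monoid_generated_by M A \<longleftrightarrow>
     A \<subseteq> carrier M \<and> (\<forall>x\<in>carrier M. \<exists>xs\<in>lists A. list_product M xs = x)"

definition atomic_monoid :: "('a, 'b) monoid_scheme \<Rightarrow> bool" where
  "atomic_monoid M \<longleftrightarrow> monoid M \<and> monoid_generated_by M (atoms M) \<and>
     (\<forall>x\<in>carrier M. bdd_above {length xs | xs. xs \<in> lists (atoms M) \<and> list_product M xs = x})"

definition gaussian_monoid :: "('a, 'b) monoid_scheme \<Rightarrow> bool" where
  "gaussian_monoid M \<longleftrightarrow> atomic_monoid M \<and> monoid_cancel M \<and>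
     (\<forall>x\<in>carrier M. \<forall>y\<in>carrier M.
        (\<exists>z. is_left_gcd M {x, y} z) \<and> (\<exists>z. is_right_gcd M {x, y} z) \<and>
        (\<exists>z. is_left_lcm M {x, y} z) \<and> (\<exists>z. is_right_lcm M {x, y} z))"

definition garside_element :: "('a, 'b) monoid_scheme \<Rightarrow> 'a \<Rightarrow> bool" where
  "garside_element M \<Delta> \<longleftrightarrow> \<Delta> \<in> carrier M \<and>
     {x \<in> carrier M. left_divides M x \<Delta>} = {x \<in> carrier M. right_divides M x \<Delta>} \<and>
     finite {x \<in> carrier M. left_divides M x \<Delta>} \<and>
     monoid_generated_by M {x \<in> carrier M. left_divides M x \<Delta>}"

definition garside_monoid :: "('a, 'b) monoid_scheme \<Rightarrow> bool" where
  "garside_monoid M \<longleftrightarrow> gaussian_monoid M \<and> (\<exists>\<Delta>. garside_element M \<Delta>)"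

text \<open>
  \<open>G\<close> is the group of fractions of \<open>M\<close> via \<open>h\<close>, both for left and for right fractions, as is
  the case for the group of fractions of a cancellative monoid satisfying the Ore conditions
  on both sides.
\<close>

definition group_of_fractions ::
  "('a, 'b) monoid_scheme \<Rightarrow> ('c, 'd) monoid_scheme \<Rightarrow> ('a \<Rightarrow> 'c) \<Rightarrow> bool" where
  "group_of_fractions M G h \<longleftrightarrow> group G \<and> h \<in> hom M G \<and> h \<one>\<^bsub>M\<^esub> = \<one>\<^bsub>G\<^esub> \<and>
     inj_on h (carrier M) \<and>
     (\<forall>g\<in>carrier G. \<exists>a\<in>carrier M. \<exists>b\<in>carrier M. g = h a \<otimes>\<^bsub>G\<^esub> inv\<^bsub>G\<^esub> (h b)) \<and>
     (\<forall>g\<in>carrier G. \<exists>a\<in>carrier M. \<exists>b\<in>carrier M. g = inv\<^bsub>G\<^esub> (h a) \<otimes>\<^bsub>G\<^esub> h b)"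


section \<open>Modules over a not necessarily commutative ring\<close>

text \<open>
  The library's locale \<open>module\<close> requires a commutative ring of scalars; its record type is
  reused here. The fields \<open>mult\<close> and \<open>one\<close> of the record of a module play no role.
\<close>

locale left_module = R?: ring R + M?: abelian_group M
  for R :: "'r ring" (structure) and M :: "('r, 'm) module" (structure) +
  assumes smult_closed:
      "\<lbrakk>a \<in> carrier R; x \<in> carrier M\<rbrakk> \<Longrightarrow> a \<odot>\<^bsub>M\<^esub> x \<in> carrier M"
    and smult_l_distr:
      "\<lbrakk>a \<in> carrier R; b \<in> carrier R; x \<in> carrier M\<rbrakk> \<Longrightarrow>
       (a \<oplus>\<^bsub>R\<^esub> b) \<odot>\<^bsub>M\<^esub> x = a \<odot>\<^bsub>M\<^esub> x \<oplus>\<^bsub>M\<^esub> b \<odot>\<^bsub>M\<^esub> x"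
    and smult_r_distr:
      "\<lbrakk>a \<in> carrier R; x \<in> carrier M; y \<in> carrier M\<rbrakk> \<Longrightarrow>
       a \<odot>\<^bsub>M\<^esub> (x \<oplus>\<^bsub>M\<^esub> y) = a \<odot>\<^bsub>M\<^esub> x \<oplus>\<^bsub>M\<^esub> a \<odot>\<^bsub>M\<^esub> y"
    and smult_assoc:
      "\<lbrakk>a \<in> carrier R; b \<in> carrier R; x \<in> carrier M\<rbrakk> \<Longrightarrow>
       (a \<otimes>\<^bsub>R\<^esub> b) \<odot>\<^bsub>M\<^esub> x = a \<odot>\<^bsub>M\<^esub> (b \<odot>\<^bsub>M\<^esub> x)"
    and smult_one: "x \<in> carrier M \<Longrightarrow> \<one>\<^bsub>R\<^esub> \<odot>\<^bsub>M\<^esub> x = x"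

definition opposite_ring :: "'r ring \<Rightarrow> 'r ring" where
  "opposite_ring R = R\<lparr>monoid.mult := (\<lambda>a b. b \<otimes>\<^bsub>R\<^esub> a)\<rparr>"

text \<open>In a right module the term \<open>a \<odot>\<^bsub>M\<^esub> x\<close> denotes the element usually written \<open>x a\<close>.\<close>

abbreviation right_module :: "'r ring \<Rightarrow> ('r, 'm) module \<Rightarrow> bool" where
  "right_module R M \<equiv> left_module (opposite_ring R) M"

definition module_hom :: "'r ring \<Rightarrow> ('r, 'm) module \<Rightarrow> ('r, 'n) module \<Rightarrow> ('m \<Rightarrow> 'n) set" where
  "module_hom R M N = {f \<in> carrier M \<rightarrow> carrier N.
     (\<forall>x\<in>carrier M. \<forall>y\<in>carrier M. f (x \<oplus>\<^bsub>M\<^esub> y) = f x \<oplus>\<^bsub>N\<^esub> f y) \<and>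
     (\<forall>a\<in>carrier R. \<forall>x\<in>carrier M. f (a \<odot>\<^bsub>M\<^esub> x) = a \<odot>\<^bsub>N\<^esub> f x)}"

text \<open>
  Projectivity is the lifting property along surjections. A definition cannot quantify over
  all types, so the modules \<open>A\<close> and \<open>B\<close> are carried by the type \<open>'m \<Rightarrow> 'r\<close>. This loses
  nothing: that type carries the free module on the set \<open>carrier P\<close>, as well as a copy of
  \<open>P\<close> itself, and \<open>P\<close> is projective as soon as the identity of \<open>P\<close> lifts along the
  surjection of this free module onto \<open>P\<close>.
\<close>

definition projective_module :: "'r ring \<Rightarrow> ('r, 'm) module \<Rightarrow> bool" where
  "projective_module R P \<longleftrightarrow> left_module R P \<and>
     (\<forall>(A :: ('r, 'm \<Rightarrow> 'r) module) (B :: ('r, 'm \<Rightarrow> 'r) module) p f.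
        left_module R A \<and> left_module R B \<and>
        p \<in> module_hom R A B \<and> p ` carrier A = carrier B \<and> f \<in> module_hom R P B \<longrightarrow>
        (\<exists>g\<in>module_hom R P A. \<forall>x\<in>carrier P. p (g x) = f x))"

text \<open>
  The tensor product of a right module \<open>A\<close> and a left module \<open>F\<close>: the free abelian group on
  \<open>A \<times> F\<close> modulo the subgroup generated by the biadditivity and balancing relations.
\<close>

definition tensor_relations ::
  "'r ring \<Rightarrow> ('r, 'a) module \<Rightarrow> ('r, 'm) module \<Rightarrow> ('a \<times> 'm \<Rightarrow>\<^sub>0 int) set" where
  "tensor_relations R A F =
     {frag_of (a \<oplus>\<^bsub>A\<^esub> b, x) - frag_of (a, x) - frag_of (b, x) | a b x.
        a \<in> carrier A \<and> b \<in> carrier A \<and> x \<in> carrier F} \<union>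
     {frag_of (a, x \<oplus>\<^bsub>F\<^esub> y) - frag_of (a, x) - frag_of (a, y) | a x y.
        a \<in> carrier A \<and> x \<in> carrier F \<and> y \<in> carrier F} \<union>
     {frag_of (r \<odot>\<^bsub>A\<^esub> a, x) - frag_of (a, r \<odot>\<^bsub>F\<^esub> x) | r a x.
        r \<in> carrier R \<and> a \<in> carrier A \<and> x \<in> carrier F}"

definition tensor_subgroup ::
  "'r ring \<Rightarrow> ('r, 'a) module \<Rightarrow> ('r, 'm) module \<Rightarrow> ('a \<times> 'm \<Rightarrow>\<^sub>0 int) set" where
  "tensor_subgroup R A F =
     generate (free_Abelian_group (carrier A \<times> carrier F)) (tensor_relations R A F)"

definition tensor_product ::
  "'r ring \<Rightarrow> ('r, 'a) module \<Rightarrow> ('r, 'm) module \<Rightarrow> ('a \<times> 'm \<Rightarrow>\<^sub>0 int) set monoid" where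
  "tensor_product R A F =
     free_Abelian_group (carrier A \<times> carrier F) Mod tensor_subgroup R A F"

text \<open>The map from \<open>A \<otimes> F\<close> to \<open>B \<otimes> F\<close> induced by a homomorphism \<open>h\<close> from \<open>A\<close> to \<open>B\<close>.\<close>

definition tensor_map ::
  "'r ring \<Rightarrow> ('r, 'b) module \<Rightarrow> ('r, 'm) module \<Rightarrow> ('a \<Rightarrow> 'b) \<Rightarrow>
     ('a \<times> 'm \<Rightarrow>\<^sub>0 int) set \<Rightarrow> ('b \<times> 'm \<Rightarrow>\<^sub>0 int) set" where
  "tensor_map R B F h C =
     the_elem ((\<lambda>c. tensor_subgroup R B F #>\<^bsub>free_Abelian_group (carrier B \<times> carrier F)\<^esub>
                      frag_extend (\<lambda>(a, x). frag_of (h a, x)) c) ` C)"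

text \<open>
  Flatness: tensoring preserves injectivity. Again the test modules are carried by the type
  \<open>'m \<Rightarrow> 'r\<close>, which loses nothing: it carries copies of the right module \<open>R\<close> and of all right
  ideals, and \<open>F\<close> is flat as soon as tensoring with \<open>F\<close> preserves the injectivity of the
  inclusions of the right ideals into \<open>R\<close>.
\<close>

definition flat_module :: "'r ring \<Rightarrow> ('r, 'm) module \<Rightarrow> bool" where
  "flat_module R F \<longleftrightarrow> left_module R F \<and>
     (\<forall>(A :: ('r, 'm \<Rightarrow> 'r) module) (B :: ('r, 'm \<Rightarrow> 'r) module) h.
        right_module R A \<and> right_module R B \<and>
        h \<in> module_hom (opposite_ring R) A B \<and> inj_on h (carrier A) \<longrightarrow>
        inj_on (tensor_map R B F h) (carrier (tensor_product R A F)))"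

text \<open>Exactness of \<open>\<dots> \<rightarrow> P 2 \<rightarrow> P 1 \<rightarrow> P 0 \<rightarrow> M \<rightarrow> 0\<close>.\<close>

definition is_resolution ::
  "'r ring \<Rightarrow> (nat \<Rightarrow> ('r, 'p) module) \<Rightarrow> (nat \<Rightarrow> 'p \<Rightarrow> 'p) \<Rightarrow> ('p \<Rightarrow> 'm) \<Rightarrow>
     ('r, 'm) module \<Rightarrow> bool" where
  "is_resolution R P d \<epsilon> M \<longleftrightarrow>
     left_module R M \<and> (\<forall>i. left_module R (P i)) \<and>
     \<epsilon> \<in> module_hom R (P 0) M \<and> (\<forall>i. d i \<in> module_hom R (P (Suc i)) (P i)) \<and>
     \<epsilon> ` carrier (P 0) = carrier M \<and>
     d 0 ` carrier (P 1) = a_kernel (P 0) M \<epsilon> \<and>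
     (\<forall>i. d (Suc i) ` carrier (P (Suc (Suc i))) = a_kernel (P (Suc i)) (P i) (d i))"

text \<open>
  Projective (flat) dimension: the least \<open>n\<close> for which there is a projective (flat)
  resolution with \<open>P i = 0\<close> for all \<open>i > n\<close>, or \<open>\<infinity>\<close>. The modules \<open>P i\<close> are carried by the
  type \<open>('m \<times> 'r) list\<close>, which loses nothing: this type is infinite and at least as large as
  \<open>'m\<close> and \<open>'r\<close>, hence it carries copies of the free modules obtained by iteratively
  resolving \<open>M\<close>, and if any resolution of length \<open>n\<close> exists, then the kernel at stage \<open>n\<close> of
  this particular one is projective (flat).
\<close>

definition projective_dimension :: "'r ring \<Rightarrow> ('r, 'm) module \<Rightarrow> enat" where
  "projective_dimension R M =
     Inf (enat ` {n. \<exists>(P :: nat \<Rightarrow> ('r, ('m \<times> 'r) list) module) d \<epsilon>.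
        is_resolution R P d \<epsilon> M \<and> (\<forall>i. projective_module R (P i)) \<and>
        (\<forall>i>n. carrier (P i) = {\<zero>\<^bsub>P i\<^esub>})})"

definition flat_dimension :: "'r ring \<Rightarrow> ('r, 'm) module \<Rightarrow> enat" where
  "flat_dimension R M =
     Inf (enat ` {n. \<exists>(P :: nat \<Rightarrow> ('r, ('m \<times> 'r) list) module) d \<epsilon>.
        is_resolution R P d \<epsilon> M \<and> (\<forall>i. flat_module R (P i)) \<and>
        (\<forall>i>n. carrier (P i) = {\<zero>\<^bsub>P i\<^esub>})})"


section \<open>Homological and cohomological dimension of a group\<close>

definition group_ring :: "('g, 'b) monoid_scheme \<Rightarrow> ('g \<Rightarrow>\<^sub>0 int) ring" where
  "group_ring G =
     \<lparr>carrier = {a. Poly_Mapping.keys a \<subseteq> carrier G},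
      monoid.mult = (\<lambda>a b. frag_extend (\<lambda>g. frag_extend (\<lambda>h. frag_of (g \<otimes>\<^bsub>G\<^esub> h)) b) a),
      one = frag_of \<one>\<^bsub>G\<^esub>,
      ring.zero = 0,
      add = (+)\<rparr>"

text \<open>The integers with trivial action: a group ring element acts through its augmentation.\<close>

definition trivial_module :: "('g \<Rightarrow>\<^sub>0 int, int) module" where
  "trivial_module =
     \<lparr>carrier = UNIV,
      monoid.mult = (*),
      one = 1,
      ring.zero = 0,
      add = (+),
      smult = (\<lambda>a n. (\<Sum>g\<in>Poly_Mapping.keys a. Poly_Mapping.lookup a g) * n)\<rparr>"

definition cohomological_dimension :: "('g, 'b) monoid_scheme \<Rightarrow> enat" where
  "cohomological_dimension G = projective_dimension (group_ring G) trivial_module"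

definition homological_dimension :: "('g, 'b) monoid_scheme \<Rightarrow> enat" where
  "homological_dimension G = flat_dimension (group_ring G) trivial_module"

end

theory Submission
  imports Defs
begin

text \<open>
  For \<open>x \<in> X\<close> let \<open>e\<^sub>x\<close> be the basis vector of \<open>\<int>\<^sup>X\<close> at \<open>x\<close>. The generator \<open>x\<close> acts on
  \<open>\<int>\<^sup>X\<close> by the affine bijection \<open>v \<mapsto> e\<^sub>x + v \<circ> g\<^sub>x\<inverse>\<close>. Involutivity (for the translation parts) and
  the braid relation (for the linear parts) say that these maps satisfy the defining relations,
  so the structure group \<open>G\<close> acts on \<open>\<int>\<^sup>X\<close>. Everything is read off from the orbit of the origin.

  For a positive word \<open>w\<close> let \<open>vec w\<close> be the image of the origin. If \<open>vec w\<close> is positive at \<open>t\<close>,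
  the letter \<open>t\<close> can be pulled to the front of \<open>w\<close> by the relations (\<open>pull_letter\<close>). It follows
  that \<open>vec\<close> is an isomorphism from \<open>M\<close>, ordered by left divisibility, onto \<open>\<nat>\<^sup>X\<close> with the
  pointwise order (\<open>prefix_iff\<close>, \<open>vec_eq_iff\<close>, \<open>vec_surj\<close>). So left gcds are pointwise minima,
  right lcms are pointwise maxima, and left cancellation holds because \<open>G\<close> acts by bijections.
  The opposite monoid of \<open>M\<close> is the structure monoid of the opposite solution, which gives the
  same statements on the other side. The right lcm \<open>\<Delta>\<close> of the generators is the all-ones vector.
  Since \<open>vec (u \<Delta>) \<ge> vec \<Delta>\<close> for every word \<open>u\<close>, every \<open>u \<Delta>\<close> has the form \<open>\<Delta> v\<close>; with cancellation this
  shows that right divisors of \<open>\<Delta>\<close> are left divisors, and a count gives equality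
  (\<open>garside_\<Delta>\<close>).

  Common multiples turn every element of \<open>G\<close> into a fraction, on either side. Two elements that move the
  origin to the same point differ by a fraction \<open>a\<inverse> b\<close> with \<open>vec a = vec b\<close>, and large powers
  of \<open>\<Delta>\<close> move any vector into \<open>\<nat>\<^sup>X\<close>. Hence \<open>G\<close> acts simply transitively on \<open>\<int>\<^sup>X\<close>, each element acting
  by a permutation of the coordinates followed by a translation (\<open>gpos_bij\<close>, \<open>gpos_mult\<close>).

  This action yields the dimension bounds. It preserves the pointwise order, hence the simplicial complex
  whose simplices are the chains \<open>v\<^sub>0 < \<dots> < v\<^sub>k \<le> v\<^sub>0 + (1, \<dots>, 1)\<close>; this is the standard triangulation of
  \<open>\<real>\<^sup>X\<close> that subdivides the unit cubes. A simplex has at most \<open>card X + 1\<close> vertices. The vertices of a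
  simplex are ordered, and the order is respected by \<open>G\<close>, so that no orientation signs
  enter. The group permutes the simplices freely with finitely many orbits. The complex is acyclic: in a finite
  piece of the lattice remove the vertices one after the other, the largest coordinate sums
  first; the link of the removed vertex in what remains is a cone (\<open>acyclic_cliques_lattice\<close>). Therefore the
  augmented chain complex is a resolution of \<open>\<int>\<close> of length \<open>card X\<close> by finitely generated
  free modules over the group ring. Such modules have a finite dual basis, and a
  finite dual basis makes a module projective and flat.
\<close>

section \<open>Presented monoids and groups\<close>

definition word_class :: "'l set \<Rightarrow> ('l list \<times> 'l list) set \<Rightarrow> 'l list \<Rightarrow> 'l list set" where
  "word_class A R u = word_cong A R `` {u}"

text \<open>
  Membership of words in \<open>lists A\<close> is decomposed along \<open>[]\<close>, \<open>#\<close> and \<open>@\<close> below; rewriting it into a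
  statement about the set of letters would hide this structure.
\<close>

declare in_lists_conv_set [simp del] in_listsD [rule del] in_listsI [rule del]

lemma word_cong_closed: "(u, v) \<in> word_cong A R \<Longrightarrow> u \<in> lists A \<and> v \<in> lists A"
  by (induction rule: word_cong.induct) auto

lemma equiv_word_cong: "equiv (lists A) (word_cong A R)"
proof (intro equivI refl_onI symI transI)
  show "word_cong A R \<subseteq> lists A \<times> lists A" using word_cong_closed by fast
qed (blast intro: word_cong.intros)+

lemma word_class_eq_iff:
  "u \<in> lists A \<Longrightarrow> v \<in> lists A \<Longrightarrow> word_class A R u = word_class A R v \<longleftrightarrow> (u, v) \<in> word_cong A R"
  unfolding word_class_def by (rule eq_equiv_class_iff[OF equiv_word_cong])

lemma word_class_self: "u \<in> lists A \<Longrightarrow> u \<in> word_class A R u"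
  by (simp add: word_class_def word_cong.cong_refl)

lemma carrier_presented_monoid: "carrier (presented_monoid A R) = word_class A R ` lists A"
  by (auto simp: presented_monoid_def quotient_def word_class_def)

lemma word_class_closed [simp, intro]:
  "u \<in> lists A \<Longrightarrow> word_class A R u \<in> carrier (presented_monoid A R)"
  by (simp add: carrier_presented_monoid)

lemma one_presented_monoid: "\<one>\<^bsub>presented_monoid A R\<^esub> = word_class A R []"
  by (simp add: presented_monoid_def word_class_def)

text \<open>
  The union in the definition of the product collapses to a single class, because congruent factors
  have congruent products.
\<close>

lemma mult_presented_monoid:
  assumes "u \<in> lists A" "v \<in> lists A"
  shows "word_class A R u \<otimes>\<^bsub>presented_monoid A R\<^esub> word_class A R v = word_class A R (u @ v)"
proof -
  have "word_class A R (u' @ v') = word_class A R (u @ v)"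
    if "u' \<in> word_class A R u" "v' \<in> word_class A R v" for u' v'
  proof -
    have "(u, u') \<in> word_cong A R" "(v, v') \<in> word_cong A R"
      using that by (auto simp: word_class_def)
    then have "(u @ v, u' @ v') \<in> word_cong A R" by (rule word_cong.cong_append)
    then show ?thesis
      using word_cong_closed[of "u @ v" "u' @ v'"]
      by (subst word_class_eq_iff) (blast intro: word_cong.cong_sym)+
  qed
  moreover have "u \<in> word_class A R u" "v \<in> word_class A R v"
    using assms word_class_self by auto
  moreover have "word_class A R u \<otimes>\<^bsub>presented_monoid A R\<^esub> word_class A R v =
      (\<Union>u'\<in>word_class A R u. \<Union>v'\<in>word_class A R v. word_class A R (u' @ v'))"
    by (simp add: presented_monoid_def word_class_def)
  ultimately show ?thesis by blast
qed

lemma monoid_presented_monoid: "monoid (presented_monoid A R)"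
proof -
  show ?thesis
    by unfold_locales (auto simp: carrier_presented_monoid one_presented_monoid mult_presented_monoid)
qed

definition formal_inverse :: "('l \<times> bool) list \<Rightarrow> ('l \<times> bool) list" where
  "formal_inverse w = rev (map (\<lambda>(x, b). (x, \<not> b)) w)"

lemma formal_inverse_lists: "w \<in> lists (A \<times> UNIV) \<Longrightarrow> formal_inverse w \<in> lists (A \<times> UNIV)"
  by (auto simp: formal_inverse_def in_lists_conv_set)

lemma formal_inverse_involutive [simp]: "formal_inverse (formal_inverse w) = w"
  by (simp add: formal_inverse_def rev_map comp_def case_prod_beta)

lemma formal_inverse_right:
  assumes "w \<in> lists (A \<times> UNIV)"
  shows "(w @ formal_inverse w, []) \<in> word_cong (A \<times> UNIV) (group_relations A R)"
  using assms
proof (induction w rule: list.induct)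
  case Nil
  then show ?case by (simp add: formal_inverse_def word_cong.cong_refl)
next
  case (Cons l w)
  obtain x b where l: "l = (x, b)" by (cases l)
  then have "x \<in> A" using Cons.prems by simp
  have w: "w \<in> lists (A \<times> UNIV)" using Cons.prems by simp
  let ?C = "word_cong (A \<times> UNIV) (group_relations A R)"
  have "([(x, b)] @ (w @ formal_inverse w) @ [(x, \<not> b)], [(x, b)] @ [] @ [(x, \<not> b)]) \<in> ?C"
    using \<open>x \<in> A\<close> Cons.IH[OF w] by (intro word_cong.cong_append word_cong.cong_refl) auto
  moreover have "([(x, b), (x, \<not> b)], []) \<in> ?C"
    using \<open>x \<in> A\<close> by (intro word_cong.cong_rel) (auto simp: group_relations_def)
  ultimately show ?case
    using word_cong.cong_trans[of "(x, b) # w @ formal_inverse w @ [(x, \<not> b)]"]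
    by (simp add: formal_inverse_def l)
qed

lemma formal_inverse_left:
  assumes "w \<in> lists (A \<times> UNIV)"
  shows "(formal_inverse w @ w, []) \<in> word_cong (A \<times> UNIV) (group_relations A R)"
  using formal_inverse_right[OF formal_inverse_lists[OF assms], of R] by simp

lemma group_presented_group: "group (presented_group A R)"
  unfolding presented_group_def
proof (rule monoid.group_l_invI[OF monoid_presented_monoid])
  let ?M = "presented_monoid (A \<times> UNIV) (group_relations A R)"
  fix U assume "U \<in> carrier ?M"
  then obtain w where w: "w \<in> lists (A \<times> UNIV)" "U = word_class (A \<times> UNIV) (group_relations A R) w"
    by (auto simp: carrier_presented_monoid)
  have "word_class (A \<times> UNIV) (group_relations A R) (formal_inverse w) \<otimes>\<^bsub>?M\<^esub> U = \<one>\<^bsub>?M\<^esub>"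
    using formal_inverse_left[OF w(1), of R] formal_inverse_lists[OF w(1)] w
    by (simp add: mult_presented_monoid one_presented_monoid word_class_eq_iff)
  then show "\<exists>V\<in>carrier ?M. V \<otimes>\<^bsub>?M\<^esub> U = \<one>\<^bsub>?M\<^esub>"
    using formal_inverse_lists[OF w(1)] by blast
qed

lemma pos_word_lists: "u \<in> lists A \<Longrightarrow> pos_word u \<in> lists (A \<times> UNIV)"
  by (auto simp: pos_word_def in_lists_conv_set)

lemma pos_word_append [simp]: "pos_word (u @ v) = pos_word u @ pos_word v"
  and pos_word_Nil [simp]: "pos_word [] = []"
  and pos_word_Cons [simp]: "pos_word (x # u) = (x, True) # pos_word u"
  by (simp_all add: pos_word_def)

lemma pos_word_cong:
  "(u, v) \<in> word_cong A R \<Longrightarrow> (pos_word u, pos_word v) \<in> word_cong (A \<times> UNIV) (group_relations A R)"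
proof (induction rule: word_cong.induct)
  case (cong_rel u v)
  then show ?case
    by (intro word_cong.cong_rel pos_word_lists) (auto simp: group_relations_def)
qed (auto intro: word_cong.intros pos_word_lists)

lemma rev_lists [simp]: "rev u \<in> lists A \<longleftrightarrow> u \<in> lists A"
  by (simp add: in_lists_conv_set)

lemma rev_word_cong:
  assumes "(u, v) \<in> word_cong A R" and R: "\<And>u v. (u, v) \<in> R \<Longrightarrow> (rev u, rev v) \<in> R'"
  shows "(rev u, rev v) \<in> word_cong A R'"
  using assms(1) by induction (auto intro: word_cong.intros R)

section \<open>Anti-isomorphisms exchange left and right divisibility\<close>

text \<open>
  Reversing the words of a presentation reverses products. The locale isolates what follows for
  divisibility, so that the lattice structure of right divisibility can be copied from the left.
\<close>

locale anti_isomorphism =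
  fixes M :: "('a, 'c) monoid_scheme" and N :: "('b, 'd) monoid_scheme" and \<rho> :: "'a \<Rightarrow> 'b"
  assumes bij: "bij_betw \<rho> (carrier M) (carrier N)"
    and anti: "x \<in> carrier M \<Longrightarrow> y \<in> carrier M \<Longrightarrow> \<rho> (x \<otimes>\<^bsub>M\<^esub> y) = \<rho> y \<otimes>\<^bsub>N\<^esub> \<rho> x"
    and closed: "x \<in> carrier M \<Longrightarrow> y \<in> carrier M \<Longrightarrow> x \<otimes>\<^bsub>M\<^esub> y \<in> carrier M"
begin

lemma \<rho>_closed: "x \<in> carrier M \<Longrightarrow> \<rho> x \<in> carrier N"
  using bij by (auto simp: bij_betw_def)

lemma \<rho>_surj: "y \<in> carrier N \<Longrightarrow> \<exists>x\<in>carrier M. y = \<rho> x"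
  using bij by (auto simp: bij_betw_def)

lemma \<rho>_eq: "x \<in> carrier M \<Longrightarrow> y \<in> carrier M \<Longrightarrow> \<rho> x = \<rho> y \<longleftrightarrow> x = y"
  using bij by (auto simp: bij_betw_def inj_on_def)

lemma right_divides_iff:
  assumes "x \<in> carrier M" "z \<in> carrier M"
  shows "right_divides M x z \<longleftrightarrow> left_divides N (\<rho> x) (\<rho> z)"
proof
  assume "right_divides M x z"
  then obtain t where "t \<in> carrier M" "z = t \<otimes>\<^bsub>M\<^esub> x" by (auto simp: right_divides_def)
  then show "left_divides N (\<rho> x) (\<rho> z)"
    using assms anti \<rho>_closed unfolding factor_def by blast
next
  assume "left_divides N (\<rho> x) (\<rho> z)"
  then obtain s where "s \<in> carrier N" "\<rho> z = \<rho> x \<otimes>\<^bsub>N\<^esub> s" by (auto simp: factor_def)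
  moreover then obtain t where "t \<in> carrier M" "s = \<rho> t" using \<rho>_surj by blast
  ultimately have "\<rho> z = \<rho> (t \<otimes>\<^bsub>M\<^esub> x)" "t \<in> carrier M" using assms anti by auto
  then show "right_divides M x z"
    using assms closed \<rho>_eq unfolding right_divides_def by blast
qed

lemma is_left_lcm_iff:
  assumes "A \<subseteq> carrier M" "z \<in> carrier M"
  shows "is_left_lcm M A z \<longleftrightarrow> is_right_lcm N (\<rho> ` A) (\<rho> z)"
proof -
  have "(\<forall>w\<in>carrier N. (\<forall>a\<in>A. left_divides N (\<rho> a) w) \<longrightarrow> left_divides N (\<rho> z) w) \<longleftrightarrow>
      (\<forall>w\<in>carrier M. (\<forall>a\<in>A. left_divides N (\<rho> a) (\<rho> w)) \<longrightarrow> left_divides N (\<rho> z) (\<rho> w))"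
    unfolding bij_betw_imp_surj_on[OF bij, symmetric] by simp
  then show ?thesis
    using assms \<rho>_closed unfolding is_left_lcm_def is_right_lcm_def
    by (auto simp: right_divides_iff subset_iff)
qed

lemma is_right_gcd_iff:
  assumes "A \<subseteq> carrier M" "z \<in> carrier M"
  shows "is_right_gcd M A z \<longleftrightarrow> is_left_gcd N (\<rho> ` A) (\<rho> z)"
proof -
  have "(\<forall>w\<in>carrier N. (\<forall>a\<in>A. left_divides N w (\<rho> a)) \<longrightarrow> left_divides N w (\<rho> z)) \<longleftrightarrow>
      (\<forall>w\<in>carrier M. (\<forall>a\<in>A. left_divides N (\<rho> w) (\<rho> a)) \<longrightarrow> left_divides N (\<rho> w) (\<rho> z))"
    unfolding bij_betw_imp_surj_on[OF bij, symmetric] by simp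
  then show ?thesis
    using assms \<rho>_closed unfolding is_right_gcd_def is_left_gcd_def
    by (auto simp: right_divides_iff subset_iff)
qed

end

text \<open>
  A common right multiple \<open>x p = u q\<close> turns a left fraction into a right fraction, and vice versa.
\<close>

lemma (in group) fraction_swap:
  assumes "x \<in> carrier G" "p \<in> carrier G" "u \<in> carrier G" "q \<in> carrier G"
    and eq: "x \<otimes> p = u \<otimes> q"
  shows "inv x \<otimes> u = p \<otimes> inv q"
proof -
  have "inv x \<otimes> u = inv x \<otimes> (u \<otimes> q) \<otimes> inv q"
    using assms(1-4) by (simp add: m_assoc)
  also have "\<dots> = inv x \<otimes> (x \<otimes> p) \<otimes> inv q" by (simp only: eq)
  also have "\<dots> = p \<otimes> inv q"
    using assms(1-4) by (simp add: m_assoc[symmetric])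
  finally show ?thesis .
qed

section \<open>The structure monoid as a lattice\<close>

locale yang_baxter =
  fixes X :: "'x set" and S :: "'x \<times> 'x \<Rightarrow> 'x \<times> 'x"
  assumes finite_X: "finite X"
    and solution: "yb_solution X S"
    and non_degenerate: "non_degenerate X S"
    and involutive: "involutive X S"
    and braided: "braided X S"
begin

abbreviation "g x y \<equiv> fst (S (x, y))"
abbreviation "f y x \<equiv> snd (S (x, y))"

lemma S_closed: "x \<in> X \<Longrightarrow> y \<in> X \<Longrightarrow> g x y \<in> X \<and> f y x \<in> X"
  using solution unfolding yb_solution_def bij_betw_def by (metis SigmaI image_eqI mem_Times_iff)

lemma S_S: "x \<in> X \<Longrightarrow> y \<in> X \<Longrightarrow> S (g x y, f y x) = (x, y)"
  using involutive by (simp add: involutive_def)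

lemma g_bij: "x \<in> X \<Longrightarrow> bij_betw (g x) X X"
  using non_degenerate by (simp add: non_degenerate_def)

lemma f_bij: "y \<in> X \<Longrightarrow> bij_betw (f y) X X"
  using non_degenerate by (simp add: non_degenerate_def)

lemma yang_baxter_equation:
  assumes "x \<in> X" "y \<in> X" "z \<in> X"
  shows "S12 S (S23 S (S12 S (x, y, z))) = S23 S (S12 S (S23 S (x, y, z)))"
  using braided assms unfolding braided_def by blast

lemma braid:
  assumes "x \<in> X" "y \<in> X" "z \<in> X"
  shows "g (g x y) (g (f y x) z) = g x (g y z)"
  using yang_baxter_equation[OF assms] by (simp add: S12_def S23_def case_prod_beta)

text \<open>
  The map \<open>g x\<close> is extended by the identity outside \<open>X\<close>, so that it permutes the coordinates of all
  functions on the type.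
\<close>

definition perm :: "'x \<Rightarrow> 'x \<Rightarrow> 'x" where
  "perm x y = (if y \<in> X then g x y else y)"

definition perm_inv :: "'x \<Rightarrow> 'x \<Rightarrow> 'x" where
  "perm_inv x = inv_into UNIV (perm x)"

lemma perm_bij: "x \<in> X \<Longrightarrow> bij (perm x)"
proof -
  assume x: "x \<in> X"
  have "bij_betw (perm x) X X"
    using g_bij[OF x] by (rule bij_betw_cong[THEN iffD1, rotated]) (simp add: perm_def)
  moreover have "bij_betw (perm x) (- X) (- X)"
    by (rule bij_betw_cong[THEN iffD1, rotated, OF bij_betw_id]) (simp add: perm_def)
  ultimately have "bij_betw (perm x) (X \<union> - X) (X \<union> - X)"
    by (rule bij_betw_combine) auto
  then show "bij (perm x)" by simp
qed

lemma perm_in_X [simp]: "x \<in> X \<Longrightarrow> perm x y \<in> X \<longleftrightarrow> y \<in> X"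
  using S_closed by (auto simp: perm_def)

lemma perm_perm_inv [simp]: "x \<in> X \<Longrightarrow> perm x (perm_inv x y) = y"
  unfolding perm_inv_def using perm_bij[of x] by (simp add: bij_is_surj surj_f_inv_f)

lemma perm_inv_perm [simp]: "x \<in> X \<Longrightarrow> perm_inv x (perm x y) = y"
  unfolding perm_inv_def using perm_bij[of x] by (simp add: bij_is_inj)

lemma perm_inv_in_X [simp]: "x \<in> X \<Longrightarrow> perm_inv x y \<in> X \<longleftrightarrow> y \<in> X"
  using perm_in_X[of x "perm_inv x y"] by simp

lemma perm_inv_bij: "x \<in> X \<Longrightarrow> bij (perm_inv x)"
  unfolding perm_inv_def using perm_bij bij_imp_bij_inv by blast

lemma perm_inv_eq: "x \<in> X \<Longrightarrow> perm_inv x u = y \<longleftrightarrow> u = perm x y"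
  by auto

text \<open>
  The defining relation \<open>x y = (g x y) (f y x)\<close> is respected by \<open>x \<mapsto> perm x\<close>: this is the first component
  of the braid relation.
\<close>

lemma perm_braid:
  assumes "x \<in> X" "y \<in> X"
  shows "perm (g x y) (perm (f y x) z) = perm x (perm y z)"
  using assms S_closed braid[of x y z] by (auto simp: perm_def)

subsection \<open>Action on integer vectors\<close>

text \<open>
  The generator \<open>x\<close> sends a vector \<open>a\<close> to \<open>e\<^sub>x + a \<circ> g\<^sub>x\<inverse>\<close>; the letter \<open>(x, False)\<close> acts by the inverse of
  this bijection.
\<close>

fun letter_action :: "'x \<times> bool \<Rightarrow> ('x \<Rightarrow> int) \<Rightarrow> ('x \<Rightarrow> int)" where
  "letter_action (x, True) a = (\<lambda>y. a (perm_inv x y) + (if y = x then 1 else 0))"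
| "letter_action (x, False) a = (\<lambda>y. a (perm x y) - (if perm x y = x then 1 else 0))"

definition word_action :: "('x \<times> bool) list \<Rightarrow> ('x \<Rightarrow> int) \<Rightarrow> ('x \<Rightarrow> int)" where
  "word_action = foldr letter_action"

lemma word_action_simps [simp]:
  "word_action [] a = a" "word_action (l # w) a = letter_action l (word_action w a)"
  "word_action (u @ v) a = word_action u (word_action v a)"
  by (simp_all add: word_action_def)

lemma letter_action_cancel: "x \<in> X \<Longrightarrow> letter_action (x, b) (letter_action (x, \<not> b) a) = a"
  by (cases b) (auto simp: fun_eq_iff)

text \<open>
  Put \<open>t = g x y\<close> and \<open>z = f y x\<close>. Acting by \<open>y\<close> and then by \<open>x\<close> translates by \<open>e\<^sub>x\<close> plus the basis vector at
  \<open>g x y = t\<close>; acting by \<open>z\<close> and then by \<open>t\<close> translates by \<open>e\<^sub>t\<close> plus the basis vector at \<open>g t z\<close>, which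
  is \<open>x\<close> by involutivity.
\<close>

lemma letter_action_relation:
  assumes "x \<in> X" "y \<in> X"
  shows "letter_action (g x y, True) (letter_action (f y x, True) a) =
    letter_action (x, True) (letter_action (y, True) a)"
proof -
  let ?t = "g x y" and ?z = "f y x"
  have tz: "?t \<in> X" "?z \<in> X" using S_closed assms by auto
  have pt: "perm x y = ?t" "perm ?t ?z = x"
    using assms tz S_S[OF assms] by (auto simp: perm_def)
  have "perm_inv ?z (perm_inv ?t u) = perm_inv y (perm_inv x u)" for u
    using assms tz perm_braid[OF assms, of "perm_inv y (perm_inv x u)"] by (simp add: perm_inv_eq)
  moreover have "perm_inv x u = y \<longleftrightarrow> u = ?t" "perm_inv ?t u = ?z \<longleftrightarrow> u = x" for u
    using assms tz pt by (auto simp: perm_inv_eq)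
  ultimately show ?thesis by (auto simp: fun_eq_iff)
qed

abbreviation "rels \<equiv> yb_relations X S"
abbreviation "grels \<equiv> group_relations X rels"
abbreviation "letters \<equiv> X \<times> (UNIV :: bool set)"

lemma word_action_cong:
  "(u, v) \<in> word_cong letters grels \<Longrightarrow> word_action u = word_action v"
proof (induction rule: word_cong.induct)
  case (cong_rel u v)
  then consider (pos) u' v' where "(u', v') \<in> rels" "u = pos_word u'" "v = pos_word v'"
    | (canc) x b where "x \<in> X" "u = [(x, b), (x, \<not> b)]" "v = []"
    by (auto simp: group_relations_def)
  then show ?case
  proof cases
    case pos
    then obtain x y where "x \<in> X" "y \<in> X" "u' = [x, y]" "v' = [g x y, f y x]"
      by (auto simp: yb_relations_def)
    then show ?thesis using pos letter_action_relation by (auto simp: fun_eq_iff)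
  next
    case canc
    then show ?thesis using letter_action_cancel[of x b] by (auto simp: fun_eq_iff)
  qed
next
  case (cong_append u v u' v')
  then show ?case by (intro ext) simp
qed simp_all

text \<open>
  Because \<open>\<sigma>\<close> preserves \<open>X\<close>, the linear part fixes the all-ones vector on \<open>X\<close>; this is what
  makes the Garside element quasi-central.
\<close>

lemma word_action_affine:
  assumes "w \<in> lists letters"
  shows "\<exists>\<sigma>. bij \<sigma> \<and> (\<forall>y. \<sigma> y \<in> X \<longleftrightarrow> y \<in> X) \<and>
    (\<forall>a y. word_action w a y = word_action w (\<lambda>_. 0) y + a (\<sigma> y))"
  using assms
proof (induction w rule: list.induct)
  case Nil
  show ?case by (intro exI[of _ id]) (simp add: bij_id[unfolded id_def] id_def)
next
  case (Cons l w)
  then obtain \<sigma> where \<sigma>: "bij \<sigma>" "\<And>y. \<sigma> y \<in> X \<longleftrightarrow> y \<in> X" "\<And>a y. word_action w a y = word_action w (\<lambda>_. 0) y + a (\<sigma> y)"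
    by auto
  obtain x b where l: "l = (x, b)" "x \<in> X" using Cons.prems by (cases l) auto
  show ?case
  proof (cases b)
    case True
    have "word_action (l # w) a y = word_action (l # w) (\<lambda>_. 0) y + a ((\<sigma> \<circ> perm_inv x) y)" for a y
      using \<sigma>(3)[of a "perm_inv x y"] \<open>b\<close> by (simp add: l)
    moreover have "(\<sigma> \<circ> perm_inv x) y \<in> X \<longleftrightarrow> y \<in> X" for y using \<sigma>(2) l(2) by simp
    ultimately show ?thesis using bij_comp[OF perm_inv_bij[OF l(2)] \<sigma>(1)] by blast
  next
    case False
    have "word_action (l # w) a y = word_action (l # w) (\<lambda>_. 0) y + a ((\<sigma> \<circ> perm x) y)" for a y
      using \<sigma>(3)[of a "perm x y"] \<open>\<not> b\<close> by (simp add: l)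
    moreover have "(\<sigma> \<circ> perm x) y \<in> X \<longleftrightarrow> y \<in> X" for y using \<sigma>(2) l(2) by simp
    ultimately show ?thesis using bij_comp[OF perm_bij[OF l(2)] \<sigma>(1)] by blast
  qed
qed

lemma word_action_supp:
  assumes "w \<in> lists letters" "\<And>y. y \<notin> X \<Longrightarrow> a y = 0" "y \<notin> X"
  shows "word_action w a y = 0"
  using assms(1,3)
proof (induction w arbitrary: y rule: list.induct)
  case (Cons l w)
  then obtain x b where l: "l = (x, b)" "x \<in> X" by (cases l) auto
  moreover have "perm x y \<noteq> x" using l(2) Cons.prems(2) perm_in_X[of x y] by metis
  moreover have "y \<noteq> x" using l(2) Cons.prems(2) by metis
  ultimately show ?case using Cons by (cases b) auto
qed (simp add: assms(2))

definition vec :: "'x list \<Rightarrow> 'x \<Rightarrow> int" where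
  "vec w = word_action (pos_word w) (\<lambda>_. 0)"

lemma vec_Nil [simp]: "vec [] = (\<lambda>_. 0)"
  and vec_Cons: "vec (x # w) = letter_action (x, True) (vec w)"
  and vec_append: "vec (u @ v) = word_action (pos_word u) (vec v)"
  by (simp_all add: vec_def)

lemma vec_cong: "(u, v) \<in> word_cong X rels \<Longrightarrow> vec u = vec v"
  unfolding vec_def using word_action_cong[OF pos_word_cong] by simp

lemma vec_append_affine:
  assumes "u \<in> lists X"
  obtains \<sigma> where "bij \<sigma>" "\<And>y. \<sigma> y \<in> X \<longleftrightarrow> y \<in> X" "\<And>v y. vec (u @ v) y = vec u y + vec v (\<sigma> y)"
  using word_action_affine[OF pos_word_lists[OF assms]] unfolding vec_append
  by (metis vec_def that)

lemma vec_nonneg: "w \<in> lists X \<Longrightarrow> 0 \<le> vec w y"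
  by (induction w arbitrary: y rule: list.induct) (auto simp: vec_Cons)

lemma vec_supp: "w \<in> lists X \<Longrightarrow> y \<notin> X \<Longrightarrow> vec w y = 0"
  unfolding vec_def by (rule word_action_supp[OF pos_word_lists]) auto

lemma sum_perm_inv: "x \<in> X \<Longrightarrow> (\<Sum>y\<in>X. a (perm_inv x y)) = sum a X"
proof -
  assume x: "x \<in> X"
  have "bij_betw (perm_inv x) X X"
    by (rule bij_betw_byWitness[of _ "perm x"]) (use x in auto)
  then show ?thesis by (rule sum.reindex_bij_betw)
qed

text \<open>
  A letter adds one unit vector and permutes the rest, so the coordinate sum counts letters. In
  particular the length of a word is an invariant of its class.
\<close>

lemma sum_vec: "w \<in> lists X \<Longrightarrow> sum (vec w) X = int (length w)"
proof (induction w rule: list.induct)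
  case (Cons x w)
  then show ?case
    using sum_perm_inv[of x "vec w"] finite_X by (simp add: vec_Cons sum.distrib)
qed simp

lemma length_cong: "(u, v) \<in> word_cong X rels \<Longrightarrow> length u = length v"
  using vec_cong[of u v] word_cong_closed[of u v X rels] sum_vec[of u] sum_vec[of v] by simp

lemma cong_Cons: "x \<in> X \<Longrightarrow> (u, v) \<in> word_cong X rels \<Longrightarrow> (x # u, x # v) \<in> word_cong X rels"
  using word_cong.cong_append[of "[x]" "[x]" X rels u v] by (simp add: word_cong.cong_refl)

text \<open>
  Induction on \<open>w = x v\<close>. If \<open>t \<noteq> x\<close>, then \<open>vec v\<close> is positive at \<open>s = g\<^sub>x\<inverse> t\<close>, so that \<open>w\<close> is congruent to
  some \<open>x s v'\<close>, and the defining relation rewrites \<open>x s\<close> to a word that starts with \<open>g x s = t\<close>.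
\<close>

lemma pull_letter:
  assumes "w \<in> lists X" "0 < vec w t"
  shows "\<exists>u\<in>lists X. (w, t # u) \<in> word_cong X rels"
  using assms
proof (induction w arbitrary: t rule: list.induct)
  case (Cons x v)
  have x: "x \<in> X" and v: "v \<in> lists X" using Cons.prems by auto
  have t: "t \<in> X"
  proof (rule ccontr)
    assume "t \<notin> X"
    then show False using vec_supp[OF Cons.prems(1)] Cons.prems(2) by simp
  qed
  show ?case
  proof (cases "t = x")
    case True
    then show ?thesis using Cons.prems(1) v by (intro bexI[of _ v]) (auto intro: word_cong.cong_refl)
  next
    case False
    let ?s = "perm_inv x t"
    have "0 < vec v ?s" using Cons.prems(2) False by (simp add: vec_Cons)
    then obtain v' where v': "v' \<in> lists X" "(v, ?s # v') \<in> word_cong X rels"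
      using Cons.IH v by blast
    have s: "?s \<in> X" using x t by simp
    have "g x ?s = t" using s perm_perm_inv[OF x, of t] by (simp add: perm_def)
    moreover have "f ?s x \<in> X" using S_closed x s by simp
    ultimately have "([x, ?s], [t, f ?s x]) \<in> word_cong X rels"
      using x s t by (intro word_cong.cong_rel) (auto simp: yb_relations_def prod_eq_iff)
    then have "(x # ?s # v', t # f ?s x # v') \<in> word_cong X rels"
      using word_cong.cong_append[of "[x, ?s]" "[t, f ?s x]" X rels v' v'] v'(1)
      by (simp add: word_cong.cong_refl)
    with cong_Cons[OF x v'(2)] have "(x # v, t # f ?s x # v') \<in> word_cong X rels"
      by (rule word_cong.cong_trans)
    then show ?thesis using v'(1) \<open>f ?s x \<in> X\<close> by (intro bexI[of _ "f ?s x # v'"]) auto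
  qed
qed simp

text \<open>
  The letters of \<open>u\<close> are pulled out of \<open>v\<close> one after the other. This is the step that makes left
  divisibility a lattice order.
\<close>

lemma prefix_iff:
  assumes "u \<in> lists X" "v \<in> lists X"
  shows "(\<exists>w\<in>lists X. (v, u @ w) \<in> word_cong X rels) \<longleftrightarrow> (\<forall>y. vec u y \<le> vec v y)"
proof
  assume "\<exists>w\<in>lists X. (v, u @ w) \<in> word_cong X rels"
  then obtain w where w: "w \<in> lists X" "(v, u @ w) \<in> word_cong X rels" by blast
  obtain \<sigma> where "\<And>v y. vec (u @ v) y = vec u y + vec v (\<sigma> y)"
    using vec_append_affine[OF assms(1)] by metis
  then show "\<forall>y. vec u y \<le> vec v y"
    using vec_cong[OF w(2)] vec_nonneg[OF w(1)] by simp
next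
  assume "\<forall>y. vec u y \<le> vec v y"
  then show "\<exists>w\<in>lists X. (v, u @ w) \<in> word_cong X rels"
    using assms
  proof (induction u arbitrary: v rule: list.induct)
    case Nil
    then show ?case by (intro bexI[of _ v]) (auto intro: word_cong.cong_refl)
  next
    case (Cons x u)
    have x: "x \<in> X" and u: "u \<in> lists X" using Cons.prems by auto
    have "vec (x # u) x > 0" using vec_nonneg[OF u] by (simp add: vec_Cons add.commute add_pos_nonneg)
    then have "vec v x > 0" using spec[OF Cons.prems(1), of x] by simp
    from pull_letter[OF Cons.prems(3) this]
    obtain v' where v': "v' \<in> lists X" "(v, x # v') \<in> word_cong X rels" by blast
    have "vec u y \<le> vec v' y" for y
      using Cons.prems(1)[rule_format, of "perm x y"] x unfolding vec_cong[OF v'(2)]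
      by (simp add: vec_Cons)
    then obtain w where w: "w \<in> lists X" "(v', u @ w) \<in> word_cong X rels"
      using Cons.IH[of v'] u v'(1) by blast
    have "(v, (x # u) @ w) \<in> word_cong X rels"
      using word_cong.cong_trans[OF v'(2) cong_Cons[OF x w(2)]] by simp
    then show ?case using w(1) by blast
  qed
qed

text \<open>
  By \<open>prefix_iff\<close>, \<open>v\<close> is congruent to some \<open>u w\<close>, and \<open>w\<close> is empty since the lengths agree.
\<close>

lemma vec_eq_iff:
  assumes "u \<in> lists X" "v \<in> lists X"
  shows "(u, v) \<in> word_cong X rels \<longleftrightarrow> vec u = vec v"
proof
  assume eq: "vec u = vec v"
  then obtain w where w: "w \<in> lists X" "(v, u @ w) \<in> word_cong X rels"
    using prefix_iff[OF assms] by auto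
  have "length u = length v" using eq sum_vec assms by (metis of_nat_eq_iff)
  then have "w = []" using length_cong[OF w(2)] by simp
  then show "(u, v) \<in> word_cong X rels" using w by (auto intro: word_cong.cong_sym)
qed (rule vec_cong)

text \<open>
  Undoing the action of a letter \<open>t\<close> with \<open>a t > 0\<close> keeps the entries nonnegative and lowers their sum by one.
\<close>

lemma vec_surj:
  assumes "\<And>y. 0 \<le> a y" "\<And>y. y \<notin> X \<Longrightarrow> a y = 0"
  shows "\<exists>w\<in>lists X. vec w = a"
  using assms
proof (induction "nat (sum a X)" arbitrary: a)
  case 0
  have "sum a X \<ge> 0" by (rule sum_nonneg) (use 0 in auto)
  then have "sum a X = 0" using 0 by simp
  then have "a y = 0" for y using 0(2,3) finite_X by (cases "y \<in> X") (auto simp: sum_nonneg_eq_0_iff)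
  then show ?case by (intro bexI[of _ "[]"]) auto
next
  case (Suc n)
  have "sum a X > 0" using Suc.hyps(2) by simp
  then obtain t where t: "t \<in> X" "a t > 0"
    by (metis (no_types, lifting) sum_nonpos linorder_not_le)
  let ?a = "letter_action (t, False) a"
  have a: "letter_action (t, True) ?a = a" using letter_action_cancel[OF t(1), of True] by simp
  have "sum (letter_action (t, True) ?a) X = sum ?a X + 1"
    using sum_perm_inv[OF t(1), of ?a] finite_X t(1) by (simp add: sum.distrib del: letter_action.simps(2))
  then have "sum a X = sum ?a X + 1" by (simp only: a)
  then have "n = nat (sum ?a X)" using Suc.hyps(2) by simp
  moreover have "0 \<le> ?a y" for y using Suc.prems(1)[of "perm t y"] t(2) by auto
  moreover have "?a y = 0" if "y \<notin> X" for y
    using that t Suc.prems(2)[of "perm t y"] by auto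
  ultimately obtain w where "w \<in> lists X" "vec w = ?a" using Suc.hyps(1) by blast
  then show ?case using t a by (intro bexI[of _ "t # w"]) (auto simp: vec_Cons)
qed

abbreviation "M \<equiv> structure_monoid X S"
abbreviation "cls \<equiv> word_class X rels"

lemma carrier_M: "carrier M = cls ` lists X"
  by (simp add: structure_monoid_def carrier_presented_monoid)

lemma cls_closed [simp]: "u \<in> lists X \<Longrightarrow> cls u \<in> carrier M"
  by (simp add: carrier_M)

lemma mult_M [simp]: "u \<in> lists X \<Longrightarrow> v \<in> lists X \<Longrightarrow> cls u \<otimes>\<^bsub>M\<^esub> cls v = cls (u @ v)"
  by (simp add: structure_monoid_def mult_presented_monoid)

lemma one_M: "\<one>\<^bsub>M\<^esub> = cls []"
  by (simp add: structure_monoid_def one_presented_monoid)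

lemma monoid_M: "monoid M"
  by (simp add: structure_monoid_def monoid_presented_monoid)

lemma cls_eq_iff: "u \<in> lists X \<Longrightarrow> v \<in> lists X \<Longrightarrow> cls u = cls v \<longleftrightarrow> vec u = vec v"
  by (simp add: word_class_eq_iff vec_eq_iff)

lemma carrier_M_cases:
  assumes "U \<in> carrier M" obtains u where "u \<in> lists X" "U = cls u"
  using assms by (auto simp: carrier_M)

lemma left_divides_iff:
  assumes "u \<in> lists X" "v \<in> lists X"
  shows "left_divides M (cls u) (cls v) \<longleftrightarrow> (\<forall>y. vec u y \<le> vec v y)"
proof -
  have "left_divides M (cls u) (cls v) \<longleftrightarrow> (\<exists>w\<in>lists X. cls v = cls (u @ w))"
    using assms by (auto simp: factor_def carrier_M)
  also have "\<dots> \<longleftrightarrow> (\<exists>w\<in>lists X. (v, u @ w) \<in> word_cong X rels)"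
    using assms by (auto simp: word_class_eq_iff)
  finally show ?thesis by (simp add: prefix_iff assms)
qed

lemma left_gcd_exists:
  assumes "U \<in> carrier M" "V \<in> carrier M"
  shows "\<exists>Z. is_left_gcd M {U, V} Z"
proof -
  obtain u v where u: "u \<in> lists X" "U = cls u" and v: "v \<in> lists X" "V = cls v"
    using assms by (auto simp: carrier_M)
  have "\<exists>z\<in>lists X. vec z = (\<lambda>y. min (vec u y) (vec v y))"
    using u v by (intro vec_surj) (simp_all add: vec_nonneg vec_supp)
  then obtain z where z: "z \<in> lists X" "vec z = (\<lambda>y. min (vec u y) (vec v y))" by blast
  have "is_left_gcd M {U, V} (cls z)"
    unfolding is_left_gcd_def using u v z
    by (auto simp: left_divides_iff elim!: carrier_M_cases)
  then show ?thesis ..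
qed

lemma right_lcm_exists:
  assumes "U \<in> carrier M" "V \<in> carrier M"
  shows "\<exists>Z. is_right_lcm M {U, V} Z"
proof -
  obtain u v where u: "u \<in> lists X" "U = cls u" and v: "v \<in> lists X" "V = cls v"
    using assms by (auto simp: carrier_M)
  have "\<exists>z\<in>lists X. vec z = (\<lambda>y. max (vec u y) (vec v y))"
    using u v by (intro vec_surj) (simp_all add: vec_nonneg vec_supp max.coboundedI1)
  then obtain z where z: "z \<in> lists X" "vec z = (\<lambda>y. max (vec u y) (vec v y))" by blast
  have "is_right_lcm M {U, V} (cls z)"
    unfolding is_right_lcm_def using u v z
    by (auto simp: left_divides_iff elim!: carrier_M_cases)
  then show ?thesis ..
qed

text \<open>
  Prepending \<open>W\<close> acts on the vectors of \<open>U\<close> and \<open>V\<close> by an affine bijection.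
\<close>

lemma left_cancel:
  assumes "U \<in> carrier M" "V \<in> carrier M" "W \<in> carrier M" "W \<otimes>\<^bsub>M\<^esub> U = W \<otimes>\<^bsub>M\<^esub> V"
  shows "U = V"
proof -
  obtain u v w where uvw: "u \<in> lists X" "U = cls u" "v \<in> lists X" "V = cls v" "w \<in> lists X" "W = cls w"
    using assms by (auto simp: carrier_M)
  have eq: "vec (w @ u) = vec (w @ v)" using assms(4) uvw by (simp add: cls_eq_iff)
  obtain \<sigma> where \<sigma>: "bij \<sigma>" "\<And>v y. vec (w @ v) y = vec w y + vec v (\<sigma> y)"
    using vec_append_affine[OF uvw(5)] by metis
  have "vec u (\<sigma> y) = vec v (\<sigma> y)" for y using fun_cong[OF eq, of y] by (simp add: \<sigma>(2))
  then have "vec u = vec v" using bij_is_surj[OF \<sigma>(1)] by (metis ext surjD)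
  then show ?thesis using uvw by (simp add: cls_eq_iff)
qed

subsection \<open>The opposite solution\<close>

text \<open>
  Reading words backwards turns the relation \<open>x y = t z\<close> into \<open>y x = z t\<close>. So the opposite of \<open>M\<close> is the
  structure monoid of \<open>S\<close> conjugated by the flip; the flip exchanges the families \<open>g\<close> and \<open>f\<close>.
\<close>

definition opp :: "'x \<times> 'x \<Rightarrow> 'x \<times> 'x" where
  "opp p = prod.swap (S (prod.swap p))"

lemma opp_apply [simp]: "opp (x, y) = (f x y, g y x)"
  by (simp add: opp_def prod_eq_iff)

text \<open>
  The hypotheses are symmetric: the flip exchanges the two halves of non-degeneracy, and reversing
  triples exchanges \<open>S12\<close> with \<open>S23\<close>.
\<close>

lemma yang_baxter_opp: "yang_baxter X opp"
proof
  have swap_bij: "bij_betw prod.swap (X \<times> X) (X \<times> X)"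
    by (rule bij_betw_byWitness[of _ prod.swap]) auto
  have "bij_betw S (X \<times> X) (X \<times> X)" using solution by (simp add: yb_solution_def)
  from bij_betw_trans[OF bij_betw_trans[OF swap_bij this] swap_bij]
  have "bij_betw opp (X \<times> X) (X \<times> X)"
    by (simp add: comp_def opp_def[abs_def])
  then show "yb_solution X opp" using solution by (simp add: yb_solution_def)
  show "non_degenerate X opp"
    using g_bij f_bij by (simp add: non_degenerate_def)
  show "involutive X opp"
    using S_S by (auto simp: involutive_def prod_eq_iff)
  show "braided X opp"
    unfolding braided_def
  proof
    fix p assume "p \<in> X \<times> X \<times> X"
    then obtain x y z where p: "p = (x, y, z)" "x \<in> X" "y \<in> X" "z \<in> X" by auto
    show "S12 opp (S23 opp (S12 opp p)) = S23 opp (S12 opp (S23 opp p))"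
      using yang_baxter_equation[OF p(4,3,2)] unfolding p
      by (simp add: S12_def S23_def opp_def case_prod_beta prod_eq_iff)
  qed
qed (rule finite_X)

lemma rev_cong: "(u, v) \<in> word_cong X rels \<longleftrightarrow> (rev u, rev v) \<in> word_cong X (yb_relations X opp)"
proof
  have "\<And>u v. (u, v) \<in> rels \<Longrightarrow> (rev u, rev v) \<in> yb_relations X opp"
    by (auto simp: yb_relations_def)
  then show "(u, v) \<in> word_cong X rels \<Longrightarrow> (rev u, rev v) \<in> word_cong X (yb_relations X opp)"
    by (rule rev_word_cong[rotated])
  have "\<And>u v. (u, v) \<in> yb_relations X opp \<Longrightarrow> (rev u, rev v) \<in> rels"
    by (auto simp: yb_relations_def)
  then show "(rev u, rev v) \<in> word_cong X (yb_relations X opp) \<Longrightarrow> (u, v) \<in> word_cong X rels"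
    using rev_word_cong[of "rev u" "rev v" X "yb_relations X opp" rels] by simp
qed

lemma image_rev_cls: "rev ` cls u = word_class X (yb_relations X opp) (rev u)"
proof -
  have "v \<in> rev ` cls u" if "(rev u, v) \<in> word_cong X (yb_relations X opp)" for v
    using that rev_cong[of u "rev v"] by (intro image_eqI[of _ _ "rev v"]) (auto simp: word_class_def)
  then show ?thesis using rev_cong by (auto simp: word_class_def)
qed

lemma anti_isomorphism_rev: "anti_isomorphism M (structure_monoid X opp) (image rev)"
proof -
  interpret opp: yang_baxter X opp by (rule yang_baxter_opp)
  show ?thesis
  proof
    show "bij_betw ((`) rev) (carrier M) (carrier (structure_monoid X opp))"
    proof (rule bij_betw_imageI)
      show "inj_on ((`) rev) (carrier M)" by (rule inj_onI) (auto simp: inj_image_eq_iff)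
      have "(`) rev ` carrier M = opp.cls ` rev ` lists X"
        by (auto simp: carrier_M image_image image_rev_cls)
      also have "rev ` lists X = lists X"
        by (auto simp: image_iff) (metis rev_lists rev_rev_ident)
      finally show "(`) rev ` carrier M = carrier (structure_monoid X opp)"
        by (simp add: opp.carrier_M)
    qed
    show "rev ` (U \<otimes>\<^bsub>M\<^esub> V) = rev ` V \<otimes>\<^bsub>structure_monoid X opp\<^esub> rev ` U"
      if "U \<in> carrier M" "V \<in> carrier M" for U V
      using that by (elim carrier_M_cases) (simp add: image_rev_cls)
    show "U \<otimes>\<^bsub>M\<^esub> V \<in> carrier M" if "U \<in> carrier M" "V \<in> carrier M" for U V
      using that monoid.m_closed[OF monoid_M] by blast
  qed
qed

lemma right_gcd_exists:
  assumes "U \<in> carrier M" "V \<in> carrier M"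
  shows "\<exists>Z. is_right_gcd M {U, V} Z"
proof -
  interpret opp: yang_baxter X opp by (rule yang_baxter_opp)
  interpret anti_isomorphism M opp.M "image rev" by (rule anti_isomorphism_rev)
  obtain Z' where Z': "is_left_gcd opp.M {rev ` U, rev ` V} Z'"
    using opp.left_gcd_exists \<rho>_closed assms by blast
  then have "Z' \<in> carrier opp.M" by (simp add: is_left_gcd_def)
  then obtain Z where "Z \<in> carrier M" "Z' = rev ` Z" using \<rho>_surj by blast
  then show ?thesis using is_right_gcd_iff[of "{U, V}" Z] Z' assms by auto
qed

lemma left_lcm_exists:
  assumes "U \<in> carrier M" "V \<in> carrier M"
  shows "\<exists>Z. is_left_lcm M {U, V} Z"
proof -
  interpret opp: yang_baxter X opp by (rule yang_baxter_opp)
  interpret anti_isomorphism M opp.M "image rev" by (rule anti_isomorphism_rev)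
  obtain Z' where Z': "is_right_lcm opp.M {rev ` U, rev ` V} Z'"
    using opp.right_lcm_exists \<rho>_closed assms by blast
  then have "Z' \<in> carrier opp.M" by (simp add: is_right_lcm_def)
  then obtain Z where "Z \<in> carrier M" "Z' = rev ` Z" using \<rho>_surj by blast
  then show ?thesis using is_left_lcm_iff[of "{U, V}" Z] Z' assms by auto
qed

lemma right_cancel:
  assumes "U \<in> carrier M" "V \<in> carrier M" "W \<in> carrier M" "U \<otimes>\<^bsub>M\<^esub> W = V \<otimes>\<^bsub>M\<^esub> W"
  shows "U = V"
proof -
  interpret opp: yang_baxter X opp by (rule yang_baxter_opp)
  interpret anti_isomorphism M opp.M "image rev" by (rule anti_isomorphism_rev)
  have "rev ` U = rev ` V"
    using opp.left_cancel[of "rev ` U" "rev ` V" "rev ` W"] assms \<rho>_closed anti by metis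
  then show ?thesis using \<rho>_eq assms by blast
qed

section \<open>The Garside element\<close>

lemma cls_eq_one_iff: "w \<in> lists X \<Longrightarrow> cls w = cls [] \<longleftrightarrow> w = []"
  using length_cong[of w "[]"] by (auto simp: word_class_eq_iff word_cong.cong_refl)

lemma cls_length: "u \<in> lists X \<Longrightarrow> v \<in> lists X \<Longrightarrow> cls u = cls v \<Longrightarrow> length u = length v"
  using length_cong by (simp add: word_class_eq_iff)

lemma generators_eq: "generators X S = (\<lambda>x. cls [x]) ` X"
  by (simp add: generators_def word_class_def)

text \<open>
  All relations preserve length, so a factorisation of a generator has an empty factor, while an
  atom cannot have length two or more.
\<close>

lemma atoms_M: "atoms M = generators X S"
proof (intro equalityI subsetI)
  fix U assume U: "U \<in> atoms M"
  then obtain w where w: "w \<in> lists X" "U = cls w" by (auto simp: atoms_def carrier_M)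
  then obtain x v where xv: "w = x # v" "x \<in> X" "v \<in> lists X"
    using U by (cases w) (auto simp: atoms_def one_M)
  then have "U = cls [x] \<otimes>\<^bsub>M\<^esub> cls v" using w by simp
  then have "cls [x] = \<one>\<^bsub>M\<^esub> \<or> cls v = \<one>\<^bsub>M\<^esub>" using U xv by (simp add: atoms_def)
  then have "v = []" using xv by (simp add: one_M cls_eq_one_iff)
  then show "U \<in> generators X S" using w xv by (simp add: generators_eq)
next
  fix U assume "U \<in> generators X S"
  then obtain x where x: "x \<in> X" "U = cls [x]" by (auto simp: generators_eq)
  have "V = \<one>\<^bsub>M\<^esub> \<or> W = \<one>\<^bsub>M\<^esub>" if VW: "V \<in> carrier M" "W \<in> carrier M" "U = V \<otimes>\<^bsub>M\<^esub> W" for V W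
  proof -
    obtain v w where vw: "v \<in> lists X" "V = cls v" "w \<in> lists X" "W = cls w"
      using VW(1,2) by (auto simp: carrier_M)
    then have "length [x] = length (v @ w)" using VW(3) x by (intro cls_length) auto
    then have "v = [] \<or> w = []" by (cases v) auto
    then show ?thesis using vw by (auto simp: one_M)
  qed
  then show "U \<in> atoms M" using x by (auto simp: atoms_def one_M cls_eq_one_iff)
qed

lemma list_product_generators:
  "w \<in> lists X \<Longrightarrow> list_product M (map (\<lambda>x. cls [x]) w) = cls w"
  by (induction w rule: list.induct) (auto simp: list_product_def one_M)

lemma generates: "monoid_generated_by M (generators X S)"
  unfolding monoid_generated_by_def
proof (intro conjI ballI)
  show "generators X S \<subseteq> carrier M" by (auto simp: generators_eq)
  fix U assume "U \<in> carrier M"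
  then obtain w where w: "w \<in> lists X" "U = cls w" by (rule carrier_M_cases)
  then show "\<exists>xs\<in>lists (generators X S). list_product M xs = U"
    by (intro bexI[of _ "map (\<lambda>x. cls [x]) w"])
      (auto simp: list_product_generators generators_eq in_lists_conv_set)
qed

lemma atomic: "atomic_monoid M"
  unfolding atomic_monoid_def atoms_M
proof (intro conjI ballI)
  show "monoid M" by (rule monoid_M)
  show "monoid_generated_by M (generators X S)" by (rule generates)
  fix U assume "U \<in> carrier M"
  then obtain u where u: "u \<in> lists X" "U = cls u" by (rule carrier_M_cases)
  show "bdd_above {length xs |xs. xs \<in> lists (generators X S) \<and> list_product M xs = U}"
  proof (rule bdd_aboveI[of _ "length u"])
    fix n assume "n \<in> {length xs |xs. xs \<in> lists (generators X S) \<and> list_product M xs = U}"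
    then obtain xs where xs: "xs \<in> lists (generators X S)" "list_product M xs = U" "n = length xs" by auto
    have "xs \<in> map (\<lambda>x. cls [x]) ` lists X"
      using xs(1) by (simp add: generators_eq lists_image)
    then obtain w where w: "w \<in> lists X" "xs = map (\<lambda>x. cls [x]) w" by auto
    then have "cls w = cls u" using xs(2) u by (simp add: list_product_generators)
    then show "n \<le> length u" using cls_length[OF w(1) u(1)] w xs(3) by simp
  qed
qed

lemma gaussian: "gaussian_monoid M"
proof -
  interpret monoid M by (rule monoid_M)
  have "monoid_cancel M"
  proof (rule monoid_cancelI)
    fix U V W assume UVW: "U \<in> carrier M" "V \<in> carrier M" "W \<in> carrier M"
    show "U = V" if "W \<otimes>\<^bsub>M\<^esub> U = W \<otimes>\<^bsub>M\<^esub> V" by (rule left_cancel[OF UVW that])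
    show "U = V" if "U \<otimes>\<^bsub>M\<^esub> W = V \<otimes>\<^bsub>M\<^esub> W" by (rule right_cancel[OF UVW that])
  qed
  then show ?thesis
    unfolding gaussian_monoid_def
    by (intro conjI ballI atomic left_gcd_exists right_gcd_exists left_lcm_exists right_lcm_exists)
qed

definition delta :: "'x list" where
  "delta = (SOME w. w \<in> lists X \<and> vec w = (\<lambda>y. if y \<in> X then 1 else 0))"

lemma delta: "delta \<in> lists X" "vec delta = (\<lambda>y. if y \<in> X then 1 else 0)"
proof -
  have "\<exists>w\<in>lists X. vec w = (\<lambda>y. if y \<in> X then 1 else 0)" by (rule vec_surj) auto
  then have "\<exists>w. w \<in> lists X \<and> vec w = (\<lambda>y. if y \<in> X then 1 else 0)" by blast
  from someI_ex[OF this] show "delta \<in> lists X" "vec delta = (\<lambda>y. if y \<in> X then 1 else 0)"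
    unfolding delta_def by blast+
qed

abbreviation "\<Delta> \<equiv> cls delta"

lemma vec_letter: "x \<in> X \<Longrightarrow> vec [x] = (\<lambda>y. if y = x then 1 else 0)"
  by (simp add: vec_Cons)

text \<open>
  A vector with entries in \<open>\<nat>\<close> is above all \<open>e\<^sub>x\<close> if and only if it is above the all-ones vector.
\<close>

lemma \<Delta>_right_lcm: "is_right_lcm M (generators X S) \<Delta>"
  unfolding is_right_lcm_def
proof (intro conjI ballI impI)
  show "\<Delta> \<in> carrier M" by (simp add: delta)
  show "left_divides M U \<Delta>" if "U \<in> generators X S" for U
    using that by (auto simp: generators_eq left_divides_iff delta vec_letter)
  fix W assume "W \<in> carrier M" and above: "\<forall>U\<in>generators X S. left_divides M U W"
  then obtain w where w: "w \<in> lists X" "W = cls w" by (elim carrier_M_cases)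
  have "1 \<le> vec w x" if "x \<in> X" for x
  proof -
    have "left_divides M (cls [x]) (cls w)" using above that w by (auto simp: generators_eq)
    then have "vec [x] x \<le> vec w x" using that w by (simp add: left_divides_iff)
    then show ?thesis using that by (simp add: vec_letter)
  qed
  then show "left_divides M \<Delta> W"
    using w by (auto simp: left_divides_iff delta vec_nonneg)
qed

text \<open>
  A left divisor of \<open>\<Delta>\<close> has a vector with entries \<open>0\<close> and \<open>1\<close>, hence a word of length at most \<open>card X\<close>.
\<close>

lemma finite_left_divisors: "finite {U \<in> carrier M. left_divides M U \<Delta>}"
proof (rule finite_subset)
  show "finite (cls ` {u. set u \<subseteq> X \<and> length u \<le> card X})"
    by (intro finite_imageI finite_lists_length_le finite_X)
  show "{U \<in> carrier M. left_divides M U \<Delta>} \<subseteq> cls ` {u. set u \<subseteq> X \<and> length u \<le> card X}"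
  proof
    fix U assume "U \<in> {U \<in> carrier M. left_divides M U \<Delta>}"
    then obtain u where u: "u \<in> lists X" "U = cls u" "left_divides M (cls u) \<Delta>"
      by (auto simp: carrier_M)
    then have "sum (vec u) X \<le> (\<Sum>y\<in>X. 1)"
      by (intro sum_mono) (simp add: left_divides_iff delta split: if_splits)
    then have "length u \<le> card X" using sum_vec[OF u(1)] by simp
    then show "U \<in> cls ` {u. set u \<subseteq> X \<and> length u \<le> card X}"
      using u by (auto simp: in_lists_conv_set)
  qed
qed

text \<open>
  The linear part of the action of \<open>U\<close> fixes the all-ones vector, so the vector of \<open>U \<Delta>\<close> is that of \<open>U\<close>
  plus the all-ones vector, and \<open>\<Delta>\<close> divides \<open>U \<Delta>\<close> on the left.
\<close>

lemma \<Delta>_quasi_central: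
  assumes "U \<in> carrier M"
  shows "\<exists>V\<in>carrier M. U \<otimes>\<^bsub>M\<^esub> \<Delta> = \<Delta> \<otimes>\<^bsub>M\<^esub> V"
proof -
  obtain u where u: "u \<in> lists X" "U = cls u" using assms by (rule carrier_M_cases)
  obtain \<sigma> where \<sigma>: "\<And>y. \<sigma> y \<in> X \<longleftrightarrow> y \<in> X" "\<And>v y. vec (u @ v) y = vec u y + vec v (\<sigma> y)"
    using vec_append_affine[OF u(1)] by metis
  have "left_divides M \<Delta> (cls (u @ delta))"
    using u by (simp add: left_divides_iff delta \<sigma> vec_nonneg)
  then show ?thesis using u by (auto simp: factor_def delta)
qed

text \<open>
  If \<open>\<Delta> = U V\<close> and \<open>U \<Delta> = \<Delta> W\<close>, then \<open>U \<Delta> = U V W\<close>, so \<open>\<Delta> = V W\<close>: right divisors are left divisors.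
  Conversely, a left divisor determines its complementary right divisor, and by right cancellation
  this assignment is injective; so there are at least as many right as left divisors, and the
  finite sets coincide.
\<close>

lemma garside_\<Delta>: "garside_element M \<Delta>"
proof -
  interpret monoid M by (rule monoid_M)
  let ?L = "{U \<in> carrier M. left_divides M U \<Delta>}" and ?R = "{U \<in> carrier M. right_divides M U \<Delta>}"
  have \<Delta>: "\<Delta> \<in> carrier M" by (simp add: delta)
  have RL: "?R \<subseteq> ?L"
  proof
    fix V assume "V \<in> ?R"
    then obtain U where V: "V \<in> carrier M" and U: "U \<in> carrier M" "\<Delta> = U \<otimes>\<^bsub>M\<^esub> V"
      by (auto simp: right_divides_def)
    obtain W where W: "W \<in> carrier M" "U \<otimes>\<^bsub>M\<^esub> \<Delta> = \<Delta> \<otimes>\<^bsub>M\<^esub> W"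
      using \<Delta>_quasi_central U(1) by blast
    have "U \<otimes>\<^bsub>M\<^esub> \<Delta> = U \<otimes>\<^bsub>M\<^esub> (V \<otimes>\<^bsub>M\<^esub> W)"
      using W(2) U V W(1) by (metis m_assoc)
    then have "\<Delta> = V \<otimes>\<^bsub>M\<^esub> W" using left_cancel \<Delta> U(1) V W(1) by blast
    then show "V \<in> ?L" using V W(1) by (auto simp: factor_def)
  qed
  have "\<forall>U\<in>?L. \<exists>V. V \<in> carrier M \<and> \<Delta> = U \<otimes>\<^bsub>M\<^esub> V"
    by (auto simp: factor_def)
  from bchoice[OF this] obtain c where
    c: "\<forall>U\<in>?L. c U \<in> carrier M \<and> \<Delta> = U \<otimes>\<^bsub>M\<^esub> c U" ..
  have "inj_on c ?L"
  proof (rule inj_onI)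
    fix U V assume UV: "U \<in> ?L" "V \<in> ?L" and eq: "c U = c V"
    then have "c U \<in> carrier M" "U \<otimes>\<^bsub>M\<^esub> c U = V \<otimes>\<^bsub>M\<^esub> c U"
      using bspec[OF c UV(1)] bspec[OF c UV(2)] by simp_all
    then show "U = V" using right_cancel[of U V "c U"] UV by simp
  qed
  moreover have "c ` ?L \<subseteq> ?R"
  proof
    fix V assume "V \<in> c ` ?L"
    then obtain U where U: "U \<in> ?L" "V = c U" by blast
    then show "V \<in> ?R" using bspec[OF c U(1)] by (auto simp: right_divides_def)
  qed
  ultimately have "card ?L \<le> card ?R"
    using card_inj_on_le finite_subset[OF RL finite_left_divisors] by blast
  then have "?R = ?L" by (intro card_seteq[OF finite_left_divisors RL])
  moreover have "monoid_generated_by M ?L"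
  proof -
    have "generators X S \<subseteq> ?L"
      using \<Delta>_right_lcm by (auto simp: is_right_lcm_def generators_eq)
    then have "lists (generators X S) \<subseteq> lists ?L" by (rule lists_mono)
    then show ?thesis using generates unfolding monoid_generated_by_def by blast
  qed
  ultimately show ?thesis
    using \<Delta> finite_left_divisors by (simp add: garside_element_def)
qed

section \<open>The group of fractions\<close>

abbreviation "G \<equiv> structure_group X S"
abbreviation "gcls \<equiv> word_class letters grels"
abbreviation "\<iota> \<equiv> structure_map X S"

lemma group_G: "group G"
  by (simp add: structure_group_def group_presented_group)

lemma carrier_G: "carrier G = gcls ` lists letters"
  by (simp add: structure_group_def presented_group_def carrier_presented_monoid)

lemma gcls_closed [simp]: "w \<in> lists letters \<Longrightarrow> gcls w \<in> carrier G"
  by (simp add: carrier_G)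

lemma mult_G [simp]: "u \<in> lists letters \<Longrightarrow> v \<in> lists letters \<Longrightarrow> gcls u \<otimes>\<^bsub>G\<^esub> gcls v = gcls (u @ v)"
  by (simp add: structure_group_def presented_group_def mult_presented_monoid)

lemma one_G: "\<one>\<^bsub>G\<^esub> = gcls []"
  by (simp add: structure_group_def presented_group_def one_presented_monoid)

lemma pos_word_letters [simp]: "u \<in> lists X \<Longrightarrow> pos_word u \<in> lists letters"
  by (rule pos_word_lists)

lemma formal_inverse_letters [simp]: "w \<in> lists letters \<Longrightarrow> formal_inverse w \<in> lists letters"
  by (rule formal_inverse_lists)

lemma inv_G: "w \<in> lists letters \<Longrightarrow> inv\<^bsub>G\<^esub> (gcls w) = gcls (formal_inverse w)"
proof -
  assume w: "w \<in> lists letters"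
  interpret group G by (rule group_G)
  show ?thesis
    using w formal_inverse_left[OF w, of rels]
    by (intro inv_equality) (simp_all add: one_G word_class_eq_iff)
qed

lemma \<iota>_cls: "u \<in> lists X \<Longrightarrow> \<iota> (cls u) = gcls (pos_word u)"
proof -
  assume u: "u \<in> lists X"
  have "gcls (pos_word v) = gcls (pos_word u)" if v: "v \<in> cls u" for v
  proof -
    have uv: "(u, v) \<in> word_cong X rels" using v by (simp add: word_class_def)
    then have "v \<in> lists X" using word_cong_closed by blast
    then show ?thesis
      using pos_word_cong[OF word_cong.cong_sym[OF uv]] u by (simp add: word_class_eq_iff)
  qed
  then have "\<forall>v\<in>cls u. gcls (pos_word v) = gcls (pos_word u)" ..
  with word_class_self[OF u] have "(\<Union>v\<in>cls u. gcls (pos_word v)) = gcls (pos_word u)"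
    by (rule UN_constant_eq)
  then show ?thesis by (simp add: structure_map_def word_class_def)
qed

lemma \<iota>_hom: "\<iota> \<in> hom M G"
  by (auto simp: hom_def carrier_M \<iota>_cls)

lemma \<iota>_closed: "U \<in> carrier M \<Longrightarrow> \<iota> U \<in> carrier G"
  and \<iota>_mult: "U \<in> carrier M \<Longrightarrow> V \<in> carrier M \<Longrightarrow> \<iota> (U \<otimes>\<^bsub>M\<^esub> V) = \<iota> U \<otimes>\<^bsub>G\<^esub> \<iota> V"
  using \<iota>_hom by (auto simp: hom_def)

lemma \<iota>_one: "\<iota> \<one>\<^bsub>M\<^esub> = \<one>\<^bsub>G\<^esub>"
  by (simp add: one_M one_G \<iota>_cls)

lemma word_action_gcls:
  "u \<in> lists letters \<Longrightarrow> v \<in> lists letters \<Longrightarrow> gcls u = gcls v \<Longrightarrow> word_action u = word_action v"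
  using word_action_cong by (simp add: word_class_eq_iff)

lemma \<iota>_inj: "inj_on \<iota> (carrier M)"
proof (rule inj_onI)
  fix U V assume "U \<in> carrier M" "V \<in> carrier M" and eq: "\<iota> U = \<iota> V"
  then obtain u v where uv: "u \<in> lists X" "U = cls u" "v \<in> lists X" "V = cls v"
    by (auto simp: carrier_M)
  then have "vec u = vec v"
    using eq word_action_gcls[of "pos_word u" "pos_word v"] by (simp add: \<iota>_cls vec_def)
  then show "U = V" using uv by (simp add: cls_eq_iff)
qed

lemma letter_cases:
  assumes "l \<in> letters"
  obtains x where "x \<in> X" "gcls [l] = \<iota> (cls [x])" | x where "x \<in> X" "gcls [l] = inv\<^bsub>G\<^esub> (\<iota> (cls [x]))"
proof -
  obtain x b where l: "l = (x, b)" "x \<in> X" using assms by auto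
  then show ?thesis
    using that by (cases b) (auto simp: \<iota>_cls inv_G formal_inverse_def)
qed

text \<open>
  A new inverse letter on the left is moved past the numerator by means of a right lcm.
\<close>

lemma right_fraction:
  assumes "w \<in> lists letters"
  shows "\<exists>U\<in>carrier M. \<exists>V\<in>carrier M. gcls w = \<iota> U \<otimes>\<^bsub>G\<^esub> inv\<^bsub>G\<^esub> (\<iota> V)"
  using assms
proof (induction w rule: list.induct)
  case Nil
  interpret M: monoid M by (rule monoid_M)
  interpret group G by (rule group_G)
  have "gcls [] = \<iota> \<one>\<^bsub>M\<^esub> \<otimes>\<^bsub>G\<^esub> inv\<^bsub>G\<^esub> (\<iota> \<one>\<^bsub>M\<^esub>)" by (simp add: \<iota>_one one_G[symmetric])
  then show ?case by blast
next
  case (Cons l w)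
  interpret M: monoid M by (rule monoid_M)
  interpret group G by (rule group_G)
  have l: "l \<in> letters" and w: "w \<in> lists letters" using Cons.prems by auto
  obtain U V where UV: "U \<in> carrier M" "V \<in> carrier M" "gcls w = \<iota> U \<otimes>\<^bsub>G\<^esub> inv\<^bsub>G\<^esub> (\<iota> V)"
    using Cons.IH[OF w] by blast
  have lw: "gcls (l # w) = gcls [l] \<otimes>\<^bsub>G\<^esub> gcls w" using l w by simp
  from l show ?case
  proof (cases rule: letter_cases)
    case (1 x)
    then have "gcls (l # w) = \<iota> (cls [x] \<otimes>\<^bsub>M\<^esub> U) \<otimes>\<^bsub>G\<^esub> inv\<^bsub>G\<^esub> (\<iota> V)"
      using UV unfolding lw by (simp add: \<iota>_mult \<iota>_closed m_assoc)
    moreover have "cls [x] \<in> carrier M" using 1 by simp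
    ultimately show ?thesis using UV M.m_closed by blast
  next
    case (2 x)
    let ?x = "cls [x]"
    have x: "?x \<in> carrier M" using 2 by simp
    obtain Z where "is_right_lcm M {?x, U} Z" using right_lcm_exists x UV(1) by blast
    then obtain P Q where PQ: "P \<in> carrier M" "Q \<in> carrier M" "?x \<otimes>\<^bsub>M\<^esub> P = U \<otimes>\<^bsub>M\<^esub> Q"
      by (auto simp: is_right_lcm_def factor_def)
    then have "\<iota> ?x \<otimes>\<^bsub>G\<^esub> \<iota> P = \<iota> U \<otimes>\<^bsub>G\<^esub> \<iota> Q" using x UV by (simp add: \<iota>_mult[symmetric])
    then have "inv\<^bsub>G\<^esub> (\<iota> ?x) \<otimes>\<^bsub>G\<^esub> \<iota> U = \<iota> P \<otimes>\<^bsub>G\<^esub> inv\<^bsub>G\<^esub> (\<iota> Q)"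
      using x UV(1) PQ(1,2) by (intro fraction_swap \<iota>_closed)
    then have "gcls (l # w) = \<iota> P \<otimes>\<^bsub>G\<^esub> inv\<^bsub>G\<^esub> (\<iota> Q) \<otimes>\<^bsub>G\<^esub> inv\<^bsub>G\<^esub> (\<iota> V)"
      unfolding lw 2(2) UV(3) using x UV(1,2) by (simp add: \<iota>_closed m_assoc[symmetric])
    also have "\<dots> = \<iota> P \<otimes>\<^bsub>G\<^esub> inv\<^bsub>G\<^esub> (\<iota> (V \<otimes>\<^bsub>M\<^esub> Q))"
      using PQ(1,2) UV(2) by (simp add: \<iota>_mult \<iota>_closed inv_mult_group m_assoc)
    finally show ?thesis using PQ UV by blast
  qed
qed

text \<open>
  The mirror image of \<open>right_fraction\<close>: the word grows on the right, and left lcms are used.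
\<close>

lemma left_fraction:
  assumes "w \<in> lists letters"
  shows "\<exists>U\<in>carrier M. \<exists>V\<in>carrier M. gcls w = inv\<^bsub>G\<^esub> (\<iota> U) \<otimes>\<^bsub>G\<^esub> \<iota> V"
  using assms
proof (induction w rule: rev_induct)
  case Nil
  interpret M: monoid M by (rule monoid_M)
  interpret group G by (rule group_G)
  have "gcls [] = inv\<^bsub>G\<^esub> (\<iota> \<one>\<^bsub>M\<^esub>) \<otimes>\<^bsub>G\<^esub> \<iota> \<one>\<^bsub>M\<^esub>" by (simp add: \<iota>_one one_G[symmetric])
  then show ?case by blast
next
  case (snoc l w)
  interpret M: monoid M by (rule monoid_M)
  interpret group G by (rule group_G)
  have l: "l \<in> letters" and w: "w \<in> lists letters" using snoc.prems by auto
  obtain U V where UV: "U \<in> carrier M" "V \<in> carrier M" "gcls w = inv\<^bsub>G\<^esub> (\<iota> U) \<otimes>\<^bsub>G\<^esub> \<iota> V"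
    using snoc.IH[OF w] by blast
  have lw: "gcls (w @ [l]) = gcls w \<otimes>\<^bsub>G\<^esub> gcls [l]" using l w by simp
  from l show ?case
  proof (cases rule: letter_cases)
    case (1 x)
    then have "gcls (w @ [l]) = inv\<^bsub>G\<^esub> (\<iota> U) \<otimes>\<^bsub>G\<^esub> \<iota> (V \<otimes>\<^bsub>M\<^esub> cls [x])"
      using UV unfolding lw by (simp add: \<iota>_mult \<iota>_closed m_assoc)
    moreover have "cls [x] \<in> carrier M" using 1 by simp
    ultimately show ?thesis using UV M.m_closed by blast
  next
    case (2 x)
    let ?x = "cls [x]"
    have x: "?x \<in> carrier M" using 2 by simp
    obtain Z where "is_left_lcm M {?x, V} Z" using left_lcm_exists x UV(2) by blast
    then obtain P Q where PQ: "P \<in> carrier M" "Q \<in> carrier M" "Q \<otimes>\<^bsub>M\<^esub> ?x = P \<otimes>\<^bsub>M\<^esub> V"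
      by (auto simp: is_left_lcm_def right_divides_def)
    then have "\<iota> P \<otimes>\<^bsub>G\<^esub> \<iota> V = \<iota> Q \<otimes>\<^bsub>G\<^esub> \<iota> ?x" using x UV by (simp add: \<iota>_mult[symmetric])
    then have "\<iota> V \<otimes>\<^bsub>G\<^esub> inv\<^bsub>G\<^esub> (\<iota> ?x) = inv\<^bsub>G\<^esub> (\<iota> P) \<otimes>\<^bsub>G\<^esub> \<iota> Q"
      using x UV(2) PQ(1,2) by (intro fraction_swap[symmetric] \<iota>_closed)
    then have "gcls (w @ [l]) = inv\<^bsub>G\<^esub> (\<iota> U) \<otimes>\<^bsub>G\<^esub> (inv\<^bsub>G\<^esub> (\<iota> P) \<otimes>\<^bsub>G\<^esub> \<iota> Q)"
      unfolding lw 2(2) UV(3) using x UV(1,2) by (simp add: \<iota>_closed m_assoc)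
    also have "\<dots> = inv\<^bsub>G\<^esub> (\<iota> (P \<otimes>\<^bsub>M\<^esub> U)) \<otimes>\<^bsub>G\<^esub> \<iota> Q"
      using PQ(1,2) UV(1) by (simp add: \<iota>_mult \<iota>_closed inv_mult_group m_assoc)
    finally show ?thesis using PQ UV by blast
  qed
qed

lemma group_of_fractions_G: "group_of_fractions M G \<iota>"
  unfolding group_of_fractions_def carrier_G
  using group_G \<iota>_hom \<iota>_one \<iota>_inj right_fraction left_fraction by blast

section \<open>The structure group acts simply transitively on a lattice\<close>

text \<open>
  The image of the origin under a group element. The choice of a word is harmless,
  since congruent words act equally.
\<close>

definition gpos :: "('x \<times> bool) list set \<Rightarrow> 'x \<Rightarrow> int" where
  "gpos U = word_action (SOME w. w \<in> U) (\<lambda>_. 0)"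

lemma gpos_gcls: "w \<in> lists letters \<Longrightarrow> gpos (gcls w) = word_action w (\<lambda>_. 0)"
proof -
  assume w: "w \<in> lists letters"
  have "(SOME v. v \<in> gcls w) \<in> gcls w" using word_class_self[OF w] by (rule someI)
  then have "(w, SOME v. v \<in> gcls w) \<in> word_cong letters grels" by (simp add: word_class_def)
  then show ?thesis using word_action_cong by (simp add: gpos_def)
qed

lemma word_action_formal_inverse:
  "w \<in> lists letters \<Longrightarrow> word_action (formal_inverse w) (word_action w a) = a"
  using word_action_cong[OF formal_inverse_left[of w X rels]] by (simp add: fun_eq_iff)

lemma gpos_mult:
  assumes "K \<in> carrier G"
  shows "\<exists>\<sigma>. bij \<sigma> \<and> (\<forall>H\<in>carrier G. \<forall>y. gpos (K \<otimes>\<^bsub>G\<^esub> H) y = gpos K y + gpos H (\<sigma> y))"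
proof -
  obtain k where k: "k \<in> lists letters" "K = gcls k" using assms by (auto simp: carrier_G)
  obtain \<sigma> where \<sigma>: "bij \<sigma>" "\<And>a y. word_action k a y = word_action k (\<lambda>_. 0) y + a (\<sigma> y)"
    using word_action_affine[OF k(1)] by blast
  have "gpos (K \<otimes>\<^bsub>G\<^esub> H) y = gpos K y + gpos H (\<sigma> y)" if "H \<in> carrier G" for H y
    using that k \<sigma>(2)[of "gpos H" y] by (auto simp: carrier_G gpos_gcls)
  then show ?thesis using \<sigma>(1) by blast
qed

text \<open>
  The quotient \<open>H\<inverse> K\<close> fixes the origin. Written as a fraction \<open>U\<inverse> V\<close> of positive elements it
  therefore has \<open>vec U = vec V\<close>, so \<open>U = V\<close>.
\<close>

lemma gpos_inj: "inj_on gpos (carrier G)"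
proof (rule inj_onI)
  interpret group G by (rule group_G)
  fix H K assume "H \<in> carrier G" "K \<in> carrier G" and eq: "gpos H = gpos K"
  then obtain h k where h: "h \<in> lists letters" "H = gcls h" and k: "k \<in> lists letters" "K = gcls k"
    by (auto simp: carrier_G)
  let ?w = "formal_inverse h @ k"
  have w: "?w \<in> lists letters" using h k by simp
  have fixes_0: "word_action ?w (\<lambda>_. 0) = (\<lambda>_. 0)"
    using eq h k word_action_formal_inverse[OF h(1), of "\<lambda>_. 0"] by (simp add: gpos_gcls)
  obtain u v where uv: "u \<in> lists X" "v \<in> lists X"
    "gcls ?w = inv\<^bsub>G\<^esub> (\<iota> (cls u)) \<otimes>\<^bsub>G\<^esub> \<iota> (cls v)"
    using left_fraction[OF w] by (auto simp: carrier_M)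
  then have "gcls (pos_word u @ ?w) = gcls (pos_word v)"
    using w by (simp add: \<iota>_cls mult_G[symmetric] m_assoc[symmetric] del: mult_G)
  then have "word_action (pos_word u @ ?w) = word_action (pos_word v)"
    using uv w by (intro word_action_gcls) auto
  then have "word_action (pos_word u @ ?w) (\<lambda>_. 0) = vec v" by (simp add: vec_def)
  then have "vec u = vec v"
    unfolding word_action_simps(3) using fixes_0 by (simp add: vec_def)
  then have "cls u = cls v" using uv by (simp add: cls_eq_iff)
  then have "gcls ?w = \<one>\<^bsub>G\<^esub>" using uv by (simp add: \<iota>_cls)
  then have "inv\<^bsub>G\<^esub> H \<otimes>\<^bsub>G\<^esub> K = \<one>\<^bsub>G\<^esub>" using h k by (simp add: inv_G)
  then show "H = K" using h k by (metis gcls_closed inv_closed inv_equality inv_inv)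
qed

lemma vec_delta_power:
  "vec (concat (replicate k delta)) = (\<lambda>y. if y \<in> X then int k else 0)"
proof (induction k)
  case (Suc k)
  obtain \<sigma> where "\<And>y. \<sigma> y \<in> X \<longleftrightarrow> y \<in> X" "\<And>v y. vec (delta @ v) y = vec delta y + vec v (\<sigma> y)"
    using vec_append_affine[OF delta(1)] by metis
  then show ?case using Suc by (simp add: fun_eq_iff delta)
qed auto

text \<open>
  A power \<open>\<Delta>\<^sup>k\<close> with \<open>k\<close> at least every \<open>\<bar>a y\<bar>\<close> moves \<open>a\<close> to a vector with nonnegative entries, which is \<open>vec u\<close>
  for a positive word \<open>u\<close>; so \<open>a\<close> is the image of the origin under \<open>\<Delta>\<^sup>-\<^sup>k u\<close>.
\<close>

lemma gpos_surj:
  assumes "\<And>y. y \<notin> X \<Longrightarrow> a y = 0"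
  shows "a \<in> gpos ` carrier G"
proof -
  obtain k :: nat where k: "\<And>y. y \<in> X \<Longrightarrow> \<bar>a y\<bar> \<le> int k"
  proof -
    have "\<bar>a y\<bar> \<le> (\<Sum>y\<in>X. \<bar>a y\<bar>)" if "y \<in> X" for y
      using that finite_X by (intro member_le_sum) auto
    moreover have "(\<Sum>y\<in>X. \<bar>a y\<bar>) \<ge> 0" by (rule sum_nonneg) auto
    ultimately show thesis using that[of "nat (\<Sum>y\<in>X. \<bar>a y\<bar>)"] by simp
  qed
  let ?D = "concat (replicate k delta)"
  have D: "?D \<in> lists X" using delta(1) by (induction k) auto
  obtain \<sigma> where \<sigma>: "\<And>y. \<sigma> y \<in> X \<longleftrightarrow> y \<in> X"
    "\<And>a y. word_action (pos_word ?D) a y = vec ?D y + a (\<sigma> y)"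
    using word_action_affine[OF pos_word_letters[OF D]] unfolding vec_def by metis
  have "\<exists>u\<in>lists X. vec u = word_action (pos_word ?D) a"
  proof (rule vec_surj)
    show "0 \<le> word_action (pos_word ?D) a y" for y
      using k[of "\<sigma> y"] \<sigma>(1)[of y] assms[of "\<sigma> y"] by (cases "y \<in> X") (auto simp: \<sigma>(2) vec_delta_power)
    show "word_action (pos_word ?D) a y = 0" if "y \<notin> X" for y
      using that \<sigma>(1)[of y] assms[of "\<sigma> y"] by (simp add: \<sigma>(2) vec_delta_power)
  qed
  then obtain u where u: "u \<in> lists X" "vec u = word_action (pos_word ?D) a" by blast
  let ?w = "formal_inverse (pos_word ?D) @ pos_word u"
  have "word_action ?w (\<lambda>_. 0) = a"
    using u(2) word_action_formal_inverse[OF pos_word_letters[OF D]] by (simp add: vec_def)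
  moreover have w: "?w \<in> lists letters" using u(1) D by simp
  ultimately show ?thesis by (intro image_eqI[of _ _ "gcls ?w"]) (simp_all only: gpos_gcls gcls_closed)
qed

lemma gpos_bij: "bij_betw gpos (carrier G) {a. \<forall>y. y \<notin> X \<longrightarrow> a y = 0}"
proof (rule bij_betw_imageI[OF gpos_inj])
  have "gpos H y = 0" if "H \<in> carrier G" "y \<notin> X" for H y
    using that by (auto simp: carrier_G gpos_gcls word_action_supp)
  then show "gpos ` carrier G = {a. \<forall>y. y \<notin> X \<longrightarrow> a y = 0}" using gpos_surj by auto
qed

end

section \<open>Ordered cliques and their boundary\<close>

definition frag_map :: "('a \<Rightarrow> 'b) \<Rightarrow> ('a \<Rightarrow>\<^sub>0 int) \<Rightarrow> ('b \<Rightarrow>\<^sub>0 int)" where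
  "frag_map f = frag_extend (\<lambda>x. frag_of (f x))"

lemma frag_map_simps [simp]:
  "frag_map f 0 = 0" "frag_map f (frag_of x) = frag_of (f x)"
  "frag_map f (- a) = - frag_map f a"
  "frag_map f (a + b) = frag_map f a + frag_map f b"
  "frag_map f (a - b) = frag_map f a - frag_map f b"
  "frag_map f (frag_cmul k a) = frag_cmul k (frag_map f a)"
  by (simp_all add: frag_map_def frag_extend_add frag_extend_diff frag_extend_minus
      frag_extend_cmul del: minus_frag_cmul)

lemma keys_frag_map: "Poly_Mapping.keys (frag_map f c) \<subseteq> f ` Poly_Mapping.keys c"
  unfolding frag_map_def using keys_frag_extend[of "\<lambda>x. frag_of (f x)" c] by auto

lemma frag_induct [case_names zero one diff]:
  assumes "P 0" "\<And>x. P (frag_of x)" "\<And>a b. P a \<Longrightarrow> P b \<Longrightarrow> P (a - b)"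
  shows "P c"
  by (rule frag_induction[of c UNIV]) (use assms in auto)

lemma frag_extend_frag_extend:
  "frag_extend f (frag_extend g c) = frag_extend (\<lambda>x. frag_extend f (g x)) c"
  by (induction c rule: frag_induct) (auto simp: frag_extend_diff)

lemma frag_extend_frag_map: "frag_extend f (frag_map g c) = frag_extend (\<lambda>x. f (g x)) c"
  by (simp add: frag_map_def frag_extend_frag_extend)

lemma frag_map_frag_map: "frag_map f (frag_map g c) = frag_map (\<lambda>x. f (g x)) c"
  by (simp add: frag_map_def frag_extend_frag_extend)

lemma frag_extend_zero_map [simp]: "frag_extend (\<lambda>x. 0) c = 0"
  by (simp add: frag_extend_eq_0)

lemma frag_extend_add_map:
  "frag_extend (\<lambda>x. f x + g x) c = frag_extend f c + frag_extend g c"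
  by (induction c rule: frag_induct) (auto simp: frag_extend_diff)

lemma frag_extend_diff_map:
  "frag_extend (\<lambda>x. f x - g x) c = frag_extend f c - frag_extend g c"
  by (induction c rule: frag_induct) (auto simp: frag_extend_diff)

text \<open>
  The alternating sum of the faces in recursive form: either the first vertex is dropped, or a later
  one is, with one more sign. The only face of a single vertex is the empty list, so the
  resulting complex is augmented.
\<close>

primrec simplex_boundary :: "'v list \<Rightarrow> ('v list \<Rightarrow>\<^sub>0 int)" where
  "simplex_boundary [] = 0"
| "simplex_boundary (a # as) = frag_of as - frag_map ((#) a) (simplex_boundary as)"

definition boundary :: "('v list \<Rightarrow>\<^sub>0 int) \<Rightarrow> ('v list \<Rightarrow>\<^sub>0 int)" where
  "boundary = frag_extend simplex_boundary"

lemma boundary_simps [simp]: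
  "boundary 0 = 0" "boundary (frag_of as) = simplex_boundary as"
  "boundary (- a) = - boundary a"
  "boundary (a + b) = boundary a + boundary b"
  "boundary (a - b) = boundary a - boundary b"
  "boundary (frag_cmul k a) = frag_cmul k (boundary a)"
  by (simp_all add: boundary_def frag_extend_add frag_extend_diff frag_extend_minus
      frag_extend_cmul del: minus_frag_cmul)

lemma boundary_cons: "boundary (frag_map ((#) v) c) = c - frag_map ((#) v) (boundary c)"
  by (induction c rule: frag_induct) auto

lemma frag_cmul_diff_right: "frag_cmul k (a - b) = frag_cmul k a - frag_cmul k b"
  using frag_cmul_distrib2[of k "a - b" b] by simp

text \<open>
  In a simplex with \<open>k\<close> vertices followed by \<open>v\<close>, the vertex \<open>v\<close> has position \<open>k\<close>, counted from \<open>0\<close>.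
\<close>

lemma boundary_snoc:
  assumes "\<And>as. as \<in> Poly_Mapping.keys c \<Longrightarrow> length as = k"
  shows "boundary (frag_map (\<lambda>as. as @ [v]) c) =
    frag_map (\<lambda>as. as @ [v]) (boundary c) + frag_cmul ((-1) ^ k) c"
proof -
  have simplex: "simplex_boundary (as @ [v]) =
      frag_map (\<lambda>as. as @ [v]) (simplex_boundary as) + frag_cmul ((-1) ^ length as) (frag_of as)"
    for as :: "'a list"
    by (induction as) (auto simp: frag_map_frag_map algebra_simps simp flip: minus_frag_cmul
        simp del: minus_frag_cmul)
  have "Poly_Mapping.keys c \<subseteq> {as. length as = k}"
    using assms by auto
  then show ?thesis
    by (induction c rule: frag_induction)
      (auto simp: simplex algebra_simps frag_cmul_diff_right)
qed

lemma boundary_boundary [simp]: "boundary (boundary c) = 0"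
proof -
  have "boundary (simplex_boundary as) = 0" for as :: "'a list"
    by (induction as) (simp_all add: boundary_cons)
  then show ?thesis
    by (induction c rule: frag_induct) auto
qed

text \<open>
  The ordered simplices with \<open>k\<close> vertices in \<open>F\<close>, so the simplices of dimension \<open>k - 1\<close>; for \<open>k = 0\<close> only the
  empty simplex. All pairs of vertices are compared, not only neighbours: lying in a common unit cube, the
  relation of interest below, is not transitive.
\<close>

definition cliques :: "('v \<Rightarrow> 'v \<Rightarrow> bool) \<Rightarrow> 'v set \<Rightarrow> nat \<Rightarrow> 'v list set" where
  "cliques E F k = {as. set as \<subseteq> F \<and> sorted_wrt E as \<and> length as = k}"

lemma cliques_mono: "F \<subseteq> F' \<Longrightarrow> cliques E F k \<subseteq> cliques E F' k"
  by (auto simp: cliques_def)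

lemma keys_simplex_boundary:
  "Poly_Mapping.keys (simplex_boundary as) \<subseteq>
    {bs. Suc (length bs) = length as \<and> set bs \<subseteq> set as \<and> (\<forall>E. sorted_wrt E as \<longrightarrow> sorted_wrt E bs)}"
proof (induction as)
  case (Cons a as)
  show ?case
  proof
    fix bs assume "bs \<in> Poly_Mapping.keys (simplex_boundary (a # as))"
    then have "bs \<in> Poly_Mapping.keys (frag_of as) \<union>
        Poly_Mapping.keys (frag_map ((#) a) (simplex_boundary as))"
      using keys_diff by fastforce
    then consider "bs = as" | cs where "bs = a # cs" "cs \<in> Poly_Mapping.keys (simplex_boundary as)"
      using keys_frag_map by fastforce
    then show "bs \<in> {bs. Suc (length bs) = length (a # as) \<and> set bs \<subseteq> set (a # as) \<and>
        (\<forall>E. sorted_wrt E (a # as) \<longrightarrow> sorted_wrt E bs)}"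
      using Cons.IH by cases (auto 0 4)
  qed
qed auto

lemma boundary_cliques:
  assumes "Poly_Mapping.keys c \<subseteq> cliques E F (Suc k)"
  shows "Poly_Mapping.keys (boundary c) \<subseteq> cliques E F k"
proof -
  have "Poly_Mapping.keys (simplex_boundary as) \<subseteq> cliques E F k" if "as \<in> cliques E F (Suc k)" for as
    using keys_simplex_boundary[of as] that unfolding cliques_def by auto
  then show ?thesis
    using keys_frag_extend[of simplex_boundary c] assms unfolding boundary_def by blast
qed

text \<open>
  The case \<open>k = 0\<close>, which asks for a vertex, is included: with it the complex of a cone is exact in
  all degrees and the link of a vertex contributes uniformly in the induction on vertices.
\<close>

definition acyclic_cliques :: "('v \<Rightarrow> 'v \<Rightarrow> bool) \<Rightarrow> 'v set \<Rightarrow> bool" where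
  "acyclic_cliques E F \<longleftrightarrow> (\<forall>k c. Poly_Mapping.keys c \<subseteq> cliques E F k \<and> boundary c = 0 \<longrightarrow>
     (\<exists>d. Poly_Mapping.keys d \<subseteq> cliques E F (Suc k) \<and> boundary d = c))"

text \<open>
  Coning off: prefixing the apex \<open>m\<close> is a contracting homotopy. A simplex that starts with \<open>m\<close> already is
  sent to \<open>0\<close>, since its cone would be degenerate.
\<close>

lemma acyclic_cliques_cone:
  assumes "m \<in> F" and apex: "\<And>u. u \<in> F \<Longrightarrow> u \<noteq> m \<Longrightarrow> E m u" and first: "\<And>u. u \<in> F \<Longrightarrow> \<not> E u m"
  shows "acyclic_cliques E F"
  unfolding acyclic_cliques_def
proof (intro allI impI, elim conjE)
  fix k and c :: "'a list \<Rightarrow>\<^sub>0 int"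
  assume c: "Poly_Mapping.keys c \<subseteq> cliques E F k" and cycle: "boundary c = 0"
  define cone where "cone as = (if as \<noteq> [] \<and> hd as = m then 0 else frag_of (m # as))" for as
  define D where "D = frag_extend cone"
  have D_simps [simp]: "D 0 = 0" "D (frag_of as) = cone as" "D (a + b) = D a + D b"
    "D (a - b) = D a - D b" for a b as
    by (simp_all add: D_def frag_extend_add frag_extend_diff)
  have D_free: "D c = frag_map ((#) m) c" if "\<And>as. as \<in> Poly_Mapping.keys c \<Longrightarrow> m \<notin> set as" for c
    unfolding D_def frag_map_def using that
    by (intro frag_extend_eq) (use list.set_sel(1) in \<open>fastforce simp: cone_def\<close>)
  have D_cons: "D (frag_map ((#) m) c) = 0" for c
    by (induction c rule: frag_induct) (auto simp: cone_def)
  \<comment> \<open>the two terms with \<open>m\<close> in front cancel if \<open>as\<close> does not start with \<open>m\<close>; otherwise one term is left\<close>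
  have homotopy: "boundary (D (frag_of as)) + D (boundary (frag_of as)) = frag_of as"
    if as: "as \<in> cliques E F k" for as
  proof (cases "as \<noteq> [] \<and> hd as = m")
    case True
    then obtain bs where bs: "as = m # bs" by (metis list.collapse)
    have "m \<notin> set bs"
      using as first \<open>m \<in> F\<close> unfolding cliques_def bs by auto
    then show ?thesis
      by (simp add: bs D_cons) (auto simp: cone_def dest: list.set_sel(1))
  next
    case False
    have "m \<notin> set as"
    proof
      assume "m \<in> set as"
      with False obtain b bs where bs: "as = b # bs" "m \<in> set bs"
        by (cases as) auto
      with as have "E b m" "b \<in> F" by (auto simp: cliques_def)
      with first show False by blast
    qed
    then have "D (simplex_boundary as) = frag_map ((#) m) (simplex_boundary as)"
      using keys_simplex_boundary[of as] by (intro D_free) blast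
    moreover have "cone as = frag_of (m # as)" using False by (auto simp: cone_def)
    ultimately show ?thesis by simp
  qed
  have "boundary (D c) + D (boundary c) = c"
    using c by (induction c rule: frag_induction) (use homotopy in \<open>auto simp: algebra_simps\<close>)
  moreover have "Poly_Mapping.keys (D c) \<subseteq> cliques E F (Suc k)"
  proof -
    have "Poly_Mapping.keys (cone as) \<subseteq> cliques E F (Suc k)" if as: "as \<in> cliques E F k" for as
    proof (cases "as \<noteq> [] \<and> hd as = m")
      case False
      have "E m u" if "u \<in> set as" for u
      proof (rule apex)
        show "u \<in> F" using that as by (auto simp: cliques_def)
        show "u \<noteq> m"
        proof
          assume "u = m"
          with False that obtain b bs where bs: "as = b # bs" "m \<in> set bs"
            by (cases as) auto
          with as have "E b m" "b \<in> F" by (auto simp: cliques_def)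
          with first show False by blast
        qed
      qed
      then show ?thesis using False as \<open>m \<in> F\<close> by (auto simp: cone_def cliques_def)
    qed (auto simp: cone_def)
    then show ?thesis
      using keys_frag_extend[of cone c] c unfolding D_def by blast
  qed
  ultimately show "\<exists>d. Poly_Mapping.keys d \<subseteq> cliques E F (Suc k) \<and> boundary d = c"
    using cycle by auto
qed

text \<open>
  In a clique, a vertex \<open>v\<close> without outgoing edges can only be last, and the vertices before it
  form a clique in its link. So a cycle is \<open>c' + e v\<close> with \<open>e\<close> a chain in the link, and comparing the
  simplices that contain \<open>v\<close> in its boundary shows that \<open>e\<close> is a cycle. If \<open>e = \<partial>e'\<close>, then
  subtracting \<open>\<partial>(e' v)\<close> moves the cycle off \<open>v\<close>.
\<close>

lemma acyclic_cliques_insert: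
  assumes F': "acyclic_cliques E F" and link: "acyclic_cliques E {u \<in> F. E u v}"
    and "v \<notin> F" and last: "\<And>u. u \<in> insert v F \<Longrightarrow> \<not> E v u"
  shows "acyclic_cliques E (insert v F)"
  unfolding acyclic_cliques_def
proof (intro allI impI, elim conjE)
  fix k and c :: "'a list \<Rightarrow>\<^sub>0 int"
  assume c: "Poly_Mapping.keys c \<subseteq> cliques E (insert v F) k" and cycle: "boundary c = 0"
  let ?L = "{u \<in> F. E u v}"
  have v_last: "as = butlast as @ [v] \<and> butlast as \<in> cliques E ?L (k - 1) \<and> k > 0"
    if as: "as \<in> cliques E (insert v F) k" and "v \<in> set as" for as k
  proof -
    obtain us ws where as_eq: "as = us @ v # ws" using \<open>v \<in> set as\<close> by (meson split_list)
    have "ws = []"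
      using as last by (cases ws) (auto simp: cliques_def as_eq sorted_wrt_append)
    moreover have "set us \<subseteq> ?L"
    proof
      fix u assume "u \<in> set us"
      then have "E u v" "u \<in> insert v F" using as by (auto simp: cliques_def as_eq sorted_wrt_append)
      then show "u \<in> ?L" using last by auto
    qed
    ultimately show ?thesis
      using as by (auto simp: cliques_def as_eq sorted_wrt_append)
  qed
  \<comment> \<open>the chain to which \<open>v\<close> is appended\<close>
  define T where "T = frag_extend (\<lambda>as. if v \<in> set as then frag_of (butlast as) else 0)"
  define c' where "c' = frag_extend (\<lambda>as. if v \<in> set as then 0 else frag_of as) c"
  define e where "e = T c"
  let ?app = "frag_map (\<lambda>as. as @ [v])"
  have T_app: "T (?app a) = a" for a
    unfolding T_def frag_extend_frag_map by (simp flip: frag_expansion)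
  have T_F: "T a = 0" if "Poly_Mapping.keys a \<subseteq> cliques E F l" for a l
    unfolding T_def using that \<open>v \<notin> F\<close> by (intro frag_extend_eq_0) (auto simp: cliques_def)
  have T_simps: "T (a + b) = T a + T b" "T (frag_cmul i a) = frag_cmul i (T a)" for a b i
    by (simp_all add: T_def frag_extend_add frag_extend_cmul)
  have split: "c = c' + ?app e"
    using c unfolding c'_def e_def T_def
  proof (induction c rule: frag_induction)
    case (one as)
    then show ?case using v_last[of as k] by auto
  qed (auto simp: frag_extend_diff algebra_simps)
  have keys_c': "Poly_Mapping.keys c' \<subseteq> cliques E F k"
    using keys_frag_extend[of "\<lambda>as. if v \<in> set as then 0 else frag_of as" c] c
    unfolding c'_def by (fastforce simp: cliques_def split: if_splits)
  have keys_e: "Poly_Mapping.keys e \<subseteq> cliques E ?L (k - 1)"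
    using keys_frag_extend[of "\<lambda>as. if v \<in> set as then frag_of (butlast as) else 0" c] c v_last
    unfolding e_def T_def by (fastforce split: if_splits)
  have keys_e_F: "Poly_Mapping.keys e \<subseteq> cliques E F (k - 1)"
    using keys_e cliques_mono[of ?L F] by blast
  have len_e: "length as = k - 1" if "as \<in> Poly_Mapping.keys e" for as
    using keys_e that by (auto simp: cliques_def)
  have bd_c': "T (boundary c') = 0"
  proof (cases k)
    case 0
    then have "Poly_Mapping.keys c' \<subseteq> {[]}" using keys_c' by (auto simp: cliques_def)
    then have "boundary c' = 0" by (induction c' rule: frag_induction) auto
    then show ?thesis by (simp add: T_def)
  next
    case (Suc j)
    then show ?thesis using boundary_cliques[of c' E F j] keys_c' T_F by blast
  qed
  have "T (boundary c) = boundary e"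
    unfolding split
    by (simp add: boundary_snoc[OF len_e] T_simps T_app bd_c' T_F[OF keys_e_F])
  then have "boundary e = 0" using cycle by (simp add: T_def)
  then obtain e' where e': "Poly_Mapping.keys e' \<subseteq> cliques E ?L (Suc (k - 1))" "boundary e' = e"
    using link keys_e unfolding acyclic_cliques_def by blast
  \<comment> \<open>the bound \<open>k - 1\<close> is truncated for \<open>k = 0\<close>, where no simplex contains \<open>v\<close>\<close>
  show "\<exists>d. Poly_Mapping.keys d \<subseteq> cliques E (insert v F) (Suc k) \<and> boundary d = c"
  proof (cases "k = 0")
    case True
    have "e = 0"
    proof -
      have "T c = 0"
        unfolding T_def using c True by (intro frag_extend_eq_0) (auto simp: cliques_def)
      then show ?thesis by (simp add: e_def)
    qed
    then have "Poly_Mapping.keys c \<subseteq> cliques E F k" using split keys_c' by simp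
    then obtain d where "Poly_Mapping.keys d \<subseteq> cliques E F (Suc k)" "boundary d = c"
      using F' cycle unfolding acyclic_cliques_def by blast
    then show ?thesis using cliques_mono[of F "insert v F" E "Suc k"] by blast
  next
    case False
    then have k: "Suc (k - 1) = k" by simp
    have keys_e': "Poly_Mapping.keys e' \<subseteq> cliques E ?L k" using e'(1) k by simp
    have len_e': "length as = k" if "as \<in> Poly_Mapping.keys e'" for as
      using keys_e' that by (auto simp: cliques_def)
    have bd: "boundary (?app e') = ?app e + frag_cmul ((-1) ^ k) e'"
      by (simp add: boundary_snoc[OF len_e'] e'(2))
    define r where "r = c' - frag_cmul ((-1) ^ k) e'"
    have r: "r = c - boundary (?app e')"
      using bd by (simp add: split r_def)
    then have "boundary r = 0" using cycle by simp
    moreover have "Poly_Mapping.keys r \<subseteq> cliques E F k"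
      using keys_c' keys_e' cliques_mono[of ?L F E k] keys_diff[of c' "frag_cmul ((-1) ^ k) e'"]
        keys_cmul[of "(-1) ^ k" e'] unfolding r_def by blast
    ultimately obtain d where d: "Poly_Mapping.keys d \<subseteq> cliques E F (Suc k)" "boundary d = r"
      using F' unfolding acyclic_cliques_def by blast
    have "Poly_Mapping.keys (?app e') \<subseteq> cliques E (insert v F) (Suc k)"
    proof -
      have "as @ [v] \<in> cliques E (insert v F) (Suc k)" if "as \<in> cliques E ?L k" for as
        using that by (auto simp: cliques_def sorted_wrt_append)
      then show ?thesis using keys_frag_map[of "\<lambda>as. as @ [v]" e'] keys_e' by blast
    qed
    then have "Poly_Mapping.keys (d + ?app e') \<subseteq> cliques E (insert v F) (Suc k)"
      using d(1) cliques_mono[of F "insert v F" E "Suc k"] keys_add[of d "?app e'"] by blast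
    moreover have "boundary (d + ?app e') = c" using d(2) r by simp
    ultimately show ?thesis by blast
  qed
qed

text \<open>
  The vertices of \<open>F\<close> are identified with integer vectors \<open>\<ge> b\<close>. Take \<open>v \<noteq> b\<close> of maximal coordinate sum; it has
  no outgoing edges. Its link consists of points \<open>u \<noteq> v\<close> with \<open>v - 1 \<le> u \<le> v\<close> and \<open>u \<ge> b\<close>, and all of them lie above
  \<open>m = max (v - 1) b\<close>, which belongs to \<open>F\<close> by the last hypothesis: the link is a cone. This
  hypothesis survives the removal of \<open>v\<close>, because \<open>v\<close> could only be the apex for a vertex
  with a larger sum.
\<close>

lemma acyclic_cliques_lattice:
  fixes pos :: "'v \<Rightarrow> 'x \<Rightarrow> int"
  assumes fin: "finite F" and "b \<in> F"
    and "inj_on pos F" and X: "finite X" and supp: "\<And>u y. u \<in> F \<Longrightarrow> y \<notin> X \<Longrightarrow> pos u y = 0"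
    and E: "\<And>u v. u \<in> F \<Longrightarrow> v \<in> F \<Longrightarrow>
      E u v \<longleftrightarrow> pos u \<noteq> pos v \<and> (\<forall>y. pos u y \<le> pos v y \<and> pos v y \<le> pos u y + 1)"
    and low: "\<And>u y. u \<in> F \<Longrightarrow> pos b y \<le> pos u y"
    and closed: "\<And>v. v \<in> F \<Longrightarrow> \<exists>m\<in>F. pos m = (\<lambda>y. max (pos v y - 1) (pos b y))"
  shows "acyclic_cliques E F"
  using assms(1-3) supp E low closed
proof (induction "card F" arbitrary: F)
  case 0
  then show ?case by auto
next
  case (Suc n)
  show ?case
  proof (cases "F = {b}")
    case True
    show ?thesis
      by (rule acyclic_cliques_cone[of b]) (use True Suc.prems(5)[of b b] in auto)
  next
    case False
    define deg where "deg u = (\<Sum>y\<in>X. pos u y)" for u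
    have deg_less: "deg u < deg v"
      if uv: "u \<in> F" "v \<in> F" "pos u \<noteq> pos v" "\<forall>y. pos u y \<le> pos v y" for u v
    proof -
      obtain y where y: "pos u y \<noteq> pos v y" using uv(3) by auto
      then have "y \<in> X" using Suc.prems(4) uv(1,2) by metis
      then show ?thesis unfolding deg_def
        using y uv(4) by (intro sum_strict_mono_ex1) (auto simp: X order.strict_iff_order)
    qed
    obtain v where v: "v \<in> F" "\<And>u. u \<in> F \<Longrightarrow> deg u \<le> deg v"
    proof -
      have "Max (deg ` F) \<in> deg ` F" using Suc.prems(1,2) by (intro Max_in) auto
      then obtain v where "v \<in> F" "deg v = Max (deg ` F)" by auto
      then show thesis using that[of v] Suc.prems(1) by simp
    qed
    have "v \<noteq> b"
    proof
      assume "v = b"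
      obtain u where u: "u \<in> F" "u \<noteq> b" using False Suc.prems(2) by blast
      then have "pos b \<noteq> pos u" using Suc.prems(2,3) by (metis inj_onD)
      then have "deg b < deg u" using deg_less[of b u] Suc.prems(2,6) u by blast
      with v(2)[OF u(1)] \<open>v = b\<close> show False by simp
    qed
    let ?F = "F - {v}"
    have vF: "insert v ?F = F" using v(1) by blast
    obtain m where m: "m \<in> F" "pos m = (\<lambda>y. max (pos v y - 1) (pos b y))"
      using Suc.prems(7) v(1) by blast
    have "pos v \<noteq> pos b" using \<open>v \<noteq> b\<close> v(1) Suc.prems(2,3) by (metis inj_onD)
    then obtain y0 where y0: "pos v y0 \<noteq> pos b y0" by auto
    have "pos b y0 < pos v y0" using y0 Suc.prems(6)[OF v(1), of y0] by simp
    then have "pos m y0 < pos v y0" by (simp add: m(2))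
    then have m_v: "pos m \<noteq> pos v" by auto
    have "E m v"
      using Suc.prems(5)[OF m(1) v(1)] m_v Suc.prems(6)[OF v(1)] by (auto simp: m(2))
    have IH: "acyclic_cliques E ?F"
    proof (rule Suc.hyps(1))
      show "n = card ?F" using Suc.hyps(2) Suc.prems(1) v(1) by simp
      show "finite ?F" "b \<in> ?F" "inj_on pos ?F"
        using Suc.prems(1-3) \<open>v \<noteq> b\<close> by (auto simp: inj_on_diff)
      show "\<exists>m\<in>?F. pos m = (\<lambda>y. max (pos w y - 1) (pos b y))" if w: "w \<in> ?F" for w
      proof -
        obtain m' where m': "m' \<in> F" "pos m' = (\<lambda>y. max (pos w y - 1) (pos b y))"
          using Suc.prems(7) w by blast
        have le: "\<forall>y. pos m' y \<le> pos w y" using Suc.prems(6) w by (auto simp: m'(2))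
        have "m' \<noteq> v"
        proof
          assume "m' = v"
          then have "pos v \<noteq> pos w" using w v(1) Suc.prems(3) by (metis Diff_iff inj_onD singletonI)
          then have "deg v < deg w" using deg_less[of v w] le w v(1) \<open>m' = v\<close> by blast
          then show False using v(2)[of w] w by simp
        qed
        then show ?thesis using m' by blast
      qed
    qed (use Suc.prems(4,5,6) in auto)
    have "acyclic_cliques E {u \<in> ?F. E u v}"
    proof (rule acyclic_cliques_cone[of m])
      show "m \<in> {u \<in> ?F. E u v}" using m(1) m_v \<open>E m v\<close> by auto
      fix u assume u: "u \<in> {u \<in> ?F. E u v}"
      then have uv: "\<forall>y. pos u y \<le> pos v y \<and> pos v y \<le> pos u y + 1"
        using Suc.prems(5)[of u v] v(1) by auto
      have mu: "pos m y \<le> pos u y" for y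
        using uv Suc.prems(6)[of u y] u unfolding m(2) by (auto simp: algebra_simps)
      show "\<not> E u m"
      proof
        assume "E u m"
        then have "pos u \<noteq> pos m" "\<forall>y. pos u y \<le> pos m y" using Suc.prems(5)[of u m] u m(1) by auto
        then show False using mu by (meson order_antisym ext)
      qed
      assume "u \<noteq> m"
      then have "pos m \<noteq> pos u" using u m(1) Suc.prems(3) by (auto dest: inj_onD)
      moreover have "pos u y \<le> pos m y + 1" for y
      proof -
        have "pos v y \<le> pos m y + 1" by (simp add: m(2))
        then show ?thesis using uv by (meson order_trans)
      qed
      ultimately show "E m u" using Suc.prems(5)[of m u] u m(1) mu by auto
    qed
    moreover have "\<not> E v u" if "u \<in> insert v ?F" for u
    proof
      assume "E v u"
      then have "deg v < deg u" using deg_less[of v u] Suc.prems(5)[of v u] v(1) that by auto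
      then show False using v that by fastforce
    qed
    ultimately have "acyclic_cliques E (insert v ?F)"
      by (intro acyclic_cliques_insert IH) auto
    then show ?thesis by (simp only: vF)
  qed
qed

section \<open>Modules with a finite dual basis\<close>

lemma module_homD:
  assumes "f \<in> module_hom R M N"
  shows "x \<in> carrier M \<Longrightarrow> f x \<in> carrier N"
    and "x \<in> carrier M \<Longrightarrow> y \<in> carrier M \<Longrightarrow> f (x \<oplus>\<^bsub>M\<^esub> y) = f x \<oplus>\<^bsub>N\<^esub> f y"
    and "a \<in> carrier R \<Longrightarrow> x \<in> carrier M \<Longrightarrow> f (a \<odot>\<^bsub>M\<^esub> x) = a \<odot>\<^bsub>N\<^esub> f x"
  using assms by (auto simp: module_hom_def)

lemma additive_group_hom:
  assumes "abelian_group M" "abelian_group N"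
    and "\<And>x. x \<in> carrier M \<Longrightarrow> f x \<in> carrier N"
    and "\<And>x y. x \<in> carrier M \<Longrightarrow> y \<in> carrier M \<Longrightarrow> f (x \<oplus>\<^bsub>M\<^esub> y) = f x \<oplus>\<^bsub>N\<^esub> f y"
  shows "abelian_group_hom M N f"
  using assms
  by (intro abelian_group_hom.intro abelian_group_hom_axioms.intro)
     (auto simp: group_hom_def group_hom_axioms_def hom_def abelian_group.a_group)

context left_module
begin

lemma smult_hom: "a \<in> carrier R \<Longrightarrow> abelian_group_hom M M (\<lambda>x. a \<odot>\<^bsub>M\<^esub> x)"
  by (rule additive_group_hom) (auto simp: M.abelian_group_axioms smult_closed smult_r_distr)

end

lemma additive_finsum:
  assumes hom: "abelian_group_hom M N f" and "finite I" "h \<in> I \<rightarrow> carrier M"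
  shows "f (finsum M h I) = finsum N (\<lambda>i. f (h i)) I"
proof -
  interpret abelian_group_hom M N f by (rule hom)
  show ?thesis
    using assms(2,3) by (induction I) (auto simp: Pi_def)
qed

text \<open>
  Generators \<open>b i\<close> together with linear forms \<open>\<phi> i\<close> such that \<open>x = \<Sum>i. \<phi> i x \<cdot> b i\<close>. By the dual basis lemma
  this characterises the finitely generated projective modules; a finite basis with its coordinates is an example.
\<close>

definition finite_dual_basis ::
  "'r ring \<Rightarrow> ('r, 'm) module \<Rightarrow> 'i set \<Rightarrow> ('i \<Rightarrow> 'm) \<Rightarrow> ('i \<Rightarrow> 'm \<Rightarrow> 'r) \<Rightarrow> bool" where
  "finite_dual_basis R P I b \<phi> \<longleftrightarrow> finite I \<and> b \<in> I \<rightarrow> carrier P \<and>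
     (\<forall>i\<in>I. \<phi> i \<in> carrier P \<rightarrow> carrier R \<and>
        (\<forall>x\<in>carrier P. \<forall>y\<in>carrier P. \<phi> i (x \<oplus>\<^bsub>P\<^esub> y) = \<phi> i x \<oplus>\<^bsub>R\<^esub> \<phi> i y) \<and>
        (\<forall>r\<in>carrier R. \<forall>x\<in>carrier P. \<phi> i (r \<odot>\<^bsub>P\<^esub> x) = r \<otimes>\<^bsub>R\<^esub> \<phi> i x)) \<and>
     (\<forall>x\<in>carrier P. x = finsum P (\<lambda>i. \<phi> i x \<odot>\<^bsub>P\<^esub> b i) I)"

locale dual_basis = P?: left_module R P for R :: "'r ring" (structure) and P :: "('r, 'm) module" +
  fixes I :: "'i set" and b :: "'i \<Rightarrow> 'm" and \<phi> :: "'i \<Rightarrow> 'm \<Rightarrow> 'r"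
  assumes dual_basis: "finite_dual_basis R P I b \<phi>"
begin

lemma finite_I: "finite I"
  and b_closed: "i \<in> I \<Longrightarrow> b i \<in> carrier P"
  and \<phi>_closed: "i \<in> I \<Longrightarrow> x \<in> carrier P \<Longrightarrow> \<phi> i x \<in> carrier R"
  and \<phi>_add: "i \<in> I \<Longrightarrow> x \<in> carrier P \<Longrightarrow> y \<in> carrier P \<Longrightarrow>
    \<phi> i (x \<oplus>\<^bsub>P\<^esub> y) = \<phi> i x \<oplus>\<^bsub>R\<^esub> \<phi> i y"
  and \<phi>_smult: "i \<in> I \<Longrightarrow> r \<in> carrier R \<Longrightarrow> x \<in> carrier P \<Longrightarrow> \<phi> i (r \<odot>\<^bsub>P\<^esub> x) = r \<otimes>\<^bsub>R\<^esub> \<phi> i x"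
  and expand: "x \<in> carrier P \<Longrightarrow> finsum P (\<lambda>i. \<phi> i x \<odot>\<^bsub>P\<^esub> b i) I = x"
  using dual_basis by (auto simp: finite_dual_basis_def)

text \<open>
  Lift the values \<open>f (b i)\<close> arbitrarily to elements \<open>a i\<close>. The assignment \<open>x \<mapsto> \<Sum>i. \<phi> i x \<cdot> a i\<close> is linear, whatever the lifts are.
\<close>

lemma projective: "projective_module R P"
  unfolding projective_module_def
proof (intro conjI allI impI, rule P.left_module_axioms, elim conjE)
  fix A B :: "('r, 'm \<Rightarrow> 'r) module" and p f
  assume "left_module R A" "left_module R B" and p: "p \<in> module_hom R A B"
    and surj: "p ` carrier A = carrier B" and f: "f \<in> module_hom R P B"
  interpret A: left_module R A by fact
  interpret B: left_module R B by fact
  have "\<forall>i\<in>I. \<exists>a\<in>carrier A. p a = f (b i)"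
    using surj module_homD(1)[OF f] b_closed by (metis imageE)
  then obtain a where a: "\<And>i. i \<in> I \<Longrightarrow> a i \<in> carrier A" "\<And>i. i \<in> I \<Longrightarrow> p (a i) = f (b i)"
    by metis
  define g where "g x = finsum A (\<lambda>i. \<phi> i x \<odot>\<^bsub>A\<^esub> a i) I" for x
  have term_closed: "\<phi> i x \<odot>\<^bsub>A\<^esub> a i \<in> carrier A" if "i \<in> I" "x \<in> carrier P" for i x
    using that a by (simp add: A.smult_closed \<phi>_closed)
  have "g \<in> module_hom R P A"
    unfolding module_hom_def
  proof (intro CollectI conjI ballI funcsetI)
    show "g x \<in> carrier A" if "x \<in> carrier P" for x
      using that term_closed unfolding g_def by (intro A.M.finsum_closed) auto
    show "g (x \<oplus>\<^bsub>P\<^esub> y) = g x \<oplus>\<^bsub>A\<^esub> g y" if "x \<in> carrier P" "y \<in> carrier P" for x y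
    proof -
      have "g (x \<oplus>\<^bsub>P\<^esub> y) = finsum A (\<lambda>i. \<phi> i x \<odot>\<^bsub>A\<^esub> a i \<oplus>\<^bsub>A\<^esub> \<phi> i y \<odot>\<^bsub>A\<^esub> a i) I"
        unfolding g_def using that term_closed a
        by (intro A.M.finsum_cong') (auto simp: \<phi>_add \<phi>_closed A.smult_l_distr)
      also have "\<dots> = g x \<oplus>\<^bsub>A\<^esub> g y"
        unfolding g_def using that term_closed by (intro A.M.finsum_addf) auto
      finally show ?thesis .
    qed
    show "g (r \<odot>\<^bsub>P\<^esub> x) = r \<odot>\<^bsub>A\<^esub> g x" if "r \<in> carrier R" "x \<in> carrier P" for r x
    proof -
      have "r \<odot>\<^bsub>A\<^esub> g x = finsum A (\<lambda>i. r \<odot>\<^bsub>A\<^esub> (\<phi> i x \<odot>\<^bsub>A\<^esub> a i)) I"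
        unfolding g_def using that term_closed
        by (intro additive_finsum[OF A.smult_hom finite_I]) auto
      also have "\<dots> = g (r \<odot>\<^bsub>P\<^esub> x)"
        unfolding g_def using that a
        by (intro A.M.finsum_cong') (auto simp: \<phi>_smult \<phi>_closed A.smult_assoc A.smult_closed)
      finally show ?thesis by simp
    qed
  qed
  moreover have "p (g x) = f x" if x: "x \<in> carrier P" for x
  proof -
    have p_hom: "abelian_group_hom A B p"
      by (intro additive_group_hom) (auto simp: A.M.abelian_group_axioms B.M.abelian_group_axioms module_homD[OF p])
    have f_hom: "abelian_group_hom P B f"
      by (intro additive_group_hom) (auto simp: M.abelian_group_axioms B.M.abelian_group_axioms module_homD[OF f])
    have "p (g x) = finsum B (\<lambda>i. p (\<phi> i x \<odot>\<^bsub>A\<^esub> a i)) I"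
      unfolding g_def using term_closed x by (intro additive_finsum[OF p_hom finite_I]) auto
    also have "\<dots> = finsum B (\<lambda>i. f (\<phi> i x \<odot>\<^bsub>P\<^esub> b i)) I"
      using x a b_closed
      by (intro B.M.finsum_cong') (auto simp: module_homD[OF p] module_homD[OF f] \<phi>_closed B.smult_closed)
    also have "\<dots> = f (finsum P (\<lambda>i. \<phi> i x \<odot>\<^bsub>P\<^esub> b i) I)"
      using x b_closed
      by (intro additive_finsum[OF f_hom finite_I, symmetric]) (auto simp: smult_closed \<phi>_closed)
    finally show ?thesis by (simp add: expand x)
  qed
  ultimately show "\<exists>g\<in>module_hom R P A. \<forall>x\<in>carrier P. p (g x) = f x" by blast
qed

end

subsection \<open>Tensor products\<close>

lemma opposite_ring_simps [simp]:
  "carrier (opposite_ring R) = carrier R" "add (opposite_ring R) = add R"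
  "\<zero>\<^bsub>opposite_ring R\<^esub> = \<zero>\<^bsub>R\<^esub>" "\<one>\<^bsub>opposite_ring R\<^esub> = \<one>\<^bsub>R\<^esub>"
  "x \<otimes>\<^bsub>opposite_ring R\<^esub> y = y \<otimes>\<^bsub>R\<^esub> x"
  by (simp_all add: opposite_ring_def)

text \<open>
  The tensor product is handled through representatives: \<open>FA\<close> is the free abelian group on pairs and \<open>N\<close> the
  subgroup of relations, so congruence modulo \<open>N\<close> replaces equality in the quotient.
\<close>

locale tensor = A?: left_module "opposite_ring R" A + F?: left_module R F
  for R :: "'r ring" (structure) and A :: "('r, 'a) module" and F :: "('r, 'm) module"
begin

abbreviation "FA \<equiv> free_Abelian_group (carrier A \<times> carrier F)"
abbreviation "N \<equiv> tensor_subgroup R A F"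

sublocale FA: comm_group FA by (rule abelian_free_Abelian_group)

lemma relations_closed: "tensor_relations R A F \<subseteq> carrier FA"
proof -
  have "Poly_Mapping.keys (frag_of p - frag_of q - frag_of r) \<subseteq> {p, q, r}"
    "Poly_Mapping.keys (frag_of p - frag_of q) \<subseteq> {p, q}" for p q r :: "'a \<times> 'm"
    using keys_diff[of "frag_of p" "frag_of q"] keys_diff[of "frag_of p - frag_of q" "frag_of r"] by auto
  then show ?thesis
    unfolding tensor_relations_def carrier_free_Abelian_group_iff subset_iff
    by (fastforce simp: A.smult_closed F.smult_closed)
qed

lemma subgroup_N: "subgroup N FA"
  unfolding tensor_subgroup_def by (rule FA.generate_is_subgroup[OF relations_closed])

lemma N_keys: "c \<in> N \<Longrightarrow> Poly_Mapping.keys c \<subseteq> carrier A \<times> carrier F"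
  using subsetD[OF subgroup.subset[OF subgroup_N], of c] by simp

lemma N_relation: "c \<in> tensor_relations R A F \<Longrightarrow> c \<in> N"
  unfolding tensor_subgroup_def by (rule generate.incl)

lemma N_zero: "0 \<in> N" and N_add: "c \<in> N \<Longrightarrow> d \<in> N \<Longrightarrow> c + d \<in> N"
  using subgroup.one_closed[OF subgroup_N] subgroup.m_closed[OF subgroup_N] by auto

lemma N_minus: "c \<in> N \<Longrightarrow> - c \<in> N"
  using subgroup.m_inv_closed[OF subgroup_N, of c] N_keys[of c] by simp

lemma N_diff: "c \<in> N \<Longrightarrow> d \<in> N \<Longrightarrow> c - d \<in> N"
  using N_add[of c "- d"] N_minus[of d] by simp

lemma N_cosetE:
  assumes "d \<in> N #>\<^bsub>FA\<^esub> c"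
  obtains n where "n \<in> N" "d = n + c"
  using assms by (auto simp: r_coset_def)

lemma N_coset_self: "c \<in> N #>\<^bsub>FA\<^esub> c"
  using N_zero by (auto simp: r_coset_def)

lemma N_coset_eq:
  assumes "Poly_Mapping.keys c \<subseteq> carrier A \<times> carrier F" "Poly_Mapping.keys d \<subseteq> carrier A \<times> carrier F"
  shows "N #>\<^bsub>FA\<^esub> c = N #>\<^bsub>FA\<^esub> d \<longleftrightarrow> c - d \<in> N"
proof
  assume "N #>\<^bsub>FA\<^esub> c = N #>\<^bsub>FA\<^esub> d"
  with N_coset_self have "c \<in> N #>\<^bsub>FA\<^esub> d" by blast
  then obtain n where "n \<in> N" "c = n + d" by (rule N_cosetE)
  then show "c - d \<in> N" by simp
next
  assume cd: "c - d \<in> N"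
  have "n + c \<in> N #>\<^bsub>FA\<^esub> d" if "n \<in> N" for n
    using N_add[OF that cd] by (force simp: r_coset_def intro: bexI[of _ "n + (c - d)"])
  moreover have "n + d \<in> N #>\<^bsub>FA\<^esub> c" if "n \<in> N" for n
    using N_diff[OF that cd] by (force simp: r_coset_def intro: bexI[of _ "n - (c - d)"])
  ultimately show "N #>\<^bsub>FA\<^esub> c = N #>\<^bsub>FA\<^esub> d"
    by (auto simp: r_coset_def)
qed

lemma N_left: "a \<in> carrier A \<Longrightarrow> b \<in> carrier A \<Longrightarrow> x \<in> carrier F \<Longrightarrow>
    frag_of (a \<oplus>\<^bsub>A\<^esub> b, x) - frag_of (a, x) - frag_of (b, x) \<in> N"
  and N_right: "a \<in> carrier A \<Longrightarrow> x \<in> carrier F \<Longrightarrow> y \<in> carrier F \<Longrightarrow>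
    frag_of (a, x \<oplus>\<^bsub>F\<^esub> y) - frag_of (a, x) - frag_of (a, y) \<in> N"
  and N_balance: "r \<in> carrier R \<Longrightarrow> a \<in> carrier A \<Longrightarrow> x \<in> carrier F \<Longrightarrow>
    frag_of (r \<odot>\<^bsub>A\<^esub> a, x) - frag_of (a, r \<odot>\<^bsub>F\<^esub> x) \<in> N"
  by (rule N_relation, unfold tensor_relations_def, blast)+

lemma N_left_zero: "x \<in> carrier F \<Longrightarrow> frag_of (\<zero>\<^bsub>A\<^esub>, x) \<in> N"
  using N_minus[OF N_left[of "\<zero>\<^bsub>A\<^esub>" "\<zero>\<^bsub>A\<^esub>" x]] by simp

lemma N_right_zero: "a \<in> carrier A \<Longrightarrow> frag_of (a, \<zero>\<^bsub>F\<^esub>) \<in> N"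
  using N_minus[OF N_right[of a "\<zero>\<^bsub>F\<^esub>" "\<zero>\<^bsub>F\<^esub>"]] by simp

lemma N_right_finsum:
  assumes "a \<in> carrier A" "finite I" "h \<in> I \<rightarrow> carrier F"
  shows "frag_of (a, finsum F h I) - (\<Sum>i\<in>I. frag_of (a, h i)) \<in> N"
  using assms(2,3)
proof (induction I)
  case empty
  then show ?case by (simp add: N_right_zero assms(1))
next
  case (insert i I)
  then have "finsum F h I \<in> carrier F" by auto
  then have "frag_of (a, h i \<oplus>\<^bsub>F\<^esub> finsum F h I) - frag_of (a, h i) - frag_of (a, finsum F h I) \<in> N"
    using insert.prems by (intro N_right) (auto simp: assms(1))
  from N_add[OF this insert.IH] insert show ?case by (simp add: algebra_simps)
qed

lemma N_sum: "(\<And>i. i \<in> I \<Longrightarrow> h i \<in> N) \<Longrightarrow> (\<Sum>i\<in>I. h i) \<in> N"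
  by (induction I rule: infinite_finite_induct) (auto simp: N_zero N_add)

end

locale tensor_dual_basis = tensor R A F + dual_basis R F I b \<phi>
  for R :: "'r ring" (structure) and A :: "('r, 'a) module" and F :: "('r, 'm) module"
    and I :: "'i set" and b \<phi>
begin

text \<open>
  The \<open>i\<close>-th coordinate of a tensor, \<open>a \<otimes> x \<mapsto> a \<cdot> \<phi> i x\<close>, as a homomorphism from the free
  abelian group on pairs. It exists by the universal property and is determined by its values on pairs.
\<close>

definition \<Phi> :: "'i \<Rightarrow> ('a \<times> 'm \<Rightarrow>\<^sub>0 int) \<Rightarrow> 'a" where
  "\<Phi> i = (SOME \<Psi>. \<Psi> \<in> hom FA (add_monoid A) \<and>
     (\<forall>a\<in>carrier A. \<forall>x\<in>carrier F. \<Psi> (frag_of (a, x)) = \<phi> i x \<odot>\<^bsub>A\<^esub> a))"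

lemma
  assumes i: "i \<in> I"
  shows \<Phi>_hom: "\<Phi> i \<in> hom FA (add_monoid A)"
    and \<Phi>_of: "a \<in> carrier A \<Longrightarrow> x \<in> carrier F \<Longrightarrow> \<Phi> i (frag_of (a, x)) = \<phi> i x \<odot>\<^bsub>A\<^esub> a"
proof -
  have "(\<lambda>p. \<phi> i (snd p) \<odot>\<^bsub>A\<^esub> fst p) ` (carrier A \<times> carrier F) \<subseteq> carrier (add_monoid A)"
    using i by (auto simp: A.smult_closed \<phi>_closed)
  then obtain \<Psi> where "\<Psi> \<in> hom FA (add_monoid A)"
    "\<And>p. p \<in> carrier A \<times> carrier F \<Longrightarrow> \<Psi> (frag_of p) = \<phi> i (snd p) \<odot>\<^bsub>A\<^esub> fst p"
    using comm_group.free_Abelian_group_universal[OF A.M.a_comm_group] by blast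
  then have "\<exists>\<Psi>. \<Psi> \<in> hom FA (add_monoid A) \<and>
     (\<forall>a\<in>carrier A. \<forall>x\<in>carrier F. \<Psi> (frag_of (a, x)) = \<phi> i x \<odot>\<^bsub>A\<^esub> a)"
    by (intro exI[of _ \<Psi>]) simp
  from someI_ex[OF this] show "\<Phi> i \<in> hom FA (add_monoid A)"
    "a \<in> carrier A \<Longrightarrow> x \<in> carrier F \<Longrightarrow> \<Phi> i (frag_of (a, x)) = \<phi> i x \<odot>\<^bsub>A\<^esub> a"
    unfolding \<Phi>_def by blast+
qed

lemma \<Phi>_group_hom: "i \<in> I \<Longrightarrow> group_hom FA (add_monoid A) (\<Phi> i)"
  using \<Phi>_hom by (simp add: group_hom_def group_hom_axioms_def A.M.a_group)

lemma \<Phi>_closed: "i \<in> I \<Longrightarrow> Poly_Mapping.keys c \<subseteq> carrier A \<times> carrier F \<Longrightarrow> \<Phi> i c \<in> carrier A"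
  using group_hom.hom_closed[OF \<Phi>_group_hom, of i c] by simp

lemma \<Phi>_zero: "i \<in> I \<Longrightarrow> \<Phi> i 0 = \<zero>\<^bsub>A\<^esub>"
  using group_hom.hom_one[OF \<Phi>_group_hom, of i] by simp

lemma \<Phi>_diff:
  assumes "i \<in> I" "Poly_Mapping.keys c \<subseteq> carrier A \<times> carrier F" "Poly_Mapping.keys d \<subseteq> carrier A \<times> carrier F"
  shows "\<Phi> i (c - d) = \<Phi> i c \<ominus>\<^bsub>A\<^esub> \<Phi> i d"
proof -
  have "\<Phi> i (- d) = \<ominus>\<^bsub>A\<^esub> \<Phi> i d"
    using group_hom.hom_inv[OF \<Phi>_group_hom[OF assms(1)], of d] assms by (simp add: a_inv_def)
  moreover have "\<Phi> i (c + - d) = \<Phi> i c \<oplus>\<^bsub>A\<^esub> \<Phi> i (- d)"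
    using group_hom.hom_mult[OF \<Phi>_group_hom[OF assms(1)], of c "- d"] assms by simp
  ultimately show ?thesis by (simp add: a_minus_def)
qed

lemma \<Phi>_N: assumes i: "i \<in> I" and "c \<in> N" shows "\<Phi> i c = \<zero>\<^bsub>A\<^esub>"
proof -
  interpret \<Phi>: group_hom FA "add_monoid A" "\<Phi> i" by (rule \<Phi>_group_hom[OF i])
  have "c \<in> kernel FA (add_monoid A) (\<Phi> i)" if c: "c \<in> tensor_relations R A F" for c
  proof -
    have *: "\<Phi> i (frag_of p - frag_of q) = \<zero>\<^bsub>A\<^esub>"
      if "p \<in> carrier A \<times> carrier F" "q \<in> carrier A \<times> carrier F" "\<Phi> i (frag_of p) = \<Phi> i (frag_of q)" for p q
      using that i by (simp add: \<Phi>_diff \<Phi>_closed A.M.r_neg a_minus_def)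
    have **: "\<Phi> i (frag_of p - frag_of q - frag_of r) = \<zero>\<^bsub>A\<^esub>"
      if "p \<in> carrier A \<times> carrier F" "q \<in> carrier A \<times> carrier F" "r \<in> carrier A \<times> carrier F"
        "\<Phi> i (frag_of p) = \<Phi> i (frag_of q) \<oplus>\<^bsub>A\<^esub> \<Phi> i (frag_of r)" for p q r
    proof -
      have cl: "\<Phi> i (frag_of q) \<in> carrier A" "\<Phi> i (frag_of r) \<in> carrier A"
        using that i by (auto intro!: \<Phi>_closed)
      have "Poly_Mapping.keys (frag_of p - frag_of q) \<subseteq> carrier A \<times> carrier F"
        using keys_diff[of "frag_of p" "frag_of q"] that by auto
      then have "\<Phi> i (frag_of p - frag_of q - frag_of r) = \<Phi> i (frag_of p) \<ominus>\<^bsub>A\<^esub> \<Phi> i (frag_of q) \<ominus>\<^bsub>A\<^esub> \<Phi> i (frag_of r)"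
        using that i by (simp add: \<Phi>_diff)
      also have "\<dots> = \<zero>\<^bsub>A\<^esub>"
        unfolding that(4) a_minus_def using cl
        by (metis A.M.a_comm A.M.a_inv_closed A.M.r_neg A.M.r_neg1 A.M.r_neg2 A.M.a_assoc A.M.add.m_closed)
      finally show ?thesis .
    qed
    have "\<Phi> i c = \<zero>\<^bsub>A\<^esub>"
      using c unfolding tensor_relations_def
    proof (elim UnE CollectE exE conjE)
      fix a a' x assume "c = frag_of (a \<oplus>\<^bsub>A\<^esub> a', x) - frag_of (a, x) - frag_of (a', x)"
        "a \<in> carrier A" "a' \<in> carrier A" "x \<in> carrier F"
      then show ?thesis
        using i by (auto intro!: ** simp: \<Phi>_of A.smult_r_distr \<phi>_closed)
    next
      fix a x y assume "c = frag_of (a, x \<oplus>\<^bsub>F\<^esub> y) - frag_of (a, x) - frag_of (a, y)"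
        "a \<in> carrier A" "x \<in> carrier F" "y \<in> carrier F"
      then show ?thesis
        using i A.smult_l_distr by (auto intro!: ** simp: \<Phi>_of \<phi>_closed \<phi>_add)
    next
      fix r a x assume "c = frag_of (r \<odot>\<^bsub>A\<^esub> a, x) - frag_of (a, r \<odot>\<^bsub>F\<^esub> x)"
        "r \<in> carrier R" "a \<in> carrier A" "x \<in> carrier F"
      then show ?thesis
        using i A.smult_assoc[of "\<phi> i x" r a]
        by (auto intro!: * simp: \<Phi>_of \<phi>_closed \<phi>_smult A.smult_closed F.smult_closed)
    qed
    then show ?thesis using subsetD[OF relations_closed c] by (simp add: kernel_def)
  qed
  then have "N \<subseteq> kernel FA (add_monoid A) (\<Phi> i)"
    unfolding tensor_subgroup_def
    by (intro FA.generate_subgroup_incl \<Phi>.subgroup_kernel) auto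
  then show ?thesis using assms(2) by (auto simp: kernel_def)
qed

text \<open>
  On a pair, \<open>a \<otimes> x = \<Sum>i. a \<otimes> \<phi> i x \<cdot> b i = \<Sum>i. a \<cdot> \<phi> i x \<otimes> b i\<close>. So a tensor is determined by its coordinates.
\<close>

lemma expand_mod_N:
  assumes "Poly_Mapping.keys c \<subseteq> carrier A \<times> carrier F"
  shows "c - (\<Sum>i\<in>I. frag_of (\<Phi> i c, b i)) \<in> N"
  using assms
proof (induction c rule: free_Abelian_group_induct[consumes 1, case_names zero diff one])
  case zero
  show ?case by (simp add: \<Phi>_zero N_minus N_sum N_left_zero b_closed)
next
  case (diff c d)
  have "(\<Sum>i\<in>I. frag_of (\<Phi> i c, b i) - frag_of (\<Phi> i (c - d), b i) - frag_of (\<Phi> i d, b i)) \<in> N"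
  proof (rule N_sum)
    fix i assume i: "i \<in> I"
    have "\<Phi> i c = \<Phi> i (c - d) \<oplus>\<^bsub>A\<^esub> \<Phi> i d"
      using i diff by (simp add: \<Phi>_diff \<Phi>_closed a_minus_def A.M.a_assoc A.M.l_neg)
    moreover have "\<Phi> i (c - d) \<in> carrier A"
      using i diff by (simp add: \<Phi>_diff \<Phi>_closed)
    ultimately show "frag_of (\<Phi> i c, b i) - frag_of (\<Phi> i (c - d), b i) - frag_of (\<Phi> i d, b i) \<in> N"
      using N_left[of "\<Phi> i (c - d)" "\<Phi> i d" "b i"] i diff by (simp add: \<Phi>_closed b_closed)
  qed
  from N_add[OF N_diff[OF diff(3,4)] this] show ?case
    by (simp add: sum_subtractf sum.distrib algebra_simps)
next
  case (one p)
  from one obtain a x where p: "p = (a, x)" "a \<in> carrier A" "x \<in> carrier F" by auto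
  have "frag_of (a, x) - (\<Sum>i\<in>I. frag_of (a, \<phi> i x \<odot>\<^bsub>F\<^esub> b i)) \<in> N"
    using N_right_finsum[OF p(2) finite_I, of "\<lambda>i. \<phi> i x \<odot>\<^bsub>F\<^esub> b i"] p(3)
    by (simp add: expand F.smult_closed \<phi>_closed b_closed)
  moreover have "(\<Sum>i\<in>I. frag_of (\<phi> i x \<odot>\<^bsub>A\<^esub> a, b i) - frag_of (a, \<phi> i x \<odot>\<^bsub>F\<^esub> b i)) \<in> N"
    using p by (intro N_sum N_balance) (auto simp: \<phi>_closed b_closed)
  ultimately have "frag_of (a, x) - (\<Sum>i\<in>I. frag_of (\<phi> i x \<odot>\<^bsub>A\<^esub> a, b i)) \<in> N"
    using N_diff[of "frag_of (a, x) - (\<Sum>i\<in>I. frag_of (a, \<phi> i x \<odot>\<^bsub>F\<^esub> b i))"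
        "\<Sum>i\<in>I. frag_of (\<phi> i x \<odot>\<^bsub>A\<^esub> a, b i) - frag_of (a, \<phi> i x \<odot>\<^bsub>F\<^esub> b i)"]
    by (simp add: sum_subtractf)
  then show ?case using p by (simp add: \<Phi>_of)
qed

end

text \<open>
  Coordinates are natural: the \<open>i\<close>-th coordinate of the image of a tensor under \<open>h\<close> is \<open>h\<close> applied to its \<open>i\<close>-th coordinate.
  If two tensors have the same image, then by injectivity of \<open>h\<close> they have the same coordinates, and
  so they are equal.
\<close>

lemma (in dual_basis) flat: "flat_module R P"
  unfolding flat_module_def
proof (intro conjI allI impI, rule P.left_module_axioms, elim conjE)
  fix A B :: "('r, 'm \<Rightarrow> 'r) module" and h
  assume "right_module R A" "right_module R B" and h: "h \<in> module_hom (opposite_ring R) A B"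
    and inj: "inj_on h (carrier A)"
  interpret A: left_module "opposite_ring R" A by fact
  interpret B: left_module "opposite_ring R" B by fact
  interpret TA: tensor_dual_basis R A P I b \<phi> by unfold_locales
  interpret TB: tensor_dual_basis R B P I b \<phi> by unfold_locales
  define H where "H = frag_extend (\<lambda>(a, x). frag_of (h a, x :: 'm))"
  have H_simps [simp]: "H 0 = 0" "H (frag_of (a, x)) = frag_of (h a, x)"
    "H (c + d) = H c + H d" "H (c - d) = H c - H d" "H (- c) = - H c" for a x c d
    by (simp_all add: H_def frag_extend_add frag_extend_diff frag_extend_minus)
  have H_keys: "Poly_Mapping.keys (H c) \<subseteq> carrier B \<times> carrier P"
    if "Poly_Mapping.keys c \<subseteq> carrier A \<times> carrier P" for c
  proof
    fix q assume "q \<in> Poly_Mapping.keys (H c)"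
    then have "q \<in> (\<Union>p\<in>Poly_Mapping.keys c. Poly_Mapping.keys (case p of (a, x) \<Rightarrow> frag_of (h a, x)))"
      unfolding H_def by (rule subsetD[OF keys_frag_extend])
    then obtain p where p: "p \<in> Poly_Mapping.keys c" "q = (h (fst p), snd p)"
      by (auto simp: case_prod_beta)
    have "fst p \<in> carrier A" "snd p \<in> carrier P" using subsetD[OF that p(1)] by auto
    then show "q \<in> carrier B \<times> carrier P"
      unfolding p(2) by (intro SigmaI module_homD(1)[OF h])
  qed
  have H_N: "H c \<in> TB.N" if "c \<in> TA.N" for c
  proof -
    have "c \<in> tensor_relations R A P \<Longrightarrow> H c \<in> TB.N" for c
      unfolding tensor_relations_def
      by (elim UnE CollectE exE conjE)
        (simp_all add: module_homD[OF h] TB.N_left TB.N_right TB.N_balance)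
    note relation = this
    show ?thesis
      using that unfolding tensor_subgroup_def[of R A P]
    proof (induction rule: generate.induct)
      case one
      show ?case by (simp add: TB.N_zero)
    next
      case (incl c)
      then show ?case by (rule relation)
    next
      case (inv c)
      then have "Poly_Mapping.keys c \<subseteq> carrier A \<times> carrier P"
        using TA.N_keys TA.N_relation by blast
      then show ?case using TB.N_minus[OF relation[OF inv]] by simp
    next
      case (eng c d)
      then show ?case by (simp add: TB.N_add)
    qed
  qed
  have map_coset: "tensor_map R B P h (TA.N #>\<^bsub>TA.FA\<^esub> c) = TB.N #>\<^bsub>TB.FA\<^esub> H c"
    if c: "Poly_Mapping.keys c \<subseteq> carrier A \<times> carrier P" for c
  proof -
    have "TB.N #>\<^bsub>TB.FA\<^esub> H d = TB.N #>\<^bsub>TB.FA\<^esub> H c" if "d \<in> TA.N #>\<^bsub>TA.FA\<^esub> c" for d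
    proof -
      from that obtain n where n: "n \<in> TA.N" "d = n + c" by (rule TA.N_cosetE)
      have "Poly_Mapping.keys d \<subseteq> carrier A \<times> carrier P"
        using n c TA.N_keys[of n] keys_add[of n c] by blast
      then have "TB.N #>\<^bsub>TB.FA\<^esub> H d = TB.N #>\<^bsub>TB.FA\<^esub> H c \<longleftrightarrow> H d - H c \<in> TB.N"
        by (intro TB.N_coset_eq H_keys c)
      then show ?thesis using n H_N[OF n(1)] by simp
    qed
    then have "(\<lambda>d. TB.N #>\<^bsub>TB.FA\<^esub> H d) ` (TA.N #>\<^bsub>TA.FA\<^esub> c) =
        (\<lambda>d. TB.N #>\<^bsub>TB.FA\<^esub> H c) ` (TA.N #>\<^bsub>TA.FA\<^esub> c)"
      by (rule image_cong[OF refl])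
    also have "\<dots> = {TB.N #>\<^bsub>TB.FA\<^esub> H c}"
      by (rule image_constant[OF TA.N_coset_self])
    finally have "(\<lambda>d. TB.N #>\<^bsub>TB.FA\<^esub> H d) ` (TA.N #>\<^bsub>TA.FA\<^esub> c) = {TB.N #>\<^bsub>TB.FA\<^esub> H c}" .
    then show ?thesis unfolding tensor_map_def H_def by simp
  qed
  have h_hom: "abelian_group_hom A B h"
    by (intro additive_group_hom) (auto simp: A.M.abelian_group_axioms B.M.abelian_group_axioms module_homD[OF h])
  have natural: "TB.\<Phi> i (H c) = h (TA.\<Phi> i c)"
    if "i \<in> I" "Poly_Mapping.keys c \<subseteq> carrier A \<times> carrier P" for i c
    using that(2)
  proof (induction c rule: free_Abelian_group_induct[consumes 1, case_names zero diff one])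
    case zero
    show ?case using that(1) abelian_group_hom.hom_zero[OF h_hom] by (simp add: TA.\<Phi>_zero TB.\<Phi>_zero)
  next
    case (diff c d)
    then show ?case
      using that(1) abelian_group_hom.hom_add[OF h_hom] abelian_group_hom.hom_a_inv[OF h_hom]
      by (simp add: TA.\<Phi>_diff TB.\<Phi>_diff H_keys TA.\<Phi>_closed a_minus_def)
  next
    case (one p)
    then show ?case
      using that(1) by (auto simp: TA.\<Phi>_of TB.\<Phi>_of module_homD[OF h] \<phi>_closed)
  qed
  show "inj_on (tensor_map R B P h) (carrier (tensor_product R A P))"
  proof (rule inj_onI)
    fix C D assume CD: "C \<in> carrier (tensor_product R A P)" "D \<in> carrier (tensor_product R A P)"
      and eq: "tensor_map R B P h C = tensor_map R B P h D"
    obtain c d where c: "Poly_Mapping.keys c \<subseteq> carrier A \<times> carrier P" "C = TA.N #>\<^bsub>TA.FA\<^esub> c"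
      and d: "Poly_Mapping.keys d \<subseteq> carrier A \<times> carrier P" "D = TA.N #>\<^bsub>TA.FA\<^esub> d"
      using CD by (auto simp: tensor_product_def FactGroup_def RCOSETS_def)
    have "H c - H d \<in> TB.N"
      using eq unfolding c(2) d(2) map_coset[OF c(1)] map_coset[OF d(1)]
      by (simp only: TB.N_coset_eq[OF H_keys[OF c(1)] H_keys[OF d(1)]])
    then have "TB.\<Phi> i (H c) \<ominus>\<^bsub>B\<^esub> TB.\<Phi> i (H d) = \<zero>\<^bsub>B\<^esub>" if "i \<in> I" for i
      using TB.\<Phi>_N[OF that] TB.\<Phi>_diff[OF that H_keys[OF c(1)] H_keys[OF d(1)]] by simp
    then have "TB.\<Phi> i (H c) = TB.\<Phi> i (H d)" if "i \<in> I" for i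
      using that TB.\<Phi>_closed[OF that H_keys[OF c(1)]] TB.\<Phi>_closed[OF that H_keys[OF d(1)]]
        B.M.minus_equality[of "TB.\<Phi> i (H c)" "\<ominus>\<^bsub>B\<^esub> TB.\<Phi> i (H d)"]
      by (simp add: a_minus_def)
    then have "TA.\<Phi> i c = TA.\<Phi> i d" if "i \<in> I" for i
      using that c d inj TA.\<Phi>_closed natural by (metis inj_onD)
    then have "(\<Sum>i\<in>I. frag_of (TA.\<Phi> i c, b i)) = (\<Sum>i\<in>I. frag_of (TA.\<Phi> i d, b i))"
      by simp
    then have "c - d \<in> TA.N"
      using TA.N_diff[OF TA.expand_mod_N[OF c(1)] TA.expand_mod_N[OF d(1)]] by simp
    then show "C = D" using TA.N_coset_eq[OF c(1) d(1)] c(2) d(2) by blast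
  qed
qed

section \<open>Transport of modules and resolutions\<close>

definition transport_module :: "('m \<Rightarrow> 'n) \<Rightarrow> ('r, 'm) module \<Rightarrow> ('r, 'n) module" where
  "transport_module j P =
     \<lparr>carrier = j ` carrier P, monoid.mult = undefined, one = undefined,
      ring.zero = j \<zero>\<^bsub>P\<^esub>,
      add = (\<lambda>u v. j (inv_into (carrier P) j u \<oplus>\<^bsub>P\<^esub> inv_into (carrier P) j v)),
      smult = (\<lambda>r u. j (r \<odot>\<^bsub>P\<^esub> inv_into (carrier P) j u))\<rparr>"

locale module_transport = P?: left_module R P for R :: "'r ring" (structure) and P :: "('r, 'm) module" +
  fixes j :: "'m \<Rightarrow> 'n"
  assumes inj: "inj_on j (carrier P)"
begin

abbreviation "Q \<equiv> transport_module j P"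
abbreviation "i \<equiv> inv_into (carrier P) j"

lemma carrier_Q: "carrier Q = j ` carrier P" and zero_Q: "\<zero>\<^bsub>Q\<^esub> = j \<zero>\<^bsub>P\<^esub>"
  by (simp_all add: transport_module_def)

lemma i_j [simp]: "x \<in> carrier P \<Longrightarrow> i (j x) = x"
  using inj by simp

lemma add_Q [simp]: "x \<in> carrier P \<Longrightarrow> y \<in> carrier P \<Longrightarrow> j x \<oplus>\<^bsub>Q\<^esub> j y = j (x \<oplus>\<^bsub>P\<^esub> y)"
  and smult_Q [simp]: "x \<in> carrier P \<Longrightarrow> r \<odot>\<^bsub>Q\<^esub> j x = j (r \<odot>\<^bsub>P\<^esub> x)"
  by (simp_all add: transport_module_def inj)

lemma abelian_group_Q: "abelian_group Q"
proof (rule abelian_groupI)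
  show "\<exists>v\<in>carrier Q. v \<oplus>\<^bsub>Q\<^esub> u = \<zero>\<^bsub>Q\<^esub>" if "u \<in> carrier Q" for u
  proof -
    obtain x where "x \<in> carrier P" "u = j x" using \<open>u \<in> carrier Q\<close> by (auto simp: carrier_Q)
    then show ?thesis
      by (intro bexI[of _ "j (\<ominus>\<^bsub>P\<^esub> x)"]) (auto simp: carrier_Q zero_Q M.l_neg)
  qed
qed (auto simp: carrier_Q zero_Q M.a_ac)

lemma left_module_Q: "left_module R Q"
proof -
  interpret Q: abelian_group Q by (rule abelian_group_Q)
  show ?thesis
    by unfold_locales
      (auto simp: carrier_Q smult_closed smult_l_distr smult_r_distr smult_assoc smult_one)
qed

lemma j_hom: "abelian_group_hom P Q j"
  by (rule additive_group_hom) (auto simp: M.abelian_group_axioms abelian_group_Q carrier_Q)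

lemma finite_dual_basis_Q:
  assumes "finite_dual_basis R P I b \<phi>"
  shows "finite_dual_basis R Q I (\<lambda>k. j (b k)) (\<lambda>k u. \<phi> k (i u))"
proof -
  interpret dual_basis R P I b \<phi> by unfold_locales (rule assms)
  show ?thesis
    unfolding finite_dual_basis_def
  proof (intro conjI ballI funcsetI)
    fix u assume "u \<in> carrier Q"
    then obtain x where x: "x \<in> carrier P" "u = j x" by (auto simp: carrier_Q)
    have "j (finsum P (\<lambda>k. \<phi> k x \<odot>\<^bsub>P\<^esub> b k) I) = finsum Q (\<lambda>k. j (\<phi> k x \<odot>\<^bsub>P\<^esub> b k)) I"
      by (rule additive_finsum[OF j_hom finite_I]) (auto simp: smult_closed \<phi>_closed b_closed x)
    also have "\<dots> = finsum Q (\<lambda>k. \<phi> k (i u) \<odot>\<^bsub>Q\<^esub> j (b k)) I"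
      by (rule abelian_monoid.finsum_cong'[OF abelian_group.axioms(1)[OF abelian_group_Q]])
        (auto simp: carrier_Q x b_closed \<phi>_closed smult_closed)
    finally show "u = finsum Q (\<lambda>k. \<phi> k (i u) \<odot>\<^bsub>Q\<^esub> j (b k)) I"
      by (simp only: expand[OF x(1)] x(2))
  qed (auto simp: carrier_Q finite_I b_closed smult_closed \<phi>_closed \<phi>_add \<phi>_smult)
qed

end

lemma transport_module_hom:
  assumes "module_transport R P j" "module_transport R P' j'" and f: "f \<in> module_hom R P P'"
  shows "(\<lambda>u. j' (f (inv_into (carrier P) j u))) \<in>
    module_hom R (transport_module j P) (transport_module j' P')"
proof -
  interpret P: module_transport R P j by fact
  interpret P': module_transport R P' j' by fact
  show ?thesis
    unfolding module_hom_def
    by (auto simp: P.carrier_Q P'.carrier_Q module_homD[OF f] P.smult_closed P.i_j)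
qed

lemma a_kernel_eq: "a_kernel P M f = {x \<in> carrier P. f x = \<zero>\<^bsub>M\<^esub>}"
  by (auto simp: a_kernel_def')

lemma transport_kernel:
  assumes "module_transport R P j" "module_transport R P' j'" and f: "f \<in> module_hom R P P'"
  shows "a_kernel (transport_module j P) (transport_module j' P') (\<lambda>u. j' (f (inv_into (carrier P) j u))) =
    j ` a_kernel P P' f"
proof -
  interpret P: module_transport R P j by fact
  interpret P': module_transport R P' j' by fact
  have "j' (f x) = j' \<zero>\<^bsub>P'\<^esub> \<longleftrightarrow> f x = \<zero>\<^bsub>P'\<^esub>" if "x \<in> carrier P" for x
    using that module_homD(1)[OF f] P'.inj P'.M.zero_closed by (metis inj_onD)
  then show ?thesis
    by (auto simp: a_kernel_eq P.carrier_Q P'.zero_Q)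
qed

lemma transport_image:
  assumes "module_transport R P j"
  shows "(\<lambda>u. j' (f (inv_into (carrier P) j u))) ` carrier (transport_module j P) = j' ` f ` carrier P"
proof -
  interpret module_transport R P j by fact
  show ?thesis by (auto simp: carrier_Q image_image)
qed

text \<open>
  The coordinates with respect to a dual basis, listed along an enumeration \<open>ks\<close> of its index set, determine the element. The
  constant \<open>z\<close> fills the first components of the pairs.
\<close>

lemma dual_basis_lists_inj:
  fixes P :: "('r, 'q) module" and z :: 'm
  assumes "dual_basis R P I b \<phi>" and "set ks = I"
  shows "inj_on (\<lambda>x. map (\<lambda>k. (z, \<phi> k x)) ks) (carrier P)"
proof (rule inj_onI)
  interpret dual_basis R P I b \<phi> by fact
  fix x y assume x: "x \<in> carrier P" and y: "y \<in> carrier P"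
    and "map (\<lambda>k. (z, \<phi> k x)) ks = map (\<lambda>k. (z, \<phi> k y)) ks"
  then have "\<phi> k x = \<phi> k y" if "k \<in> I" for k
    using that assms(2) by simp
  then have "finsum P (\<lambda>k. \<phi> k x \<odot>\<^bsub>P\<^esub> b k) I = finsum P (\<lambda>k. \<phi> k y \<odot>\<^bsub>P\<^esub> b k) I"
    using y by (intro M.finsum_cong') (auto simp: smult_closed \<phi>_closed b_closed)
  then show "x = y" by (simp add: expand x y)
qed

text \<open>
  The definitions of the dimensions prescribe the type of lists of pairs for the modules of a
  resolution. A resolution over another type is copied into it by means of coordinates.
\<close>

lemma dimension_le_of_resolution:
  fixes R :: "'r ring" and M :: "('r, 'm) module" and P :: "nat \<Rightarrow> ('r, 'q) module"
  assumes res: "is_resolution R P d \<epsilon> M"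
    and basis: "\<And>i. finite_dual_basis R (P i) (I i) (b i) (\<phi> i)"
    and vanish: "\<And>i. n < i \<Longrightarrow> carrier (P i) = {\<zero>\<^bsub>P i\<^esub>}"
  shows "projective_dimension R M \<le> enat n" "flat_dimension R M \<le> enat n"
proof -
  have P: "left_module R (P i)" for i
    using res by (simp add: is_resolution_def)
  have DB: "dual_basis R (P i) (I i) (b i) (\<phi> i)" for i
    using P basis by (simp add: dual_basis_def dual_basis_axioms_def)
  define ks where "ks i = (SOME xs. set xs = I i)" for i
  have ks: "set (ks i) = I i" for i
  proof -
    have "finite (I i)" using basis[of i] by (simp add: finite_dual_basis_def)
    then show ?thesis unfolding ks_def by (rule someI_ex[OF finite_list])
  qed
  define j :: "nat \<Rightarrow> 'q \<Rightarrow> ('m \<times> 'r) list"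
    where "j i = (\<lambda>x. map (\<lambda>k. (\<zero>\<^bsub>M\<^esub>, \<phi> i k x)) (ks i))" for i
  have T: "module_transport R (P i) (j i)" for i
    using P dual_basis_lists_inj[OF DB ks] by (simp add: module_transport_def module_transport_axioms_def j_def)
  define P' where "P' i = transport_module (j i) (P i)" for i
  define d' where "d' i u = j i (d i (inv_into (carrier (P (Suc i))) (j (Suc i)) u))" for i u
  define \<epsilon>' where "\<epsilon>' u = \<epsilon> (inv_into (carrier (P 0)) (j 0) u)" for u
  have P': "left_module R (P' i)" for i
    unfolding P'_def by (rule module_transport.left_module_Q[OF T])
  have "finite_dual_basis R (P' i) (I i) (\<lambda>k. j i (b i k)) (\<lambda>k u. \<phi> i k (inv_into (carrier (P i)) (j i) u))" for i
    unfolding P'_def by (rule module_transport.finite_dual_basis_Q[OF T basis])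
  then have DB': "dual_basis R (P' i) (I i) (\<lambda>k. j i (b i k)) (\<lambda>k u. \<phi> i k (inv_into (carrier (P i)) (j i) u))" for i
    using P' by (simp add: dual_basis_def dual_basis_axioms_def)
  have d: "d i \<in> module_hom R (P (Suc i)) (P i)" for i
    using res by (simp add: is_resolution_def)
  have \<epsilon>: "\<epsilon> \<in> module_hom R (P 0) M" using res by (simp add: is_resolution_def)
  have d': "d' i = (\<lambda>u. j i (d i (inv_into (carrier (P (Suc i))) (j (Suc i)) u)))" for i
    by (simp add: d'_def fun_eq_iff)
  interpret T0: module_transport R "P 0" "j 0" by (rule T)
  have "is_resolution R P' d' \<epsilon>' M"
    unfolding is_resolution_def
  proof (intro conjI allI)
    show "left_module R M" using res by (simp add: is_resolution_def)
    show "left_module R (P' i)" for i by (rule P')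
    show "d' i \<in> module_hom R (P' (Suc i)) (P' i)" for i
      unfolding d' P'_def by (rule transport_module_hom[OF T T d])
    show "d' (Suc i) ` carrier (P' (Suc (Suc i))) = a_kernel (P' (Suc i)) (P' i) (d' i)" for i
      using res unfolding d' P'_def transport_image[OF T] transport_kernel[OF T T d]
      by (simp add: is_resolution_def)
    have "a_kernel (P' 0) M \<epsilon>' = j 0 ` a_kernel (P 0) M \<epsilon>"
      by (auto simp: a_kernel_eq P'_def T0.carrier_Q \<epsilon>'_def)
    moreover have "d' 0 ` carrier (P' 1) = j 0 ` d 0 ` carrier (P 1)"
      using transport_image[OF T, of "j 0" "d 0" 1] unfolding d' P'_def by simp
    ultimately show "d' 0 ` carrier (P' 1) = a_kernel (P' 0) M \<epsilon>'"
      using res by (simp add: is_resolution_def)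
    show "\<epsilon>' \<in> module_hom R (P' 0) M"
      by (auto simp: module_hom_def \<epsilon>'_def P'_def T0.carrier_Q module_homD[OF \<epsilon>] T0.smult_closed)
    have "\<epsilon>' ` carrier (P' 0) = \<epsilon> ` carrier (P 0)"
      by (auto simp: \<epsilon>'_def P'_def T0.carrier_Q image_image)
    then show "\<epsilon>' ` carrier (P' 0) = carrier M"
      using res by (simp add: is_resolution_def)
  qed
  moreover have "carrier (P' i) = {\<zero>\<^bsub>P' i\<^esub>}" if "n < i" for i
    using vanish[OF that] module_transport.carrier_Q[OF T] module_transport.zero_Q[OF T]
    by (simp add: P'_def)
  moreover have "projective_module R (P' i)" "flat_module R (P' i)" for i
    using dual_basis.projective[OF DB'] dual_basis.flat[OF DB'] by auto
  ultimately show "projective_dimension R M \<le> enat n" "flat_dimension R M \<le> enat n"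
    unfolding projective_dimension_def flat_dimension_def
    by (intro Inf_lower imageI CollectI exI[of _ P'] exI[of _ d'] exI[of _ \<epsilon>'] conjI; blast)+
qed

section \<open>Permutation modules over a group ring\<close>

text \<open>
  The biadditive extension of \<open>act\<close>. It is both the multiplication of the group ring and the scalar
  multiplication of a permutation module, so that one associativity lemma serves both.
\<close>

definition frag_action :: "('g \<Rightarrow> 'y \<Rightarrow> 'z) \<Rightarrow> ('g \<Rightarrow>\<^sub>0 int) \<Rightarrow> ('y \<Rightarrow>\<^sub>0 int) \<Rightarrow> ('z \<Rightarrow>\<^sub>0 int)" where
  "frag_action act r c = frag_extend (\<lambda>g. frag_map (act g) c) r"

lemma frag_action_simps [simp]:
  "frag_action act 0 c = 0" "frag_action act r 0 = 0"
  "frag_action act (frag_of g) c = frag_map (act g) c"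
  "frag_action act (r + s) c = frag_action act r c + frag_action act s c"
  "frag_action act (r - s) c = frag_action act r c - frag_action act s c"
  "frag_action act r (c + c') = frag_action act r c + frag_action act r c'"
  "frag_action act r (c - c') = frag_action act r c - frag_action act r c'"
  by (simp_all add: frag_action_def frag_extend_add frag_extend_diff frag_extend_add_map
      frag_extend_diff_map)

lemma keys_frag_action:
  assumes "Poly_Mapping.keys r \<subseteq> A" "Poly_Mapping.keys c \<subseteq> B" "\<And>g y. g \<in> A \<Longrightarrow> y \<in> B \<Longrightarrow> act g y \<in> C"
  shows "Poly_Mapping.keys (frag_action act r c) \<subseteq> C"
proof
  fix q assume "q \<in> Poly_Mapping.keys (frag_action act r c)"
  then obtain g where "g \<in> Poly_Mapping.keys r" "q \<in> Poly_Mapping.keys (frag_map (act g) c)"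
    unfolding frag_action_def using subsetD[OF keys_frag_extend] by fast
  then show "q \<in> C"
    using assms subsetD[OF keys_frag_map] by fast
qed

lemma frag_action_assoc:
  assumes "Poly_Mapping.keys r \<subseteq> A" "Poly_Mapping.keys s \<subseteq> B" "Poly_Mapping.keys c \<subseteq> C"
    and act: "\<And>g h y. g \<in> A \<Longrightarrow> h \<in> B \<Longrightarrow> y \<in> C \<Longrightarrow> act1 (m g h) y = act2 g (act3 h y)"
  shows "frag_action act1 (frag_action m r s) c = frag_action act2 r (frag_action act3 s c)"
  using assms(1)
proof (induction r rule: frag_induction)
  case (one g)
  from assms(2) show ?case
  proof (induction s rule: frag_induction)
    case (one h)
    from assms(3) show ?case
      by (induction c rule: frag_induction) (use act \<open>g \<in> A\<close> \<open>h \<in> B\<close> in auto)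
  qed auto
qed auto

lemma group_ring_simps [simp]:
  "carrier (group_ring G) = {r. Poly_Mapping.keys r \<subseteq> carrier G}"
  "r \<otimes>\<^bsub>group_ring G\<^esub> s = frag_action (\<lambda>g h. g \<otimes>\<^bsub>G\<^esub> h) r s"
  "\<one>\<^bsub>group_ring G\<^esub> = frag_of \<one>\<^bsub>G\<^esub>" "\<zero>\<^bsub>group_ring G\<^esub> = 0" "r \<oplus>\<^bsub>group_ring G\<^esub> s = r + s"
  by (simp_all add: group_ring_def frag_action_def frag_map_def)

definition permutation_module ::
  "('g \<Rightarrow> 'y \<Rightarrow> 'y) \<Rightarrow> 'y set \<Rightarrow> ('g \<Rightarrow>\<^sub>0 int, 'y \<Rightarrow>\<^sub>0 int) module" where
  "permutation_module act Y =
     \<lparr>carrier = {c. Poly_Mapping.keys c \<subseteq> Y}, monoid.mult = undefined, one = undefined,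
      ring.zero = 0, add = (+), smult = frag_action act\<rparr>"

lemma permutation_module_simps [simp]:
  "carrier (permutation_module act Y) = {c. Poly_Mapping.keys c \<subseteq> Y}"
  "\<zero>\<^bsub>permutation_module act Y\<^esub> = 0" "c \<oplus>\<^bsub>permutation_module act Y\<^esub> c' = c + c'"
  "r \<odot>\<^bsub>permutation_module act Y\<^esub> c = frag_action act r c"
  by (simp_all add: permutation_module_def)

lemma frag_abelian_group:
  fixes M :: "('y \<Rightarrow>\<^sub>0 int, 'b) ring_scheme"
  assumes "carrier M = {c. Poly_Mapping.keys c \<subseteq> Y}" "\<And>c c'. c \<oplus>\<^bsub>M\<^esub> c' = c + c'" "\<zero>\<^bsub>M\<^esub> = 0"
  shows "abelian_group M"
proof (rule abelian_groupI)
  show "\<exists>y\<in>carrier M. y \<oplus>\<^bsub>M\<^esub> x = \<zero>\<^bsub>M\<^esub>" if "x \<in> carrier M" for x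
    using that by (intro bexI[of _ "- x"]) (auto simp: assms)
qed (use keys_add in \<open>fastforce simp: assms add_ac\<close>)+

lemma (in group) frag_map_one [simp]:
  "Poly_Mapping.keys c \<subseteq> carrier G \<Longrightarrow> frag_map ((\<otimes>) \<one>) c = c"
  by (induction c rule: frag_induction) auto

lemma (in group) ring_group_ring: "ring (group_ring G)"
proof (rule ringI)
  show "abelian_group (group_ring G)"
    by (rule frag_abelian_group) auto
  show "monoid (group_ring G)"
  proof
    show "r \<otimes>\<^bsub>group_ring G\<^esub> s \<otimes>\<^bsub>group_ring G\<^esub> t = r \<otimes>\<^bsub>group_ring G\<^esub> (s \<otimes>\<^bsub>group_ring G\<^esub> t)"
      if "r \<in> carrier (group_ring G)" "s \<in> carrier (group_ring G)" "t \<in> carrier (group_ring G)" for r s t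
      using that by (auto simp: m_assoc intro!: frag_action_assoc[of r "carrier G" s "carrier G" t "carrier G"])
    show "r \<otimes>\<^bsub>group_ring G\<^esub> \<one>\<^bsub>group_ring G\<^esub> = r" if "r \<in> carrier (group_ring G)" for r
    proof -
      from that have "Poly_Mapping.keys r \<subseteq> carrier G" by simp
      then show ?thesis by (induction r rule: frag_induction) auto
    qed
    show "r \<otimes>\<^bsub>group_ring G\<^esub> s \<in> carrier (group_ring G)"
      if "r \<in> carrier (group_ring G)" "s \<in> carrier (group_ring G)" for r s
      using that keys_frag_action[of r "carrier G" s "carrier G" "\<lambda>g h. g \<otimes> h" "carrier G"] by simp
  qed auto
qed auto

lemma (in group) left_module_permutation_module:
  assumes "\<And>g y. g \<in> carrier G \<Longrightarrow> y \<in> Y \<Longrightarrow> act g y \<in> Y"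
    and "\<And>g h y. g \<in> carrier G \<Longrightarrow> h \<in> carrier G \<Longrightarrow> y \<in> Y \<Longrightarrow> act (g \<otimes> h) y = act g (act h y)"
    and "\<And>y. y \<in> Y \<Longrightarrow> act \<one> y = y"
  shows "left_module (group_ring G) (permutation_module act Y)"
proof -
  interpret R: ring "group_ring G" by (rule ring_group_ring)
  interpret M: abelian_group "permutation_module act Y" by (rule frag_abelian_group) auto
  show ?thesis
  proof
    show "r \<odot>\<^bsub>permutation_module act Y\<^esub> c \<in> carrier (permutation_module act Y)"
      if "r \<in> carrier (group_ring G)" "c \<in> carrier (permutation_module act Y)" for r c
      using that assms(1) keys_frag_action[of r "carrier G" c Y act Y] by simp
    show "(r \<otimes>\<^bsub>group_ring G\<^esub> s) \<odot>\<^bsub>permutation_module act Y\<^esub> c =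
        r \<odot>\<^bsub>permutation_module act Y\<^esub> (s \<odot>\<^bsub>permutation_module act Y\<^esub> c)"
      if "r \<in> carrier (group_ring G)" "s \<in> carrier (group_ring G)"
        "c \<in> carrier (permutation_module act Y)" for r s c
      using that assms(2) by (auto intro!: frag_action_assoc[of r "carrier G" s "carrier G" c Y])
    show "\<one>\<^bsub>group_ring G\<^esub> \<odot>\<^bsub>permutation_module act Y\<^esub> c = c"
      if "c \<in> carrier (permutation_module act Y)" for c
    proof -
      from that have "Poly_Mapping.keys c \<subseteq> Y" by simp
      then show ?thesis by (induction c rule: frag_induction) (auto simp: assms(3))
    qed
  qed auto
qed

lemma sum_lookup_eq: "(\<Sum>g\<in>Poly_Mapping.keys r. Poly_Mapping.lookup r g) =
    Poly_Mapping.lookup (frag_map (\<lambda>_. ()) r) ()"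
proof -
  have "Poly_Mapping.lookup (\<Sum>g\<in>K. frag_cmul (f g) (frag_of ())) () = sum f K" for K :: "'a set" and f
    by (induction K rule: infinite_finite_induct) (auto simp: lookup_add)
  then show ?thesis by (simp add: frag_map_def frag_extend_def)
qed

text \<open>
  The scalar by which a group ring element acts on the trivial module. On chains of vertices it is
  the boundary into degree \<open>-1\<close>.
\<close>

definition augmentation :: "('y \<Rightarrow>\<^sub>0 int) \<Rightarrow> int" where
  "augmentation c = (\<Sum>y\<in>Poly_Mapping.keys c. Poly_Mapping.lookup c y)"

lemma augmentation_simps [simp]:
  "augmentation 0 = 0" "augmentation (frag_of y) = 1"
  "augmentation (c + c') = augmentation c + augmentation c'"
  "augmentation (c - c') = augmentation c - augmentation c'"
  "augmentation (frag_cmul k c) = k * augmentation c"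
  by (simp_all only: augmentation_def sum_lookup_eq frag_map_simps)
    (simp_all add: lookup_add lookup_minus)

lemma augmentation_map [simp]: "augmentation (frag_map f c) = augmentation c"
  by (induction c rule: frag_induct) auto

lemma augmentation_action [simp]: "augmentation (frag_action act r c) = augmentation r * augmentation c"
  by (induction r rule: frag_induct) (auto simp: algebra_simps)

lemma trivial_module_simps [simp]:
  "carrier trivial_module = UNIV" "\<zero>\<^bsub>trivial_module\<^esub> = 0" "m \<oplus>\<^bsub>trivial_module\<^esub> n = m + n"
  "r \<odot>\<^bsub>trivial_module\<^esub> n = augmentation r * n"
  by (simp_all add: trivial_module_def augmentation_def)

lemma (in group) left_module_trivial_module: "left_module (group_ring G) trivial_module"
proof -
  interpret R: ring "group_ring G" by (rule ring_group_ring)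
  interpret M: abelian_group "trivial_module :: ('a \<Rightarrow>\<^sub>0 int, int) module"
    by (rule abelian_groupI) (auto intro: exI[of _ "- _"])
  show ?thesis by unfold_locales (auto simp: algebra_simps)
qed

text \<open>
  Every \<open>y\<close> is \<open>act (mv y) (base y)\<close> for an orbit representative \<open>base y\<close> in \<open>B\<close>, and the action is free because \<open>mv\<close> is
  equivariant. So \<open>B\<close> is a basis, and the coordinate of \<open>y\<close> at \<open>base y\<close> is \<open>mv y\<close>.
\<close>

lemma (in group) finite_dual_basis_free_action:
  fixes act :: "'a \<Rightarrow> 'y \<Rightarrow> 'y"
  assumes M: "left_module (group_ring G) (permutation_module act Y)"
    and "finite B" "B \<subseteq> Y"
    and closed: "\<And>g y. g \<in> carrier G \<Longrightarrow> y \<in> Y \<Longrightarrow> act g y \<in> Y"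
    and base: "\<And>y. y \<in> Y \<Longrightarrow> base y \<in> B" "\<And>g y. g \<in> carrier G \<Longrightarrow> y \<in> Y \<Longrightarrow> base (act g y) = base y"
    and mv: "\<And>y. y \<in> Y \<Longrightarrow> mv y \<in> carrier G"
      "\<And>g y. g \<in> carrier G \<Longrightarrow> y \<in> Y \<Longrightarrow> mv (act g y) = g \<otimes> mv y"
    and decomp: "\<And>y. y \<in> Y \<Longrightarrow> act (mv y) (base y) = y"
  shows "finite_dual_basis (group_ring G) (permutation_module act Y) B frag_of
    (\<lambda>b. frag_extend (\<lambda>y. if base y = b then frag_of (mv y) else 0))"
proof -
  interpret left_module "group_ring G" "permutation_module act Y" by (rule M)
  let ?\<phi> = "\<lambda>b. frag_extend (\<lambda>y. if base y = b then frag_of (mv y) else 0)"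
  have smult: "?\<phi> b (frag_action act r c) = frag_action (\<otimes>) r (?\<phi> b c)"
    if r: "Poly_Mapping.keys r \<subseteq> carrier G" and c: "Poly_Mapping.keys c \<subseteq> Y" for b r c
    using r
  proof (induction r rule: frag_induction)
    case (one g)
    from c show ?case
      by (induction c rule: frag_induction) (use one in \<open>auto simp: frag_extend_diff base mv\<close>)
  qed (auto simp: frag_extend_diff)
  have finsum_eq: "finsum (permutation_module act Y) f K = sum f K"
    if "finite K" "\<And>k. k \<in> K \<Longrightarrow> Poly_Mapping.keys (f k) \<subseteq> Y" for f and K :: "'y set"
    using that
  proof (induction K)
    case (insert k K)
    have "f \<in> K \<rightarrow> carrier (permutation_module act Y)" "f k \<in> carrier (permutation_module act Y)"
      using insert.prems by auto
    then show ?case using insert by simp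
  qed simp
  have \<phi>_keys: "Poly_Mapping.keys (?\<phi> b c) \<subseteq> carrier G" if "Poly_Mapping.keys c \<subseteq> Y" for b c
  proof
    fix g assume "g \<in> Poly_Mapping.keys (?\<phi> b c)"
    then obtain y where "y \<in> Poly_Mapping.keys c" "g \<in> Poly_Mapping.keys (if base y = b then frag_of (mv y) else 0)"
      using subsetD[OF keys_frag_extend] by fast
    then show "g \<in> carrier G" using that mv(1) by (auto split: if_splits)
  qed
  have expand: "(\<Sum>b\<in>B. frag_action act (?\<phi> b c) (frag_of b)) = c" if "Poly_Mapping.keys c \<subseteq> Y" for c
    using that
  proof (induction c rule: frag_induction)
    case (one y)
    have "(\<Sum>b\<in>B. frag_action act (?\<phi> b (frag_of y)) (frag_of b)) =
        (\<Sum>b\<in>B. if base y = b then frag_of y else 0)"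
      by (rule sum.cong) (auto simp: decomp one)
    also have "\<dots> = frag_of y" using \<open>finite B\<close> base(1)[OF one] by simp
    finally show ?case .
  qed (auto simp: frag_extend_diff sum_subtractf)
  have term_keys: "Poly_Mapping.keys (frag_action act (?\<phi> b c) (frag_of b)) \<subseteq> Y"
    if "Poly_Mapping.keys c \<subseteq> Y" "b \<in> B" for b c
    using that \<open>B \<subseteq> Y\<close> by (intro keys_frag_action[OF \<phi>_keys, where B = "{b}"]) (auto intro: closed)
  show ?thesis
    unfolding finite_dual_basis_def
  proof (intro conjI ballI)
    show "c = finsum (permutation_module act Y) (\<lambda>b. ?\<phi> b c \<odot>\<^bsub>permutation_module act Y\<^esub> frag_of b) B"
      if "c \<in> carrier (permutation_module act Y)" for c
    proof -
      have c: "Poly_Mapping.keys c \<subseteq> Y" using that by simp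
      show ?thesis
        using finsum_eq[OF \<open>finite B\<close>, of "\<lambda>b. frag_action act (?\<phi> b c) (frag_of b)"]
          term_keys[OF c] expand[OF c] by simp
    qed
  qed (use \<open>B \<subseteq> Y\<close> \<open>finite B\<close> \<phi>_keys smult in \<open>auto simp: frag_extend_add\<close>)
qed

section \<open>Groups acting simply transitively on a lattice\<close>

text \<open>
  \<open>pos\<close> identifies the group with the lattice \<open>\<int>\<^sup>X\<close> in such a way that left multiplication by \<open>k\<close> becomes a permutation of
  the coordinates followed by the translation by \<open>pos k\<close>. Elements of the group and points of the lattice are
  not distinguished below.
\<close>

locale lattice_group = group G for G (structure) +
  fixes X :: "'x set" and pos :: "'a \<Rightarrow> 'x \<Rightarrow> int"
  assumes finite_X: "finite X"
    and pos_bij: "bij_betw pos (carrier G) {v. \<forall>y. y \<notin> X \<longrightarrow> v y = 0}"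
    and pos_mult: "k \<in> carrier G \<Longrightarrow>
      \<exists>\<sigma>. bij \<sigma> \<and> (\<forall>g\<in>carrier G. \<forall>y. pos (k \<otimes> g) y = pos k y + pos g (\<sigma> y))"
begin

text \<open>
  The cliques of this relation are the simplices of the standard triangulation of \<open>\<real>\<^sup>X\<close>: chains of lattice points within a unit cube.
\<close>

definition edge :: "'a \<Rightarrow> 'a \<Rightarrow> bool" where
  "edge g h \<longleftrightarrow> pos g \<noteq> pos h \<and> (\<forall>y. pos g y \<le> pos h y \<and> pos h y \<le> pos g y + 1)"

text \<open>
  A translation and a permutation of the coordinates leave the pointwise order and the constant
  bound \<open>1\<close> unchanged.
\<close>

lemma edge_mult:
  assumes "k \<in> carrier G" "g \<in> carrier G" "h \<in> carrier G"
  shows "edge (k \<otimes> g) (k \<otimes> h) \<longleftrightarrow> edge g h"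
proof -
  obtain \<sigma> where \<sigma>: "bij \<sigma>" "\<And>g y. g \<in> carrier G \<Longrightarrow> pos (k \<otimes> g) y = pos k y + pos g (\<sigma> y)"
    using pos_mult[OF assms(1)] by blast
  have all: "(\<forall>y. Q (\<sigma> y)) \<longleftrightarrow> (\<forall>y. Q y)" for Q
    using bij_is_surj[OF \<sigma>(1)] by (metis surjD)
  show ?thesis
    using all[of "\<lambda>y. pos g y = pos h y"] all[of "\<lambda>y. pos g y \<le> pos h y \<and> pos h y \<le> pos g y + 1"]
    by (simp add: edge_def fun_eq_iff \<sigma>(2) assms algebra_simps)
qed

lemma pos_supp: "g \<in> carrier G \<Longrightarrow> y \<notin> X \<Longrightarrow> pos g y = 0"
  using pos_bij by (auto simp: bij_betw_def)

lemma pos_inj: "inj_on pos (carrier G)"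
  using pos_bij by (auto simp: bij_betw_def)

lemma pos_surj:
  assumes "\<And>y. y \<notin> X \<Longrightarrow> v y = 0"
  obtains g where "g \<in> carrier G" "pos g = v"
proof -
  have "v \<in> pos ` carrier G" using assms pos_bij by (auto simp: bij_betw_def)
  then show ?thesis using that by auto
qed

lemma finite_box: "finite {g \<in> carrier G. \<forall>y. l y \<le> pos g y \<and> pos g y \<le> u y}"
proof -
  let ?F = "{g \<in> carrier G. \<forall>y. l y \<le> pos g y \<and> pos g y \<le> u y}"
  have "(\<lambda>g. restrict (pos g) X) ` ?F \<subseteq> (\<Pi>\<^sub>E y\<in>X. {l y..u y})"
    by auto
  then have "finite ((\<lambda>g. restrict (pos g) X) ` ?F)"
    by (rule finite_subset) (simp add: finite_PiE finite_X)
  moreover have "inj_on (\<lambda>g. restrict (pos g) X) ?F"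
  proof (rule inj_onI)
    fix g h assume g: "g \<in> ?F" and h: "h \<in> ?F" and eq: "restrict (pos g) X = restrict (pos h) X"
    have "pos g y = pos h y" for y
    proof (cases "y \<in> X")
      case True
      then show ?thesis using fun_cong[OF eq, of y] by simp
    qed (use g h pos_supp in auto)
    then have "pos g = pos h" by auto
    then show "g = h" using pos_inj g h by (auto dest: inj_onD)
  qed
  ultimately show ?thesis by (rule finite_imageD)
qed

text \<open>
  A cycle involves finitely many points, which lie in a finite box \<open>[l, u]\<close> of the lattice. Boxes satisfy the closure
  hypothesis of \<open>acyclic_cliques_lattice\<close>.
\<close>

lemma acyclic_edge_cliques: "acyclic_cliques edge (carrier G)"
  unfolding acyclic_cliques_def
proof (intro allI impI, elim conjE)
  fix k and c :: "'a list \<Rightarrow>\<^sub>0 int"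
  assume c: "Poly_Mapping.keys c \<subseteq> cliques edge (carrier G) k" and cycle: "boundary c = 0"
  \<comment> \<open>the unit makes the set nonempty even if the empty simplex is the only one in \<open>c\<close>\<close>
  define V where "V = insert \<one> (\<Union>as\<in>Poly_Mapping.keys c. set as)"
  have V: "finite V" "V \<noteq> {}" "V \<subseteq> carrier G"
    using c by (auto simp: V_def cliques_def)
  define l where "l y = Min ((\<lambda>g. pos g y) ` V)" for y
  define u where "u y = Max ((\<lambda>g. pos g y) ` V)" for y
  have lu: "l y \<le> pos g y" "pos g y \<le> u y" if "g \<in> V" for g y
    using that V by (auto simp: l_def u_def)
  have "l y = 0" if "y \<notin> X" for y
  proof -
    have "l y \<in> (\<lambda>g. pos g y) ` V" unfolding l_def using V by (intro Min_in) auto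
    then show ?thesis using that V pos_supp by auto
  qed
  then obtain b where b: "b \<in> carrier G" "pos b = l" using pos_surj by metis
  let ?F = "{g \<in> carrier G. \<forall>y. l y \<le> pos g y \<and> pos g y \<le> u y}"
  have "acyclic_cliques edge ?F"
  proof (rule acyclic_cliques_lattice[where pos = pos and b = b and X = X])
    show "finite ?F" by (rule finite_box)
    have "\<one> \<in> V" by (simp add: V_def)
    then have "l y \<le> u y" for y using lu order_trans by metis
    then show "b \<in> ?F" using b by simp
    show "inj_on pos ?F" by (rule inj_on_subset[OF pos_inj]) auto
    show "\<exists>m\<in>?F. pos m = (\<lambda>y. max (pos v y - 1) (pos b y))" if v: "v \<in> ?F" for v
    proof -
      have "max (pos v y - 1) (pos b y) = 0" if "y \<notin> X" for y
        using that v b(1) pos_supp by simp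
      then obtain m where m: "m \<in> carrier G" "pos m = (\<lambda>y. max (pos v y - 1) (pos b y))"
        by (rule pos_surj)
      moreover have "l y \<le> pos m y \<and> pos m y \<le> u y" for y
      proof -
        have "l y \<le> pos v y" "pos v y \<le> u y" using v by auto
        then show ?thesis by (simp add: m(2) b(2))
      qed
      ultimately show ?thesis by blast
    qed
  qed (use finite_X pos_supp b in \<open>auto simp: edge_def\<close>)
  moreover have "Poly_Mapping.keys c \<subseteq> cliques edge ?F k"
  proof
    fix as assume as: "as \<in> Poly_Mapping.keys c"
    then have "set as \<subseteq> V" by (auto simp: V_def)
    then have "set as \<subseteq> ?F" using lu V(3) by blast
    then show "as \<in> cliques edge ?F k" using as c by (auto simp: cliques_def)
  qed
  ultimately obtain d where "Poly_Mapping.keys d \<subseteq> cliques edge ?F (Suc k)" "boundary d = c"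
    using cycle unfolding acyclic_cliques_def by blast
  then show "\<exists>d. Poly_Mapping.keys d \<subseteq> cliques edge (carrier G) (Suc k) \<and> boundary d = c"
    using cliques_mono[of ?F "carrier G" edge "Suc k"] by blast
qed

abbreviation translate :: "'a \<Rightarrow> 'a list \<Rightarrow> 'a list" where
  "translate g \<equiv> map ((\<otimes>) g)"

definition chains :: "nat \<Rightarrow> ('a \<Rightarrow>\<^sub>0 int, 'a list \<Rightarrow>\<^sub>0 int) module" where
  "chains k = permutation_module translate (cliques edge (carrier G) (Suc k))"

lemma translate_cliques:
  assumes "g \<in> carrier G" "as \<in> cliques edge (carrier G) k"
  shows "translate g as \<in> cliques edge (carrier G) k"
proof -
  have as: "set as \<subseteq> carrier G" "sorted_wrt edge as" "length as = k"
    using assms(2) by (auto simp: cliques_def)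
  have "edge (g \<otimes> a) (g \<otimes> b)" if "a \<in> set as" "b \<in> set as" "edge a b" for a b
    using edge_mult[OF assms(1) subsetD[OF as(1) that(1)] subsetD[OF as(1) that(2)]] that(3) by simp
  then have "sorted_wrt (\<lambda>a b. edge (g \<otimes> a) (g \<otimes> b)) as"
    using as(2) by (rule sorted_wrt_mono_rel)
  moreover have "set (translate g as) \<subseteq> carrier G"
    using as(1) assms(1) by auto
  ultimately show ?thesis using as(3) by (simp add: cliques_def sorted_wrt_map)
qed

lemma left_module_chains: "left_module (group_ring G) (chains k)"
  unfolding chains_def
proof (rule left_module_permutation_module)
  show "translate (g \<otimes> h) as = translate g (translate h as)"
    if "g \<in> carrier G" "h \<in> carrier G" "as \<in> cliques edge (carrier G) (Suc k)" for g h as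
    using that by (auto simp: cliques_def m_assoc)
  show "translate \<one> as = as" if "as \<in> cliques edge (carrier G) (Suc k)" for as
    using that by (intro map_idI) (auto simp: cliques_def)
qed (rule translate_cliques)

text \<open>
  The representatives of the orbits of simplices: the group acts simply transitively on the
  possible first vertices.
\<close>

definition pointed_cliques :: "nat \<Rightarrow> 'a list set" where
  "pointed_cliques k = {as \<in> cliques edge (carrier G) (Suc k). hd as = \<one>}"

lemma pos_one: "pos \<one> y = 0"
proof -
  obtain \<sigma> where "bij \<sigma>" "\<forall>g\<in>carrier G. \<forall>y. pos (\<one> \<otimes> g) y = pos \<one> y + pos g (\<sigma> y)"
    using pos_mult[OF one_closed] by blast
  then have "pos \<one> y = pos \<one> y + pos \<one> (\<sigma> y)" for y by (metis l_one one_closed)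
  then have "pos \<one> (\<sigma> y) = 0" for y by (metis add_cancel_left_right)
  then show ?thesis using bij_is_surj[OF \<open>bij \<sigma>\<close>] by (metis surjD)
qed

lemma finite_pointed_cliques: "finite (pointed_cliques k)"
proof -
  let ?F = "{g \<in> carrier G. \<forall>y. 0 \<le> pos g y \<and> pos g y \<le> 1}"
  have "as \<in> {as. set as \<subseteq> ?F \<and> length as = Suc k}" if "as \<in> pointed_cliques k" for as
  proof -
    obtain bs where as: "as = \<one> # bs"
      using \<open>as \<in> pointed_cliques k\<close> by (cases as) (auto simp: pointed_cliques_def cliques_def)
    show ?thesis
      using that by (auto simp: pointed_cliques_def cliques_def as edge_def pos_one)
  qed
  then have "pointed_cliques k \<subseteq> {as. set as \<subseteq> ?F \<and> length as = Suc k}" by blast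
  moreover have "finite {as. set as \<subseteq> ?F \<and> length as = Suc k}"
    using finite_lists_length_eq[OF finite_box[of "\<lambda>_. 0" "\<lambda>_. 1"]] by simp
  ultimately show ?thesis by (rule finite_subset)
qed

lemma finite_dual_basis_chains:
  "finite_dual_basis (group_ring G) (chains k) (pointed_cliques k) frag_of
     (\<lambda>b. frag_extend (\<lambda>as. if translate (inv (hd as)) as = b then frag_of (hd as) else 0))"
proof -
  have hd_closed: "hd as \<in> carrier G \<and> as \<noteq> []" if "as \<in> cliques edge (carrier G) (Suc k)" for as
    using that by (cases as) (auto simp: cliques_def)
  have mem: "a \<in> carrier G" if "as \<in> cliques edge (carrier G) (Suc k)" "a \<in> set as" for a as
    using that by (auto simp: cliques_def)
  show ?thesis
    unfolding chains_def
  proof (rule finite_dual_basis_free_action)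
    show "left_module (group_ring G) (permutation_module translate (cliques edge (carrier G) (Suc k)))"
      using left_module_chains by (simp add: chains_def)
    show "finite (pointed_cliques k)" by (rule finite_pointed_cliques)
    show "pointed_cliques k \<subseteq> cliques edge (carrier G) (Suc k)" by (auto simp: pointed_cliques_def)
    fix as assume as: "as \<in> cliques edge (carrier G) (Suc k)"
    show "translate (inv (hd as)) as \<in> pointed_cliques k"
      using hd_closed[OF as] translate_cliques[OF _ as, of "inv (hd as)"]
      by (simp add: pointed_cliques_def hd_map)
    show "hd as \<in> carrier G" using hd_closed[OF as] by simp
    show "translate (hd as) (translate (inv (hd as)) as) = as"
      using hd_closed[OF as] mem[OF as] by (auto simp: m_assoc[symmetric] map_idI)
    fix g assume g: "g \<in> carrier G"
    show "translate g as \<in> cliques edge (carrier G) (Suc k)" by (rule translate_cliques[OF g as])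
    show "hd (translate g as) = g \<otimes> hd as" using hd_closed[OF as] by (simp add: hd_map)
    show "translate (inv hd (translate g as)) (translate g as) = translate (inv (hd as)) as"
      using hd_closed[OF as] mem[OF as] g
      by (auto simp: hd_map inv_mult_group m_assoc) (simp add: m_assoc[symmetric])
  qed
qed

text \<open>
  Along a simplex the coordinate sum grows by at least one in each step, and by at most \<open>card X\<close> altogether.
\<close>

lemma no_long_cliques:
  assumes "as \<in> cliques edge (carrier G) (Suc k)"
  shows "k \<le> card X"
proof -
  define deg where "deg g = (\<Sum>y\<in>X. pos g y)" for g
  have deg_less: "deg g < deg h" if "edge g h" "g \<in> carrier G" "h \<in> carrier G" for g h
  proof -
    obtain y where y: "pos g y \<noteq> pos h y" using \<open>edge g h\<close> by (auto simp: edge_def)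
    then have "y \<in> X" using pos_supp that by metis
    then show ?thesis unfolding deg_def
      using y \<open>edge g h\<close>
      by (intro sum_strict_mono_ex1) (auto simp: finite_X edge_def order.strict_iff_order)
  qed
  have "deg (hd as) + int k \<le> deg (last as)"
    if "as \<in> cliques edge (carrier G) (Suc k)" for as k
    using that
  proof (induction as arbitrary: k rule: rev_induct)
    case (snoc g as)
    show ?case
    proof (cases k)
      case 0
      with snoc.prems have "as = []" by (auto simp: cliques_def)
      then show ?thesis using 0 by simp
    next
      case (Suc l)
      have as: "as \<in> cliques edge (carrier G) (Suc l)" and "as \<noteq> []"
        using snoc.prems Suc by (auto simp: cliques_def sorted_wrt_append)
      have "edge (last as) g" "last as \<in> carrier G" "g \<in> carrier G"
        using snoc.prems \<open>as \<noteq> []\<close> by (auto simp: cliques_def sorted_wrt_append)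
      then have "deg (last as) < deg g" by (rule deg_less)
      then show ?thesis using snoc.IH[OF as] \<open>as \<noteq> []\<close> Suc by simp
    qed
  qed (simp add: cliques_def)
  from this[OF assms] have "deg (hd as) + int k \<le> deg (last as)" .
  moreover have "deg (last as) \<le> deg (hd as) + int (card X)"
  proof -
    have "pos (last as) y \<le> pos (hd as) y + 1" for y
    proof (cases as)
      case (Cons a bs)
      then show ?thesis using assms by (auto simp: cliques_def edge_def)
    qed (use assms in \<open>simp add: cliques_def\<close>)
    then have "deg (last as) \<le> (\<Sum>y\<in>X. pos (hd as) y + 1)"
      unfolding deg_def by (intro sum_mono)
    then show ?thesis by (simp add: deg_def sum.distrib)
  qed
  ultimately show ?thesis by simp
qed

lemma boundary_translate:
  "boundary (frag_action translate r c) = frag_action translate r (boundary c)"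
proof -
  have simplex: "simplex_boundary (translate g as) = frag_map (translate g) (simplex_boundary as)" for g as
    by (induction as) (simp_all add: frag_map_frag_map)
  have "boundary (frag_map (translate g) c) = frag_map (translate g) (boundary c)" for g
    by (induction c rule: frag_induct) (auto simp: simplex)
  then show ?thesis by (induction r rule: frag_induct) auto
qed

text \<open>
  Through this identity, acyclicity in degree \<open>0\<close> becomes exactness at \<open>chains 0\<close> of the resolution.
\<close>

lemma boundary_vertices:
  assumes "Poly_Mapping.keys c \<subseteq> cliques edge (carrier G) (Suc 0)"
  shows "boundary c = frag_cmul (augmentation c) (frag_of [])"
  using assms
proof (induction c rule: frag_induction)
  case (one as)
  then obtain a where "as = [a]" by (auto simp: cliques_def length_Suc_conv)
  then show ?case by simp
qed (auto simp: frag_cmul_diff_distrib)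

theorem resolution:
  "is_resolution (group_ring G) chains (\<lambda>_. boundary) augmentation trivial_module"
  unfolding is_resolution_def
proof (intro conjI allI)
  show "left_module (group_ring G) trivial_module" by (rule left_module_trivial_module)
  show "left_module (group_ring G) (chains i)" for i by (rule left_module_chains)
  show "augmentation \<in> module_hom (group_ring G) (chains 0) trivial_module"
    by (auto simp: module_hom_def chains_def)
  show "boundary \<in> module_hom (group_ring G) (chains (Suc i)) (chains i)" for i
    using boundary_cliques[of _ edge "carrier G" "Suc i"]
    by (simp add: module_hom_def chains_def boundary_translate)
  show "augmentation ` carrier (chains 0) = carrier trivial_module"
  proof -
    have "n \<in> augmentation ` carrier (chains 0)" for n
      by (rule image_eqI[of _ _ "frag_cmul n (frag_of [\<one>])"])
        (auto simp: chains_def cliques_def dest: subsetD[OF keys_cmul])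
    then show ?thesis by auto
  qed
  have exact: "boundary ` carrier (chains (Suc k)) =
      {c. Poly_Mapping.keys c \<subseteq> cliques edge (carrier G) (Suc k) \<and> boundary c = 0}" for k
  proof (intro equalityI subsetI)
    fix c assume "c \<in> boundary ` carrier (chains (Suc k))"
    then obtain d where "Poly_Mapping.keys d \<subseteq> cliques edge (carrier G) (Suc (Suc k))" "c = boundary d"
      by (auto simp: chains_def)
    then show "c \<in> {c. Poly_Mapping.keys c \<subseteq> cliques edge (carrier G) (Suc k) \<and> boundary c = 0}"
      using boundary_cliques[of d edge "carrier G" "Suc k"] by simp
  next
    fix c assume "c \<in> {c. Poly_Mapping.keys c \<subseteq> cliques edge (carrier G) (Suc k) \<and> boundary c = 0}"
    then obtain d where "Poly_Mapping.keys d \<subseteq> cliques edge (carrier G) (Suc (Suc k))" "boundary d = c"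
      using acyclic_edge_cliques unfolding acyclic_cliques_def by blast
    then show "c \<in> boundary ` carrier (chains (Suc k))" by (auto simp: chains_def)
  qed
  show "boundary ` carrier (chains 1) = a_kernel (chains 0) trivial_module augmentation"
    using exact[of 0] by (auto simp: a_kernel_eq chains_def boundary_vertices)
  show "boundary ` carrier (chains (Suc (Suc i))) = a_kernel (chains (Suc i)) (chains i) boundary" for i
    using exact[of "Suc i"] by (auto simp: a_kernel_eq chains_def)
qed

theorem dimension_bounds:
  "cohomological_dimension G \<le> enat (card X)" "homological_dimension G \<le> enat (card X)"
proof -
  have vanish: "carrier (chains i) = {\<zero>\<^bsub>chains i\<^esub>}" if "card X < i" for i
  proof -
    have "cliques edge (carrier G) (Suc i) = {}" using no_long_cliques that by fastforce
    then show ?thesis by (auto simp: chains_def)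
  qed
  show "cohomological_dimension G \<le> enat (card X)" "homological_dimension G \<le> enat (card X)"
    unfolding cohomological_dimension_def homological_dimension_def
    by (rule dimension_le_of_resolution[OF resolution finite_dual_basis_chains vanish]; assumption)+
qed

end

section \<open>Garside structure and dimension of the structure group\<close>

theorem theoremC:
  fixes X :: "'x set" and S :: "'x \<times> 'x \<Rightarrow> 'x \<times> 'x"
  assumes "finite X"
    and "yb_solution X S"
    and "non_degenerate X S"
    and "involutive X S"
    and "braided X S"
  defines "M \<equiv> structure_monoid X S"
    and "G \<equiv> structure_group X S"
  shows "garside_monoid M \<and>
         group_of_fractions M G (structure_map X S) \<and>
         (\<exists>\<Delta>. is_right_lcm M (generators X S) \<Delta> \<and> is_right_lcm M (atoms M) \<Delta> \<and>
              garside_element M \<Delta>) \<and>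
         homological_dimension G \<le> enat (card X) \<and>
         cohomological_dimension G \<le> enat (card X)"
proof -
  interpret yb: yang_baxter X S
    using assms(1-5) by (rule yang_baxter.intro)
  interpret lattice: lattice_group "structure_group X S" X yb.gpos
    using yb.group_G yb.finite_X yb.gpos_bij yb.gpos_mult
    by (simp add: lattice_group_def lattice_group_axioms_def)
  have "garside_monoid M"
    unfolding garside_monoid_def M_def using yb.gaussian yb.garside_\<Delta> by blast
  moreover have "group_of_fractions M G (structure_map X S)"
    unfolding M_def G_def by (rule yb.group_of_fractions_G)
  moreover have "is_right_lcm M (generators X S) yb.\<Delta>" "is_right_lcm M (atoms M) yb.\<Delta>"
    "garside_element M yb.\<Delta>"
    unfolding M_def using yb.\<Delta>_right_lcm yb.atoms_M yb.garside_\<Delta> by simp_all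
  ultimately show ?thesis
    unfolding G_def using lattice.dimension_bounds by blast
qed

end
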